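(* Let $n\in\mathbb{N}$, $n\ge2$, let $b_1=+1$, $b_2=-1$, and let $\eta_0\in(0,\operatorname{diam}(\Omega)/2)$. There exists $\zeta_0>0$ (with $\zeta_0<\eta_0$) such that, if $z(0)\in\mathcal{C}_{n,\zeta_0,\eta_0}$, then there exists $T_{\mathrm{coll}}^{\pm}>0$ such that the evolution $z(t)$ of $$\dot z_i(t)=-\nabla_{z_i}\mathcal{E}_n(z_1(t),\dots,z_n(t)),\qquad i=1,\dots,n,$$ with initial datum $z(0)$ is defined for $t\in[0,T_{\mathrm{coll}}^{\pm}]$, $z(t)\in\Omega^n$ for $t\in[0,T_{\mathrm{coll}}^{\pm})$, $z_1(T_{\mathrm{coll}}^{\pm})=z_2(T_{\mathrm{coll}}^{\pm})\in\Omega$ and $z''(T_{\mathrm{coll}}^{\pm})\in\Omega^{n-2}$. Furthermore, as $\zeta_0\to0$ (that is, with $\Omega,n,\eta_0$ fixed, for all sufficiently small $\zeta_0>0$ and for every $z(0)\in\mathcal{C}_{n,\zeta_0,\eta_0}$, there exists $T_{\mathrm{coll}}^{\pm}>0$ such that the evolution $z(t)$ with initial datum $z(0)$ is defined for $t\in[0,T_{\mathrm{coll}}^{\pm}]$, $z(t)\in\Omega^n$ for $t\in[0,T_{\mathrm{coll}}^{\pm})$, $z_1(T_{\mathrm{coll}}^{\pm})=z_2(T_{\mathrm{coll}}^{\pm})\in\Omega$ and $z''(T_{\mathrm{coll}}^{\pm})\in\Omega^{n-2}$), the following estimate holds: $$T_{\mathrm{coll}}^{\pm}\le\frac{\pi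\zeta_0^2\eta_0^2}{2\big(\eta_0^2-\zeta_0^2-2(n-2)\zeta_0\eta_0\big)}.$$
   Context: $\Omega\subset\mathbb{R}^2$ is a bounded open connected set with $C^2$ boundary. The function $k_\Omega(x,y)$, for $x,y\in\Omega$, is the solution of $-\Delta_x k_\Omega(x,y)=0$ for $x\in\Omega$ and $k_\Omega(x,y)=\frac1{2\pi}\log|x-y|$ for $x\in\partial\Omega$; it is smooth and symmetric on $\Omega\times\Omega$. Set $h_\Omega(x):=k_\Omega(x,x)$. For $n$ dislocations at distinct positions $z_1,\dots,z_n\in\Omega$ with Burgers moduli $b_1,\dots,b_n\in\{-1,+1\}$ (constant in time) the renormalised energy is $$\mathcal{E}_n(z_1,\dots,z_n)=\sum_{i<j}b_ib_j\Big(k_\Omega(z_i,z_j)-\frac1{2\pi}\log|z_i-z_j|\Big)+\frac12\sum_{i=1}^n b_i^2h_\Omega(z_i).$$ Saying that the evolution is defined on $[0,T]$ means that $z$ is continuous on $[0,T]$ and solves the system on $[0,T)$ (with $z_i(t)\neq z_j(t)$ for $i\ne j$ there), its value at $T$ being the limit as $t\uparrow T$. Distances: $d_1(x)=\operatorname{dist}(x,\partial\Omega)$, and for $m\ge2$, $d_m(x_1,\dots,x_m)=\min\{\min_i\operatorname{dist}(x_i,\partial\Omega),\ \min_{i\ne j}|x_i-x_j|\}$. Write $z=(z_1,z_2,z'')$ with $z''=(z_3,\dots,z_n)$. For $0<\zeta<\eta$, $$\mathcal{C}_{n,\zeta,\eta}:=\big\{(z_1,z_2,z'')\in\Omega^n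 : |z_1-z_2|<\zeta,\ d_{n-2}(z'')>\eta,\ \operatorname{dist}\big(\{z_1,z_2\},\{z_3,\dots,z_n\}\cup\partial\Omega\big)>\eta\big\},$$ where for $n=2$ the conditions on $z''$ are void; initial data are understood to have $z_1(0)\ne z_2(0)$. The moduli $b_3,\dots,b_n\in\{-1,+1\}$ are arbitrary. *)

theory Defs
  imports "HOL-Analysis.Analysis"
begin

text \<open>Near each boundary point the set is, in suitable orthonormal coordinates \<open>(u, v)\<close>,
  the region strictly above the graph of a \<open>C\<^sup>2\<close> function.\<close>

definition C2_boundary :: "(real^2) set \<Rightarrow> bool" where
  "C2_boundary \<Omega> \<longleftrightarrow>
    (\<forall>p\<in>frontier \<Omega>. \<exists>r>0. \<exists>u v. \<exists>\<gamma> \<gamma>' \<gamma>'' :: real \<Rightarrow> real.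
       norm u = 1 \<and> norm v = 1 \<and> u \<bullet> v = 0 \<and>
       (\<forall>s. (\<gamma> has_real_derivative \<gamma>' s) (at s)) \<and>
       (\<forall>s. (\<gamma>' has_real_derivative \<gamma>'' s) (at s)) \<and>
       continuous_on UNIV \<gamma>'' \<and>
       \<Omega> \<inter> ball p r = {x \<in> ball p r. \<gamma> (x \<bullet> u) < x \<bullet> v})"

text \<open>Twice continuously differentiable with vanishing Laplacian; \<open>H x\<close> is the Hessian of \<open>f\<close>
  at \<open>x\<close>, and the sum is its trace.\<close>

definition harmonic_on :: "(real^2) set \<Rightarrow> (real^2 \<Rightarrow> real) \<Rightarrow> bool" where
  "harmonic_on S f \<longleftrightarrow>
    (\<exists>(G :: real^2 \<Rightarrow> real^2) (H :: real^2 \<Rightarrow> ((real^2) \<Rightarrow>\<^sub>L (real^2))).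
       (\<forall>x\<in>S. GDERIV f x :> G x) \<and>
       (\<forall>x\<in>S. (G has_derivative blinfun_apply (H x)) (at x)) \<and>
       continuous_on S H \<and>
       (\<forall>x\<in>S. (\<Sum>e\<in>Basis. blinfun_apply (H x) e \<bullet> e) = 0))"

text \<open>\<open>k x y\<close> is \<open>k\<^sub>\<Omega>(x, y)\<close>: for each \<open>y \<in> \<Omega>\<close>, the classical solution in \<open>x\<close> (continuous up to the
  boundary) of the Dirichlet problem. On a bounded \<open>\<Omega>\<close> this determines \<open>k x y\<close> for
  \<open>x \<in> closure \<Omega>\<close> and \<open>y \<in> \<Omega>\<close>, by the maximum principle; other values of \<open>k\<close> are never used.\<close>

definition is_k :: "(real^2) set \<Rightarrow> (real^2 \<Rightarrow> real^2 \<Rightarrow> real) \<Rightarrow> bool" where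
  "is_k \<Omega> k \<longleftrightarrow>
    (\<forall>y\<in>\<Omega>. continuous_on (closure \<Omega>) (\<lambda>x. k x y) \<and>
            harmonic_on \<Omega> (\<lambda>x. k x y) \<and>
            (\<forall>x\<in>frontier \<Omega>. k x y = 1 / (2 * pi) * ln (norm (x - y))))"

text \<open>Configurations are indexed by \<open>{1..n}\<close>; their values at other indices are irrelevant.\<close>

definition energy ::
  "(real^2 \<Rightarrow> real^2 \<Rightarrow> real) \<Rightarrow> (nat \<Rightarrow> real) \<Rightarrow> nat \<Rightarrow> (nat \<Rightarrow> real^2) \<Rightarrow> real" where
  "energy k b n z =
     (\<Sum>i\<in>{1..n}. \<Sum>j\<in>{i<..n}.
        b i * b j * (k (z i) (z j) - 1 / (2 * pi) * ln (norm (z i - z j))))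
     + 1 / 2 * (\<Sum>i\<in>{1..n}. (b i)\<^sup>2 * k (z i) (z i))"

definition burgers_moduli :: "nat \<Rightarrow> (nat \<Rightarrow> real) \<Rightarrow> bool" where
  "burgers_moduli n b \<longleftrightarrow> (\<forall>i\<in>{1..n}. b i \<in> {-1, 1}) \<and> b 1 = 1 \<and> b 2 = -1"

text \<open>\<open>separation \<Omega> I x\<close> is \<open>d\<^sub>m\<close> of the family \<open>(x i)\<close>, \<open>i \<in> I\<close>, with \<open>m = card I \<ge> 1\<close>. For \<open>m = 1\<close>
  there are no pairs and this is the distance to the boundary. It is not meaningful for
  empty \<open>I\<close>.\<close>

definition separation :: "(real^2) set \<Rightarrow> nat set \<Rightarrow> (nat \<Rightarrow> real^2) \<Rightarrow> real" where
  "separation \<Omega> I x =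
     Min ({infdist (x i) (frontier \<Omega>) | i. i \<in> I} \<union>
          {norm (x i - x j) | i j. i \<in> I \<and> j \<in> I \<and> i \<noteq> j})"

definition config_set :: "(real^2) set \<Rightarrow> nat \<Rightarrow> real \<Rightarrow> real \<Rightarrow> (nat \<Rightarrow> real^2) set" where
  "config_set \<Omega> n \<zeta> \<eta> =
    {z. z \<in> {1..n} \<rightarrow> \<Omega> \<and>
        norm (z 1 - z 2) < \<zeta> \<and>
        (3 \<le> n \<longrightarrow> separation \<Omega> {3..n} z > \<eta>) \<and>
        setdist {z 1, z 2} (z ` {3..n} \<union> frontier \<Omega>) > \<eta>}"

text \<open>\<open>z\<close> is an evolution on \<open>[0, T]\<close>. The gradient in \<open>z\<^sub>i\<close> is the gradient of the energy as a
  function of the \<open>i\<close>-th point, the others being held fixed. The derivative at \<open>t = 0\<close> is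
  one-sided. The value at \<open>T\<close> is the limit as \<open>t\<close> increases to \<open>T\<close>, by continuity.\<close>

definition evolution ::
  "(real^2) set \<Rightarrow> (real^2 \<Rightarrow> real^2 \<Rightarrow> real) \<Rightarrow> (nat \<Rightarrow> real) \<Rightarrow> nat \<Rightarrow> real
    \<Rightarrow> (real \<Rightarrow> nat \<Rightarrow> real^2) \<Rightarrow> bool" where
  "evolution \<Omega> k b n T z \<longleftrightarrow>
     (\<forall>i\<in>{1..n}. continuous_on {0..T} (\<lambda>t. z t i)) \<and>
     (\<forall>t\<in>{0..<T}.
        z t \<in> {1..n} \<rightarrow> \<Omega> \<and> inj_on (z t) {1..n} \<and>
        (\<forall>i\<in>{1..n}. \<exists>g.
           GDERIV (\<lambda>x. energy k b n ((z t)(i := x))) (z t i) :> g \<and>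
           ((\<lambda>s. z s i) has_vector_derivative - g) (at t within {0..<T})))"

text \<open>\<open>the_evolution \<Omega> k b n z0 T z\<close>: \<open>z\<close> is an evolution on \<open>[0, T]\<close> starting at \<open>z0\<close>, and every
  evolution starting at \<open>z0\<close> on a possibly shorter time interval agrees with it.\<close>

definition the_evolution ::
  "(real^2) set \<Rightarrow> (real^2 \<Rightarrow> real^2 \<Rightarrow> real) \<Rightarrow> (nat \<Rightarrow> real) \<Rightarrow> nat \<Rightarrow> (nat \<Rightarrow> real^2)
    \<Rightarrow> real \<Rightarrow> (real \<Rightarrow> nat \<Rightarrow> real^2) \<Rightarrow> bool" where
  "the_evolution \<Omega> k b n z0 T z \<longleftrightarrow>
     evolution \<Omega> k b n T z \<and> (\<forall>i\<in>{1..n}. z 0 i = z0 i) \<and>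
     (\<forall>S w. 0 < S \<and> S \<le> T \<and> evolution \<Omega> k b n S w \<and> (\<forall>i\<in>{1..n}. w 0 i = z0 i) \<longrightarrow>
            (\<forall>t\<in>{0..S}. \<forall>i\<in>{1..n}. w t i = z t i))"

definition collision_time ::
  "(real^2) set \<Rightarrow> (real^2 \<Rightarrow> real^2 \<Rightarrow> real) \<Rightarrow> (nat \<Rightarrow> real) \<Rightarrow> nat \<Rightarrow> (nat \<Rightarrow> real^2)
    \<Rightarrow> real \<Rightarrow> bool" where
  "collision_time \<Omega> k b n z0 T \<longleftrightarrow>
     0 < T \<and>
     (\<exists>z. the_evolution \<Omega> k b n z0 T z \<and>
          (\<forall>t\<in>{0..<T}. z t \<in> {1..n} \<rightarrow> \<Omega>) \<and>
          z T 1 = z T 2 \<and> z T 1 \<in> \<Omega> \<and>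
          z T \<in> {3..n} \<rightarrow> \<Omega>)"

end

theory Submission
  imports Defs "HOL-Probability.Discrete_Topology"
begin

text \<open>
  Everything about \<open>k\<close> follows from the maximum principle. Since \<open>x \<mapsto> k x y\<close> solves the Dirichlet
  problem with data \<open>log |x - y| / 2\<pi>\<close>, finite combinations of \<open>k x y\<close> over several \<open>y\<close> are bounded by
  the same combinations of the boundary data. This makes \<open>y \<mapsto> k x y\<close> harmonic, gives \<open>k x y = k y x\<close>, and
  bounds the gradient of \<open>k\<close> by \<open>1 / (2\<pi>d)\<close> at distance \<open>d\<close> from the boundary; a comparison
  argument on a half disc bounds its mixed increments with the constant \<open>7/4 < 2\<close>, which is what the
  stated collision time needs when \<open>n = 2\<close>.

  With \<open>r = |z\<^sub>1 - z\<^sub>2|\<close>, the time change \<open>dt = r\<^sup>2 d\<tau>\<close> removes the singularity of the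
  collision: in \<open>\<tau>\<close> the system is Lipschitz, exists for all time, and \<open>r\<close> decays exponentially, so the
  points move by at most \<open>r(0)\<close> and the collision happens at \<open>T = \<integral> r\<^sup>2 d\<tau>\<close>. With \<open>p = (n - 2) / \<eta>\<close> and
  \<open>q = 1 / \<eta>\<^sup>2\<close>, the function \<open>V = \<pi>/2 (r\<^sup>2 + 2 p r\<^sup>3 + q r\<^sup>4)\<close> satisfies \<open>dV/dt \<le> -1\<close>, whence \<open>T \<le> V(\<zeta>)\<close>.
\<close>

section \<open>Weakly harmonic functions\<close>

text \<open>The hypothesis \<open>is_k\<close> gives regularity of \<open>k\<close> in its first
  variable only, and no bounds. Hence each estimate is first proved for finite increments in the
  second variable, where it is a statement about boundary data, and turns into a gradient bound only
  after dividing by the step \<open>h\<close> and letting \<open>h\<close> tend to 0.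

  The threshold 2 arises as follows. For n = 2, if the mixed increments cost \<open>c q r^2\<close>,
  the distance obeys \<open>dr/dt \<le> - (1 - c q r^2) / (pi r)\<close>, so that T is about
  \<open>pi/2 (\<zeta>^2 + (c/2) q \<zeta>^4)\<close>, whereas the stated bound expands to
  \<open>pi/2 (\<zeta>^2 + q \<zeta>^4 + ...)\<close>. The gradient estimate obtained from the mean
  value property has c = 2; it leaves no room for the motion of the points, which brings them closer
  to the boundary than \<eta>. The constant 7/4 leaves that room.\<close>

definition perp :: "real^2 \<Rightarrow> real^2" where
  "perp e = vector [- e $ 2, e $ 1]"

lemma perp_nth [simp]: "perp e $ 1 = - e $ 2" "perp e $ 2 = e $ 1"
  by (simp_all add: perp_def)

lemma inner_real2: "(x::real^2) \<bullet> y = x $ 1 * y $ 1 + x $ 2 * y $ 2"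
  by (simp add: inner_vec_def sum_2)

lemma norm_perp [simp]: "norm (perp e) = norm e"
  by (simp add: norm_eq_sqrt_inner inner_real2 algebra_simps)

lemma inner_perp [simp]: "e \<bullet> perp e = 0" "perp e \<bullet> e = 0"
  by (simp_all add: inner_real2)

lemma inner_frame:
  assumes "norm e = 1"
  shows "(x \<bullet> e)\<^sup>2 + (x \<bullet> perp e)\<^sup>2 = (norm x)\<^sup>2"
proof -
  have "(norm x)\<^sup>2 * (norm e)\<^sup>2 = (x \<bullet> e)\<^sup>2 + (x \<bullet> perp e)\<^sup>2"
    unfolding power2_norm_eq_inner by (simp add: inner_real2 power2_eq_square algebra_simps)
  thus ?thesis using assms by simp
qed

text \<open>Five-point Laplacian without the factor \<open>1 / h^2\<close>. The frame
  \<open>e\<close>, \<open>perp e\<close> is a parameter because the reflection argument must align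
  it with the segment whose increment it estimates.\<close>

definition disc_lap :: "real^2 \<Rightarrow> (real^2 \<Rightarrow> real) \<Rightarrow> real^2 \<Rightarrow> real \<Rightarrow> real" where
  "disc_lap e u x h = u (x + h *\<^sub>R e) + u (x - h *\<^sub>R e)
     + u (x + h *\<^sub>R perp e) + u (x - h *\<^sub>R perp e) - 4 * u x"

text \<open>Harmonicity through difference quotients: it needs no differentiability, yet suffices for the
  maximum principle, and it can be checked for \<open>y \<mapsto> k x y\<close>, of which no derivative is known a priori.\<close>

definition wharmonic :: "real^2 \<Rightarrow> (real^2) set \<Rightarrow> (real^2 \<Rightarrow> real) \<Rightarrow> bool" where
  "wharmonic e S u \<longleftrightarrow> (\<forall>x\<in>S. ((\<lambda>h. disc_lap e u x h / h\<^sup>2) \<longlongrightarrow> 0) (at_right 0))"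

lemma wharmonic_subset: "wharmonic e S u \<Longrightarrow> T \<subseteq> S \<Longrightarrow> wharmonic e T u"
  by (auto simp: wharmonic_def)

lemma wharmonic_add:
  assumes "wharmonic e S u" "wharmonic e S v"
  shows "wharmonic e S (\<lambda>x. u x + v x)"
  unfolding wharmonic_def
proof
  fix x assume "x \<in> S"
  then have "((\<lambda>h. disc_lap e u x h / h\<^sup>2 + disc_lap e v x h / h\<^sup>2) \<longlongrightarrow> 0 + 0) (at_right 0)"
    using assms by (intro tendsto_add) (auto simp: wharmonic_def)
  moreover have "disc_lap e (\<lambda>x. u x + v x) x h = disc_lap e u x h + disc_lap e v x h" for h
    by (simp add: disc_lap_def)
  ultimately show "((\<lambda>h. disc_lap e (\<lambda>x. u x + v x) x h / h\<^sup>2) \<longlongrightarrow> 0) (at_right 0)"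
    by (simp add: add_divide_distrib)
qed

lemma wharmonic_cmult:
  assumes "wharmonic e S u"
  shows "wharmonic e S (\<lambda>x. c * u x)"
  unfolding wharmonic_def
proof
  fix x assume "x \<in> S"
  then have "((\<lambda>h. c * (disc_lap e u x h / h\<^sup>2)) \<longlongrightarrow> c * 0) (at_right 0)"
    using assms by (intro tendsto_mult_left) (auto simp: wharmonic_def)
  moreover have "disc_lap e (\<lambda>x. c * u x) x h = c * disc_lap e u x h" for h
    by (simp add: disc_lap_def algebra_simps)
  ultimately show "((\<lambda>h. disc_lap e (\<lambda>x. c * u x) x h / h\<^sup>2) \<longlongrightarrow> 0) (at_right 0)"
    by simp
qed

lemma wharmonic_minus: "wharmonic e S u \<Longrightarrow> wharmonic e S (\<lambda>x. - u x)"
  using wharmonic_cmult[of e S u "-1"] by simp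

lemma wharmonic_diff:
  "wharmonic e S u \<Longrightarrow> wharmonic e S v \<Longrightarrow> wharmonic e S (\<lambda>x. u x - v x)"
  using wharmonic_add[OF _ wharmonic_minus] by fastforce

lemma wharmonic_const: "wharmonic e S (\<lambda>x. c)"
  by (simp add: wharmonic_def disc_lap_def)

lemma disc_lap_norm2:
  assumes "norm e = 1"
  shows "disc_lap e (\<lambda>x. (norm x)\<^sup>2) x h = 4 * h\<^sup>2"
proof -
  have "e \<bullet> e = 1" "perp e \<bullet> perp e = 1"
    using assms norm_perp[of e] by (simp_all add: dot_square_norm)
  then show ?thesis
    unfolding disc_lap_def power2_norm_eq_inner
    by (simp add: inner_simps inner_commute power2_eq_square)
qed

text \<open>At a minimum of \<open>u - \<delta> |x|^2\<close> none of the four neighbours is lower,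
  so \<open>disc_lap\<close> of \<open>u\<close> is at least \<open>4 \<delta> h^2\<close>, against
  the limit 0. The boundary condition is a one-sided bound along the approach, because
  \<open>u\<close> may tend to infinity at a pole or have no known continuous extension.\<close>

lemma wharmonic_min_principle:
  fixes u :: "real^2 \<Rightarrow> real"
  assumes S: "open S" "bounded S" and e: "norm e = 1"
    and wh: "wharmonic e S u" and cont: "continuous_on S u"
    and bd: "\<And>p \<epsilon>. p \<in> frontier S \<Longrightarrow> 0 < \<epsilon> \<Longrightarrow> \<forall>\<^sub>F x in at p within S. - \<epsilon> < u x"
    and x0: "x0 \<in> S"
  shows "0 \<le> u x0"
proof (rule ccontr)
  assume "\<not> 0 \<le> u x0"
  define \<epsilon> where "\<epsilon> = - u x0 / 2"
  have \<epsilon>: "0 < \<epsilon>" "u x0 = - 2 * \<epsilon>" using \<open>\<not> 0 \<le> u x0\<close> by (auto simp: \<epsilon>_def)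
  \<comment> \<open>By \<open>bd\<close> this set cannot accumulate at the frontier, so it is
    compact although \<open>S\<close> is open.\<close>
  define K where "K = {x \<in> S. u x \<le> - \<epsilon>}"
  have "closed K"
    unfolding closed_sequential_limits
  proof (intro allI impI, elim conjE)
    fix s l assume s: "\<forall>n. s n \<in> K" and lim: "s \<longlonglongrightarrow> l"
    have sS: "s n \<in> S" "u (s n) \<le> - \<epsilon>" for n using s by (auto simp: K_def)
    have "l \<in> closure S" using sS(1) lim by (auto simp: closure_sequential)
    have "l \<in> S"
    proof (rule ccontr)
      assume "l \<notin> S"
      then have "l \<in> frontier S" using \<open>l \<in> closure S\<close> S(1) by (simp add: frontier_def interior_open)
      from bd[OF this \<epsilon>(1)] have "\<forall>\<^sub>F x in at l within S. - \<epsilon> < u x" .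
      moreover have "filterlim s (at l within S) sequentially"
        unfolding filterlim_at using lim sS(1) \<open>l \<notin> S\<close> by (auto intro!: always_eventually)
      ultimately have "\<forall>\<^sub>F n in sequentially. - \<epsilon> < u (s n)"
        by (rule eventually_compose_filterlim)
      then obtain n where "- \<epsilon> < u (s n)" by (auto simp: eventually_sequentially)
      with sS(2)[of n] show False by simp
    qed
    then have "isCont u l" using cont S(1) by (simp add: continuous_on_eq_continuous_at)
    then have "(\<lambda>n. u (s n)) \<longlonglongrightarrow> u l" using lim by (rule isCont_tendsto_compose)
    then have "u l \<le> - \<epsilon>" using sS(2) by (intro LIMSEQ_le_const2) auto
    then show "l \<in> K" using \<open>l \<in> S\<close> by (simp add: K_def)
  qed
  moreover have "bounded K" using S(2) by (rule bounded_subset) (auto simp: K_def)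
  ultimately have "compact K" by (simp add: compact_eq_bounded_closed)
  obtain B where B: "0 < B" "\<And>x. x \<in> S \<Longrightarrow> norm x \<le> B" using S(2) by (auto simp: bounded_pos)
  \<comment> \<open>The perturbation is then at most \<open>\<epsilon> / 2\<close>: off
    \<open>K\<close> the value of \<open>v\<close> exceeds \<open>- 3 / 2 * \<epsilon>\<close>,
    while \<open>v x0 \<le> - 2 * \<epsilon>\<close>, so the minimum over \<open>K\<close> is a
    minimum over \<open>S\<close>.\<close>
  define \<delta> where "\<delta> = \<epsilon> / (2 * B\<^sup>2)"
  have \<delta>: "0 < \<delta>" "\<delta> * B\<^sup>2 = \<epsilon> / 2" using \<epsilon> B by (auto simp: \<delta>_def)
  define v where "v x = u x - \<delta> * (norm x)\<^sup>2" for x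
  have "continuous_on K v" unfolding v_def K_def
    by (intro continuous_intros continuous_on_subset[OF cont]) auto
  moreover have "x0 \<in> K" using x0 \<epsilon> by (simp add: K_def)
  ultimately obtain p where p: "p \<in> K" "\<And>x. x \<in> K \<Longrightarrow> v p \<le> v x"
    using continuous_attains_inf[OF \<open>compact K\<close>] by blast
  have vp: "v p \<le> v x" if "x \<in> S" for x
  proof (cases "x \<in> K")
    case False
    then have "- \<epsilon> < u x" using that by (auto simp: K_def)
    moreover have "\<delta> * (norm x)\<^sup>2 \<le> \<delta> * B\<^sup>2" using \<delta> B(2)[OF that] by (intro mult_left_mono power_mono) auto
    ultimately have "- 3 / 2 * \<epsilon> < v x" unfolding v_def using \<delta>(2) by linarith
    moreover have "v x0 \<le> - 2 * \<epsilon>" using \<epsilon> \<delta> by (simp add: v_def)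
    ultimately show ?thesis using p(2)[OF \<open>x0 \<in> K\<close>] \<epsilon> by linarith
  qed (use p in auto)
  have "p \<in> S" using p by (simp add: K_def)
  obtain r where r: "0 < r" "ball p r \<subseteq> S" using S(1) \<open>p \<in> S\<close> openE by blast
  have "4 * \<delta> \<le> disc_lap e u p h / h\<^sup>2" if h: "0 < h" "h < r" for h
  proof -
    have "p + h *\<^sub>R e \<in> S" "p - h *\<^sub>R e \<in> S" "p + h *\<^sub>R perp e \<in> S" "p - h *\<^sub>R perp e \<in> S"
      using r h e by (auto intro!: subsetD[OF r(2)] simp: dist_norm)
    then have "0 \<le> disc_lap e v p h" using vp unfolding disc_lap_def
      by (smt (verit))
    also have "\<dots> = disc_lap e u p h - \<delta> * disc_lap e (\<lambda>x. (norm x)\<^sup>2) p h"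
      by (simp add: disc_lap_def v_def algebra_simps)
    finally show ?thesis using h disc_lap_norm2[OF e] by (simp add: field_simps)
  qed
  then have "\<forall>\<^sub>F h in at_right 0. 4 * \<delta> \<le> disc_lap e u p h / h\<^sup>2"
    using r(1) by (auto simp: eventually_at_right_field)
  moreover have "((\<lambda>h. disc_lap e u p h / h\<^sup>2) \<longlongrightarrow> 0) (at_right 0)"
    using wh \<open>p \<in> S\<close> by (simp add: wharmonic_def)
  ultimately have "4 * \<delta> \<le> 0" by (intro tendsto_lowerbound) auto
  with \<delta>(1) show False by simp
qed

lemma wharmonic_nonneg:
  fixes u :: "real^2 \<Rightarrow> real"
  assumes "open S" "bounded S" "norm e = 1" "wharmonic e S u" "continuous_on (closure S) u"
    and bd: "\<And>p. p \<in> frontier S \<Longrightarrow> 0 \<le> u p" and "x \<in> S"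
  shows "0 \<le> u x"
proof (rule wharmonic_min_principle[where u=u and S=S and e=e])
  show "continuous_on S u" using assms(5) closure_subset by (rule continuous_on_subset)
  fix p \<epsilon> :: real assume "0 < \<epsilon>"
  fix p assume p: "p \<in> frontier S"
  have "(u \<longlongrightarrow> u p) (at p within closure S)"
    using assms(5) p by (auto simp: continuous_on_def frontier_def)
  then have "(u \<longlongrightarrow> u p) (at p within S)" by (rule tendsto_within_subset) (rule closure_subset)
  then show "\<forall>\<^sub>F x in at p within S. - \<epsilon> < u x"
    using bd[OF p] \<open>0 < \<epsilon>\<close> by (intro order_tendstoD(1)) auto
qed (use assms in auto)

lemma wharmonic_abs_le:
  fixes u :: "real^2 \<Rightarrow> real"
  assumes "open S" "bounded S" "norm e = 1" "wharmonic e S u" "continuous_on (closure S) u"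
    and bd: "\<And>p. p \<in> frontier S \<Longrightarrow> \<bar>u p\<bar> \<le> M" and "x \<in> S"
  shows "\<bar>u x\<bar> \<le> M"
proof -
  have "0 \<le> M - u x"
    by (rule wharmonic_nonneg[OF assms(1-3)])
      (use assms bd in \<open>auto intro!: wharmonic_diff wharmonic_const continuous_intros dest!: bd\<close>)
  moreover have "0 \<le> M + u x"
    by (rule wharmonic_nonneg[OF assms(1-3)])
      (use assms bd in \<open>auto intro!: wharmonic_add wharmonic_const continuous_intros dest!: bd\<close>)
  ultimately show ?thesis by linarith
qed

section \<open>From classical to weak harmonicity\<close>

lemma second_difference_tendsto:
  fixes f :: "real^2 \<Rightarrow> real"
  assumes S: "open S" "x \<in> S"
    and G: "\<And>y. y \<in> S \<Longrightarrow> GDERIV f y :> G y"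
    and H: "(G has_derivative H) (at x)" and e: "norm e = 1"
  shows "((\<lambda>h. (f (x + h *\<^sub>R e) + f (x - h *\<^sub>R e) - 2 * f x) / h\<^sup>2) \<longlongrightarrow> H e \<bullet> e) (at_right 0)"
proof -
  obtain r where r: "0 < r" "ball x r \<subseteq> S" using S openE by blast
  let ?n = "\<lambda>h. f (x + h *\<^sub>R e) + f (x - h *\<^sub>R e) - 2 * f x"
  let ?d = "\<lambda>h. G (x + h *\<^sub>R e) \<bullet> e - G (x - h *\<^sub>R e) \<bullet> e"
  have inS: "x + h *\<^sub>R e \<in> S" "x - h *\<^sub>R e \<in> S" if "\<bar>h\<bar> < r" for h
    using that r e by (auto intro!: subsetD[OF r(2)] simp: dist_norm)
  have der: "(?n has_real_derivative ?d h) (at h)" if "\<bar>h\<bar> < r" for h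
  proof -
    have 1: "(f has_derivative (\<lambda>v. v \<bullet> G (x + h *\<^sub>R e))) (at (x + h *\<^sub>R e))"
      "(f has_derivative (\<lambda>v. v \<bullet> G (x - h *\<^sub>R e))) (at (x - h *\<^sub>R e))"
      using G inS[OF that] by (auto simp: gderiv_def)
    have "(?n has_derivative (\<lambda>t. (t *\<^sub>R e) \<bullet> G (x + h *\<^sub>R e) + (- (t *\<^sub>R e)) \<bullet> G (x - h *\<^sub>R e) - 0)) (at h)"
      by (intro has_derivative_diff has_derivative_add has_derivative_const
          has_derivative_compose[where g=f and f="\<lambda>h. x + h *\<^sub>R e", OF _ 1(1)]
          has_derivative_compose[where g=f and f="\<lambda>h. x - h *\<^sub>R e", OF _ 1(2)])
        (auto intro!: derivative_eq_intros)
    moreover have "(\<lambda>t. (t *\<^sub>R e) \<bullet> G (x + h *\<^sub>R e) + (- (t *\<^sub>R e)) \<bullet> G (x - h *\<^sub>R e) - 0) = (*) (?d h)"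
      by (simp add: fun_eq_iff inner_commute algebra_simps)
    ultimately show ?thesis unfolding has_field_derivative_def by (rule has_derivative_eq_rhs)
  qed
  have dd: "(?d has_real_derivative 2 * (H e \<bullet> e)) (at 0)"
  proof -
    have H': "(G has_derivative H) (at (x + 0 *\<^sub>R e))" "(G has_derivative H) (at (x - 0 *\<^sub>R e))" using H by auto
    have lin: "linear H" using H has_derivative_bounded_linear bounded_linear.linear by blast
    have "(?d has_derivative (\<lambda>t. H (t *\<^sub>R e) \<bullet> e - H (- (t *\<^sub>R e)) \<bullet> e)) (at 0)"
      by (intro has_derivative_diff has_derivative_inner_left
          has_derivative_compose[where g=G and f="\<lambda>h. x + h *\<^sub>R e", OF _ H'(1)]
          has_derivative_compose[where g=G and f="\<lambda>h. x - h *\<^sub>R e", OF _ H'(2)])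
        (auto intro!: derivative_eq_intros)
    then show ?thesis
      by (simp add: has_field_derivative_def linear_cmul[OF lin] linear_neg[OF lin] algebra_simps mult_commute_abs)
  qed
  have "((\<lambda>h. ?d h / h) \<longlongrightarrow> 2 * (H e \<bullet> e)) (at 0)"
    using dd by (simp add: has_field_derivative_iff)
  then have "((\<lambda>h. ?d h / h) \<longlongrightarrow> 2 * (H e \<bullet> e)) (at_right 0)"
    by (rule tendsto_within_subset) simp
  from tendsto_divide[OF this tendsto_const[of 2]]
  have lim: "((\<lambda>h. ?d h / (2 * h)) \<longlongrightarrow> H e \<bullet> e) (at_right 0)"
    by (simp add: mult.commute)
  have evr: "\<forall>\<^sub>F h in at_right 0. P h" if "\<And>h. 0 < h \<Longrightarrow> h < r \<Longrightarrow> P h" for P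
    using that r(1) by (auto simp: eventually_at_right_field)
  have "isCont ?n 0" using der[of 0] r(1) DERIV_isCont by simp
  then have n0: "(?n \<longlongrightarrow> 0) (at_right 0)"
    unfolding isCont_def using tendsto_within_subset[of ?n _ 0 UNIV "{0<..}"] by simp
  show ?thesis
  \<comment> \<open>One application of l'Hopital leaves a central difference quotient of the
    gradient, whose limit follows from differentiability of \<open>G\<close> at the single point
    \<open>x\<close>.\<close>
  proof (rule lhopital_right_0[where f'="?d" and g'="\<lambda>h. 2 * h"])
    show "((\<lambda>h. h\<^sup>2) \<longlongrightarrow> 0) (at_right (0::real))" by (auto intro!: tendsto_eq_intros)
    show "\<forall>\<^sub>F h in at_right 0. DERIV ?n h :> ?d h" by (rule evr) (auto intro!: der)
  qed (use lim n0 in \<open>auto intro!: evr derivative_eq_intros\<close>)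
qed

text \<open>Frame invariance of the trace: with it a harmonic function is \<open>wharmonic\<close>
  for every unit vector \<open>e\<close>, not only along the axes.\<close>

lemma trace_frame:
  fixes H :: "real^2 \<Rightarrow> real^2"
  assumes lin: "linear H" and e: "norm e = 1"
  shows "H e \<bullet> e + H (perp e) \<bullet> perp e = (\<Sum>b\<in>Basis. H b \<bullet> b)"
proof -
  have dec: "H v = v $ 1 *\<^sub>R H (axis 1 1) + v $ 2 *\<^sub>R H (axis 2 1)" for v
  proof -
    have "v = v $ 1 *\<^sub>R axis 1 1 + v $ 2 *\<^sub>R axis 2 1" by (simp add: vec_eq_iff forall_2 axis_def)
    then have "H v = H (v $ 1 *\<^sub>R axis 1 1 + v $ 2 *\<^sub>R axis 2 1)" by simp
    then show ?thesis by (simp add: linear_add[OF lin] linear_cmul[OF lin])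
  qed
  have sq: "e $ 1 * e $ 1 + e $ 2 * e $ 2 = 1" using e by (simp add: norm_eq_sqrt_inner inner_real2)
  have "(\<Sum>b\<in>Basis. H b \<bullet> b) = H (axis 1 1) $ 1 + H (axis 2 1) $ 2"
  proof -
    have bas: "(Basis :: (real^2) set) = {axis 1 1, axis 2 1}"
      by (auto simp: Basis_vec_def UNIV_2)
    have ne: "axis 1 1 \<noteq> (axis 2 1 :: real^2)" by (simp add: axis_eq_axis)
    have two: "(\<Sum>b\<in>{p, q}. H b \<bullet> b) = H p \<bullet> p + H q \<bullet> q" if "p \<noteq> q" for p q using that by simp
    have "(\<Sum>b\<in>Basis. H b \<bullet> b) = H (axis 1 1) \<bullet> axis 1 1 + H (axis 2 1) \<bullet> axis 2 1"
      unfolding bas by (rule two[OF ne])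
    then show ?thesis by (simp add: inner_axis)
  qed
  moreover have "H e \<bullet> e + H (perp e) \<bullet> perp e
      = (e $ 1 * e $ 1 + e $ 2 * e $ 2) * (H (axis 1 1) $ 1 + H (axis 2 1) $ 2)"
  proof -
    define A B where "A = H (axis 1 1)" and "B = H (axis 2 1)"
    have "H v = v $ 1 *\<^sub>R A + v $ 2 *\<^sub>R B" for v unfolding A_def B_def by (rule dec)
    then have "H e = e $ 1 *\<^sub>R A + e $ 2 *\<^sub>R B" "H (perp e) = perp e $ 1 *\<^sub>R A + perp e $ 2 *\<^sub>R B" by blast+
    then show ?thesis
      unfolding A_def[symmetric] B_def[symmetric] by (simp only:) (simp add: inner_real2 algebra_simps)
  qed
  ultimately show ?thesis using sq by simp
qed

lemma harmonic_on_wharmonic: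
  assumes "harmonic_on S f" "open S" "norm e = 1"
  shows "wharmonic e S f"
  unfolding wharmonic_def
proof
  fix x assume x: "x \<in> S"
  from assms(1) obtain G H where G: "\<And>x. x \<in> S \<Longrightarrow> GDERIV f x :> G x"
    and H: "\<And>x. x \<in> S \<Longrightarrow> (G has_derivative blinfun_apply (H x)) (at x)"
    and tr: "\<And>x. x \<in> S \<Longrightarrow> (\<Sum>e\<in>Basis. blinfun_apply (H x) e \<bullet> e) = 0"
    unfolding harmonic_on_def by blast
  have "norm (perp e) = 1" using assms(3) by simp
  from tendsto_add[OF second_difference_tendsto[OF assms(2) x G H[OF x] assms(3)]
      second_difference_tendsto[OF assms(2) x G H[OF x] this]]
  have "((\<lambda>h. (f (x + h *\<^sub>R e) + f (x - h *\<^sub>R e) - 2 * f x) / h\<^sup>2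
      + (f (x + h *\<^sub>R perp e) + f (x - h *\<^sub>R perp e) - 2 * f x) / h\<^sup>2) \<longlongrightarrow> 0) (at_right 0)"
    using trace_frame[OF bounded_linear.linear[OF blinfun.bounded_linear_right[of "H x"]] assms(3)] tr[OF x]
    by simp
  moreover have "(f (x + h *\<^sub>R e) + f (x - h *\<^sub>R e) - 2 * f x) / h\<^sup>2
      + (f (x + h *\<^sub>R perp e) + f (x - h *\<^sub>R perp e) - 2 * f x) / h\<^sup>2 = disc_lap e f x h / h\<^sup>2" for h
    unfolding disc_lap_def add_divide_distrib[symmetric] by (rule arg_cong2[where f="(/)"]) auto
  ultimately show "((\<lambda>h. disc_lap e f x h / h\<^sup>2) \<longlongrightarrow> 0) (at_right 0)" by simp
qed

section \<open>The logarithmic potential and the Lipschitz estimate\<close>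

definition fundsol :: "real^2 \<Rightarrow> real" where
  "fundsol z = 1 / (2 * pi) * ln (norm z)"

text \<open>Inversion in the unit circle; divided by \<open>2 * pi\<close> it is the gradient of
  \<open>fundsol\<close>.\<close>

definition vinv :: "real^2 \<Rightarrow> real^2" where
  "vinv z = z /\<^sub>R (norm z)\<^sup>2"

lemma disc_lap_translate: "disc_lap e (\<lambda>x. f (x - y)) x h = disc_lap e f (x - y) h"
  by (simp add: disc_lap_def algebra_simps)

lemma disc_lap_reflect: "disc_lap e (\<lambda>y. f (x - y)) y h = disc_lap e f (x - y) h"
  by (simp add: disc_lap_def algebra_simps)

lemma disc_lap_cmult: "disc_lap e (\<lambda>x. c * f x) x h = c * disc_lap e f x h"
  by (simp add: disc_lap_def algebra_simps)

text \<open>In complex notation the four shifted norms multiply to \<open>|z\<^sup>4 - h\<^sup>4|\<close>.\<close>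

lemma disc_lap_ln_norm:
  assumes e: "norm e = 1" and z: "z \<noteq> 0" and h: "6 * h ^ 4 \<le> (norm z) ^ 4"
  shows "\<bar>disc_lap e (\<lambda>x. ln (norm x)) z h\<bar> \<le> 3 * h ^ 4 / (norm z) ^ 4"
proof -
  define N where "N = (norm z)\<^sup>2"
  define a where "a = z \<bullet> e"
  define b where "b = z \<bullet> perp e"
  have N: "0 < N" "N = a\<^sup>2 + b\<^sup>2" "N\<^sup>2 = (norm z) ^ 4" using z inner_frame[OF e, of z]
    by (auto simp: N_def a_def b_def)
  have ee: "e \<bullet> e = 1" "perp e \<bullet> perp e = 1"
    using e norm_perp[of e] by (simp_all add: dot_square_norm)
  have A: "(norm (z + h *\<^sub>R e))\<^sup>2 = N + 2 * h * a + h\<^sup>2" "(norm (z - h *\<^sub>R e))\<^sup>2 = N - 2 * h * a + h\<^sup>2"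
     "(norm (z + h *\<^sub>R perp e))\<^sup>2 = N + 2 * h * b + h\<^sup>2" "(norm (z - h *\<^sub>R perp e))\<^sup>2 = N - 2 * h * b + h\<^sup>2"
    unfolding N_def a_def b_def power2_norm_eq_inner
    using ee by (simp_all add: inner_simps inner_commute power2_eq_square)
  have hz: "\<bar>h\<bar> < norm z"
  proof (rule ccontr)
    assume "\<not> ?thesis"
    then have "(norm z) ^ 4 \<le> \<bar>h\<bar> ^ 4" by (intro power_mono) auto
    moreover have "0 < (norm z) ^ 4" using z by simp
    ultimately show False using h by simp
  qed
  have nz: "z + v \<noteq> 0" if "norm v = \<bar>h\<bar>" for v
    using that hz by (metis add.commute add.right_inverse add_left_cancel less_irrefl norm_minus_cancel)
  have p: "0 < norm (z + h *\<^sub>R e)" "0 < norm (z - h *\<^sub>R e)"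
    "0 < norm (z + h *\<^sub>R perp e)" "0 < norm (z - h *\<^sub>R perp e)"
    using nz[of "h *\<^sub>R e"] nz[of "- (h *\<^sub>R e)"] nz[of "h *\<^sub>R perp e"] nz[of "- (h *\<^sub>R perp e)"] e by auto
  define P where "P = (N + 2 * h * a + h\<^sup>2) * (N - 2 * h * a + h\<^sup>2) * ((N + 2 * h * b + h\<^sup>2) * (N - 2 * h * b + h\<^sup>2))"
  have "2 * disc_lap e (\<lambda>x. ln (norm x)) z h = ln ((norm (z + h *\<^sub>R e))\<^sup>2) + ln ((norm (z - h *\<^sub>R e))\<^sup>2)
     + (ln ((norm (z + h *\<^sub>R perp e))\<^sup>2) + ln ((norm (z - h *\<^sub>R perp e))\<^sup>2)) - ln (((norm z)\<^sup>2) ^ 4)"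
    using p z by (simp add: disc_lap_def ln_realpow)
  also have "\<dots> = ln (P / N ^ 4)"
  proof -
    have "0 < (norm (z + h *\<^sub>R e))\<^sup>2" "0 < (norm (z - h *\<^sub>R e))\<^sup>2"
      "0 < (norm (z + h *\<^sub>R perp e))\<^sup>2" "0 < (norm (z - h *\<^sub>R perp e))\<^sup>2"
      using p by (auto simp only: zero_less_power)
    then show ?thesis unfolding A P_def using N(1)
      by (simp add: ln_mult ln_div N_def[symmetric])
  qed
  finally have eq: "2 * disc_lap e (\<lambda>x. ln (norm x)) z h = ln (P / N ^ 4)" .
  \<comment> \<open>The hypothesis on \<open>h\<close> says \<open>q \<le> 1 / 6\<close>; it makes
    the quantity \<open>x\<close> below at most \<open>3 * q \<le> 1 / 2\<close>, the range of the
    quadratic estimate for \<open>ln (1 + x)\<close>.\<close>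
  define q where "q = h ^ 4 / N\<^sup>2"
  have "0 < N\<^sup>2" using N(1) by simp
  then have q: "0 \<le> q" "q \<le> 1 / 6" "h ^ 4 = q * N\<^sup>2" using h unfolding N(3)[symmetric] by (auto simp: q_def divide_simps)
  define c where "c = a\<^sup>2 * b\<^sup>2 / N\<^sup>2"
  have "4 * (a\<^sup>2 * b\<^sup>2) \<le> N\<^sup>2"
  proof -
    have "0 \<le> (a\<^sup>2 - b\<^sup>2)\<^sup>2" by simp
    then show ?thesis unfolding N(2) by (simp add: power2_eq_square algebra_simps)
  qed
  then have c: "0 \<le> c" "c \<le> 1 / 4" "a\<^sup>2 * b\<^sup>2 = c * N\<^sup>2" using N(1) by (auto simp: c_def field_simps)
  \<comment> \<open>In complex notation \<open>z = a + i b\<close>, the real part of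
    \<open>z^4\<close> is \<open>N^2 - 8 a^2 b^2\<close>; this is \<open>|z^4 - h^4|^2\<close>
    expanded and regrouped.\<close>
  have "P = (N\<^sup>2 - h ^ 4)\<^sup>2 + 16 * h ^ 4 * (a\<^sup>2 * b\<^sup>2)"
    unfolding P_def N(2) by algebra
  also have "\<dots> = N ^ 4 * ((1 - q)\<^sup>2 + 16 * q * c)"
    unfolding q(3) c(3) by algebra
  finally have "P / N ^ 4 = (1 - q)\<^sup>2 + 16 * q * c" using N(1) by simp
  then have t: "P / N ^ 4 = 1 + (q * (16 * c - 2) + q\<^sup>2)"
    by (simp add: power2_eq_square algebra_simps)
  define x where "x = q * (16 * c - 2) + q\<^sup>2"
  have "q * q \<le> q * (1/6)" using q by (intro mult_left_mono)
  moreover have "0 \<le> q * c" "q * c \<le> q * (1/4)" using mult_left_mono[OF c(2) q(1)] q c by auto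
  ultimately have x: "\<bar>x\<bar> \<le> 3 * q" using q(1) unfolding x_def power2_eq_square abs_le_iff
    by (auto simp: algebra_simps)
  then have "\<bar>x\<bar> \<le> 1/2" using q by linarith
  then have "\<bar>ln (1 + x) - x\<bar> \<le> 2 * x\<^sup>2" by (rule abs_ln_one_plus_x_minus_x_bound)
  moreover have "x\<^sup>2 \<le> 1/2 * \<bar>x\<bar>"
    using mult_right_mono[OF \<open>\<bar>x\<bar> \<le> 1/2\<close>, of "\<bar>x\<bar>"] by (simp add: power2_eq_square)
  ultimately have "\<bar>ln (1 + x)\<bar> \<le> 2 * \<bar>x\<bar>" by linarith
  with x have "\<bar>2 * disc_lap e (\<lambda>x. ln (norm x)) z h\<bar> \<le> 6 * q" unfolding eq t x_def[symmetric] by linarith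
  then show ?thesis unfolding q_def N(3) by simp
qed

text \<open>Uniformity over all \<open>z\<close> with \<open>d \<le> norm z\<close> is the point:
  such a bound can be carried by the maximum principle from the boundary into the domain, and the
  order \<open>h^4\<close> survives the division by \<open>h^2\<close>.\<close>

lemma disc_lap_fundsol:
  assumes "norm e = 1" "d > 0" "d \<le> norm z" and h: "6 * h ^ 4 \<le> d ^ 4"
  shows "\<bar>disc_lap e fundsol z h\<bar> \<le> 3 * h ^ 4 / (2 * pi * d ^ 4)"
proof -
  have "d ^ 4 \<le> norm z ^ 4" using assms by (intro power_mono) auto
  have "\<bar>disc_lap e fundsol z h\<bar> = 1 / (2 * pi) * \<bar>disc_lap e (\<lambda>x. ln (norm x)) z h\<bar>"
    unfolding fundsol_def[abs_def] disc_lap_cmult by (simp add: abs_mult)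
  also have "\<dots> \<le> 1 / (2 * pi) * (3 * h ^ 4 / (norm z) ^ 4)"
    by (intro mult_left_mono disc_lap_ln_norm) (use assms \<open>d ^ 4 \<le> norm z ^ 4\<close> in \<open>auto intro: order_trans\<close>)
  also have "\<dots> \<le> 1 / (2 * pi) * (3 * h ^ 4 / d ^ 4)"
    using assms \<open>d ^ 4 \<le> norm z ^ 4\<close> by (intro mult_left_mono divide_left_mono mult_pos_pos zero_less_power) auto
  finally show ?thesis by simp
qed

lemma quartic_div_square_tendsto: "((\<lambda>h::real. c * h ^ 4 / h\<^sup>2) \<longlongrightarrow> 0) (at_right 0)"
proof -
  have "((\<lambda>h::real. c * h\<^sup>2) \<longlongrightarrow> 0) (at_right 0)" by (auto intro!: tendsto_eq_intros)
  moreover have "c * h ^ 4 / h\<^sup>2 = c * h\<^sup>2" if "h > 0" for h :: real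
    using that by (simp add: field_simps power_eq_if)
  ultimately show ?thesis
    by (auto elim!: Lim_transform_eventually simp: eventually_at_right_field intro!: exI[of _ 1])
qed

lemma disc_lap_tendstoI:
  assumes "d > 0" and "\<And>h. 0 < h \<Longrightarrow> h < d \<Longrightarrow> \<bar>disc_lap e u x h\<bar> \<le> c * h ^ 4"
  shows "((\<lambda>h. disc_lap e u x h / h\<^sup>2) \<longlongrightarrow> 0) (at_right 0)"
proof (rule Lim_null_comparison[OF _ quartic_div_square_tendsto])
  show "\<forall>\<^sub>F h in at_right 0. norm (disc_lap e u x h / h\<^sup>2) \<le> c * h ^ 4 / h\<^sup>2"
    using assms by (auto simp: eventually_at_right_field intro!: exI[of _ d] divide_right_mono)
qed

lemma wharmonic_fundsol:
  assumes "norm e = 1" "y \<notin> S"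
  shows "wharmonic e S (\<lambda>x. fundsol (x - y))"
  unfolding wharmonic_def
proof
  fix x assume "x \<in> S"
  let ?d = "norm (x - y)"
  have d: "0 < ?d" using assms \<open>x \<in> S\<close> by auto
  show "((\<lambda>h. disc_lap e (\<lambda>x. fundsol (x - y)) x h / h\<^sup>2) \<longlongrightarrow> 0) (at_right 0)"
  proof (rule disc_lap_tendstoI)
    show "0 < ?d / 6" using d by simp
    fix h assume h: "0 < h" "h < ?d / 6"
    then have "h ^ 4 \<le> (?d / 6) ^ 4" by (intro power_mono) auto
    then have "1296 * h ^ 4 \<le> ?d ^ 4" unfolding power_divide by simp
    moreover have "0 \<le> h ^ 4" by simp
    ultimately have "6 * h ^ 4 \<le> ?d ^ 4" by linarith
    from disc_lap_fundsol[OF assms(1) d order_refl this]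
    show "\<bar>disc_lap e (\<lambda>x. fundsol (x - y)) x h\<bar> \<le> 3 / (2 * pi * ?d ^ 4) * h ^ 4"
      by (simp add: disc_lap_translate)
  qed
qed

text \<open>On the half disc \<open>D\<close>, the difference of \<open>u\<close> and its reflection is dominated by \<open>2 M w\<close>, where the
  harmonic cubic \<open>w\<close> is nonnegative on the diameter and equals \<open>1 + a (1 - a)\<^sup>2\<close> on the arc.\<close>

lemma wharmonic_reflection_estimate:
  fixes u :: "real^2 \<Rightarrow> real"
  assumes e: "norm e = 1" and U: "cball m r \<subseteq> U" and r: "0 < r"
    and wh: "wharmonic e U u" and cont: "continuous_on U u"
    and M: "\<And>x. x \<in> U \<Longrightarrow> \<bar>u x\<bar> \<le> M" and s: "0 < s" "s < r"
  shows "u (m + s *\<^sub>R e) - u (m - s *\<^sub>R e) \<le> 7 / 2 * M * s / r"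
proof -
  define R where "R x = x - (2 * ((x - m) \<bullet> e)) *\<^sub>R e" for x
  define a where "a x = (x - m) \<bullet> e / r" for x
  define b where "b x = (x - m) \<bullet> perp e / r" for x
  \<comment> \<open>Real part of \<open>7/4 c - c^2 + c^3/4\<close> at \<open>c = a + i b\<close>.
    The slope 7/4 at the centre becomes the constant of the estimate; the other coefficients are
    chosen so that the values on the arc stay above 1.\<close>
  define w where "w x = 7 / 4 * a x + ((b x)\<^sup>2 - (a x)\<^sup>2) + ((a x) ^ 3 - 3 * a x * (b x)\<^sup>2) / 4" for x
  define D where "D = {x. norm (x - m) < r} \<inter> {x. 0 < (x - m) \<bullet> e}"
  define v where "v x = 2 * M * w x - (u x - u (R x))" for x
  have "m \<in> U" using U r by auto
  then have M0: "0 \<le> M" using M[of m] by linarith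
  have ee: "e \<bullet> e = 1" "perp e \<bullet> perp e = 1"
    using e norm_perp[of e] by (simp_all add: dot_square_norm)
  have Rn: "norm (R x - m) = norm (x - m)" for x
  proof -
    have "(norm (R x - m))\<^sup>2 = (norm (x - m))\<^sup>2"
      unfolding power2_norm_eq_inner R_def using ee(1)
      by (simp add: inner_simps inner_commute algebra_simps)
    then show ?thesis by simp
  qed
  have ab: "(a x)\<^sup>2 + (b x)\<^sup>2 = (norm (x - m) / r)\<^sup>2" for x
    unfolding a_def b_def power_divide add_divide_distrib[symmetric] inner_frame[OF e] ..
  have "open D" unfolding D_def by (intro open_Int open_Collect_less continuous_intros)
  have "bounded D" by (rule bounded_subset[OF bounded_ball[of m r]]) (auto simp: D_def dist_norm norm_minus_commute)
  have clD: "closure D \<subseteq> {x. norm (x - m) \<le> r} \<inter> {x. 0 \<le> (x - m) \<bullet> e}"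
    by (rule closure_minimal) (auto simp: D_def intro!: closed_Int closed_Collect_le continuous_intros)
  have inU: "x \<in> U" "R x \<in> U" if "norm (x - m) \<le> r" for x
    using U that Rn[of x] by (auto intro!: subsetD[OF U] simp: dist_norm norm_minus_commute)
  have "0 \<le> v (m + s *\<^sub>R e)"
  proof (rule wharmonic_nonneg[OF \<open>open D\<close> \<open>bounded D\<close> e])
    have "disc_lap e w x h = 0" for x h
    proof -
      define t where "t = h / r"
      have a: "a (x + h *\<^sub>R e) = a x + t" "a (x - h *\<^sub>R e) = a x - t"
        "a (x + h *\<^sub>R perp e) = a x" "a (x - h *\<^sub>R perp e) = a x"
        and b: "b (x + h *\<^sub>R e) = b x" "b (x - h *\<^sub>R e) = b x"
        "b (x + h *\<^sub>R perp e) = b x + t" "b (x - h *\<^sub>R perp e) = b x - t"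
        using ee by (simp_all add: t_def a_def b_def inner_simps add_divide_distrib diff_divide_distrib)
      show ?thesis unfolding disc_lap_def w_def a b
        by (simp add: power2_eq_square power3_eq_cube algebra_simps add_divide_distrib diff_divide_distrib)
    qed
    then have "wharmonic e D w" by (simp add: wharmonic_def)
    moreover have "wharmonic e D (\<lambda>x. u (R x))"
      unfolding wharmonic_def
    proof
      fix x assume "x \<in> D"
      then have "R x \<in> U" using inU by (auto simp: D_def)
      have "disc_lap e (\<lambda>x. u (R x)) x h = disc_lap e u (R x) h" for h
      proof -
        have "R (x + h *\<^sub>R e) = R x - h *\<^sub>R e" "R (x - h *\<^sub>R e) = R x + h *\<^sub>R e"
          "R (x + h *\<^sub>R perp e) = R x + h *\<^sub>R perp e" "R (x - h *\<^sub>R perp e) = R x - h *\<^sub>R perp e"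
          unfolding R_def using ee by (simp_all add: vec_eq_iff inner_simps algebra_simps)
        then show ?thesis by (simp add: disc_lap_def)
      qed
      then show "((\<lambda>h. disc_lap e (\<lambda>x. u (R x)) x h / h\<^sup>2) \<longlongrightarrow> 0) (at_right 0)"
        using wh \<open>R x \<in> U\<close> by (simp add: wharmonic_def)
    qed
    moreover have "wharmonic e D u" by (rule wharmonic_subset[OF wh]) (use inU in \<open>auto simp: D_def\<close>)
    ultimately show "wharmonic e D v" unfolding v_def
      by (intro wharmonic_diff wharmonic_cmult)
    show "continuous_on (closure D) v"
      unfolding v_def w_def a_def b_def
    proof (intro continuous_intros)
      show "continuous_on (closure D) u" by (rule continuous_on_subset[OF cont]) (use clD inU in auto)
      show "continuous_on (closure D) (\<lambda>x. u (R x))"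
        by (rule continuous_on_compose2[OF cont]) (use clD inU in \<open>auto simp: R_def intro!: continuous_intros\<close>)
    qed (use r in auto)
    show "m + s *\<^sub>R e \<in> D" using s e ee by (simp add: D_def)
    fix p assume "p \<in> frontier D"
    then have p: "norm (p - m) \<le> r" "0 \<le> (p - m) \<bullet> e" "p \<notin> D"
      using clD \<open>open D\<close> by (auto simp: frontier_def interior_open)
    show "0 \<le> v p"
    \<comment> \<open>On the diameter the reflection is the identity and the increment of
      \<open>u\<close> vanishes; on the arc the increment is at most \<open>2 * M\<close>.\<close>
    proof (cases "(p - m) \<bullet> e = 0")
      case True
      then have "a p = 0" "R p = p" by (auto simp: a_def R_def)
      then show ?thesis using M0 by (simp add: v_def w_def)
    next
      case False
      then have "norm (p - m) = r" using p by (auto simp: D_def)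
      with ab[of p] r have 1: "(b p)\<^sup>2 = 1 - (a p)\<^sup>2" by simp
      have "0 \<le> a p" using p r by (simp add: a_def)
      have "w p = 1 + a p * (1 - a p)\<^sup>2" unfolding w_def 1 by (simp add: field_simps power2_eq_square power3_eq_cube)
      also have "\<dots> \<ge> 1" using \<open>0 \<le> a p\<close> by simp
      finally have "2 * M \<le> 2 * M * w p" using M0 mult_left_mono[of 1 "w p" "2 * M"] by simp
      moreover have "\<bar>u p\<bar> \<le> M" "\<bar>u (R p)\<bar> \<le> M" using M inU p by auto
      ultimately show ?thesis unfolding v_def by linarith
    qed
  qed
  moreover have "R (m + s *\<^sub>R e) = m - s *\<^sub>R e"
    using ee by (simp add: R_def algebra_simps flip: scaleR_left_distrib)
  ultimately have "u (m + s *\<^sub>R e) - u (m - s *\<^sub>R e) \<le> 2 * M * w (m + s *\<^sub>R e)" by (simp add: v_def)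
  also have "w (m + s *\<^sub>R e) = 7 / 4 * (s / r) - (s / r)\<^sup>2 + (s / r) ^ 3 / 4"
    using ee by (simp add: w_def a_def b_def)
  also have "\<dots> \<le> 7 / 4 * (s / r)"
  proof -
    have "(s / r) ^ 3 \<le> (s / r)\<^sup>2" using s by (intro power_decreasing) auto
    then show ?thesis using zero_le_power2[of "s / r"] by linarith
  qed
  finally show ?thesis using M0 by (simp add: mult_left_mono)
qed

text \<open>With the frame along \<open>x - x'\<close> the two points are mirror images about the
  midpoint, and the half-disc comparison applies. If they are at least \<open>2 * r\<close> apart,
  the trivial bound \<open>2 * M\<close> is already below \<open>7 / 2 * M * s / r\<close>.\<close>

lemma wharmonic_Lipschitz:
  fixes u :: "real^2 \<Rightarrow> real"
  assumes U: "cball (midpoint x x') r \<subseteq> U" and r: "0 < r"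
    and wh: "\<And>e. norm e = 1 \<Longrightarrow> wharmonic e U u" and cont: "continuous_on U u"
    and M: "\<And>x. x \<in> U \<Longrightarrow> \<bar>u x\<bar> \<le> M" and xU: "x \<in> U" "x' \<in> U"
  shows "\<bar>u x - u x'\<bar> \<le> 7 / 4 * M / r * norm (x - x')"
proof -
  have main: "u x - u x' \<le> 7 / 4 * M / r * norm (x - x')"
    if U: "cball (midpoint x x') r \<subseteq> U" and xU: "x \<in> U" "x' \<in> U" for x x'
  proof -
    have "midpoint x x' \<in> U" using U r by auto
    then have M0: "0 \<le> M" using M by fastforce
    define s where "s = norm (x - x') / 2"
    consider "s = 0" | "0 < s" "s < r" | "r \<le> s" using norm_ge_zero[of "x - x'"] unfolding s_def by linarith
    then show ?thesis
    proof cases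
      case 2
      define e where "e = (x - x') /\<^sub>R norm (x - x')"
      have e: "norm e = 1" using 2 by (simp add: e_def s_def)
      have se: "s *\<^sub>R e = (1/2) *\<^sub>R (x - x')" using 2 by (simp add: s_def e_def)
      have xm: "x = midpoint x x' + s *\<^sub>R e" "x' = midpoint x x' - s *\<^sub>R e"
        unfolding se midpoint_def by (simp_all add: vec_eq_iff field_simps)
      have "u x - u x' \<le> 7 / 2 * M * s / r"
        using wharmonic_reflection_estimate[OF e U r wh[OF e] cont M 2] xm by simp
      then show ?thesis by (simp add: s_def)
    next
      case 3
      have "2 * M \<le> 2 * M * (s / r)" using mult_left_mono[of 1 "s / r" "2 * M"] 3 r M0 by simp
      moreover have "0 \<le> 3/2 * M * (s / r)" using M0 r 3 by (intro mult_nonneg_nonneg) auto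
      ultimately have "2 * M \<le> 7 / 2 * M * (s / r)" by linarith
      then show ?thesis using M[OF xU(1)] M[OF xU(2)] by (simp add: s_def)
    qed (auto simp: s_def)
  qed
  from main[OF U xU] main[of x' x] U xU show ?thesis
    by (simp add: midpoint_sym norm_minus_commute abs_le_iff)
qed

text \<open>The segment from \<open>a\<close> to \<open>b\<close> may pass through the pole, so the
  estimate goes through the radii, where \<open>ln\<close> has slope at most
  \<open>1 / d\<close>.\<close>

lemma fundsol_Lipschitz:
  assumes d: "0 < d" "d \<le> norm a" "d \<le> norm b"
  shows "\<bar>fundsol a - fundsol b\<bar> \<le> norm (a - b) / (2 * pi * d)"
proof -
  have main: "ln s - ln t \<le> \<bar>s - t\<bar> / d" if "d \<le> s" "d \<le> t" for s t :: real
  proof -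
    have "ln s - ln t = ln (s / t)" using that d by (simp add: ln_div)
    also have "\<dots> \<le> s / t - 1" using that d by (intro ln_le_minus_one) auto
    also have "\<dots> = (s - t) / t" using that d by (simp add: field_simps)
    also have "\<dots> \<le> \<bar>s - t\<bar> / t" using that d by (intro divide_right_mono) auto
    also have "\<dots> \<le> \<bar>s - t\<bar> / d" using that d by (intro divide_left_mono) auto
    finally show ?thesis .
  qed
  have "\<bar>ln (norm a) - ln (norm b)\<bar> \<le> \<bar>norm a - norm b\<bar> / d"
    using main[of "norm a" "norm b"] main[of "norm b" "norm a"] d by (simp add: abs_le_iff abs_minus_commute)
  also have "\<dots> \<le> norm (a - b) / d" using d norm_triangle_ineq3[of a b] by (intro divide_right_mono) auto
  finally have "1 / (2 * pi) * \<bar>ln (norm a) - ln (norm b)\<bar> \<le> 1 / (2 * pi) * (norm (a - b) / d)"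
    by (intro mult_left_mono) auto
  moreover have "\<bar>fundsol a - fundsol b\<bar> = 1 / (2 * pi) * \<bar>ln (norm a) - ln (norm b)\<bar>"
    unfolding fundsol_def right_diff_distrib[symmetric] by (simp add: abs_mult)
  ultimately show ?thesis by simp
qed

lemma fundsol_GDERIV:
  assumes "z \<noteq> 0"
  shows "GDERIV fundsol z :> (1 / (2 * pi)) *\<^sub>R vinv z"
proof -
  have n: "(norm has_derivative (\<lambda>h. h \<bullet> sgn z)) (at z)"
    using GDERIV_norm[OF assms] by (simp add: gderiv_def)
  have "(fundsol has_derivative (\<lambda>h. 1 / (2 * pi) * (1 / norm z * (h \<bullet> sgn z)))) (at z)"
    unfolding fundsol_def[abs_def] using assms
    by (auto intro!: derivative_eq_intros n simp: field_simps)
  moreover have "1 / (2 * pi) * (1 / norm z * (h \<bullet> sgn z)) = h \<bullet> ((1 / (2 * pi)) *\<^sub>R vinv z)" for h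
    by (simp add: vinv_def sgn_div_norm power2_eq_square field_simps)
  ultimately show ?thesis by (simp add: gderiv_def)
qed

lemma norm_vinv: "norm (vinv z) = 1 / norm z"
  by (simp add: vinv_def power2_eq_square divide_simps)

lemma norm_vinv_diff:
  assumes "a \<noteq> 0" "b \<noteq> 0"
  shows "norm (vinv a - vinv b) = norm (a - b) / (norm a * norm b)"
proof -
  have pos: "a \<bullet> a \<noteq> 0" "b \<bullet> b \<noteq> 0" using assms by auto
  have "(norm (vinv a - vinv b))\<^sup>2 = (norm (a - b) / (norm a * norm b))\<^sup>2"
    unfolding power_divide power_mult_distrib vinv_def power2_norm_eq_inner
    using pos by (simp add: inner_simps inner_commute divide_simps)
  then show ?thesis by (simp add: power2_eq_iff_nonneg)
qed

text \<open>The mean value theorem is used only in the shift parameter. The difference of the two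
  gradients is then exact, by the distance formula for inversion, and no path from \<open>a\<close>
  to \<open>b\<close> around the pole is required.\<close>

lemma fundsol_second_difference:
  assumes e: "norm e = 1" and h: "0 < h" and d: "h < d" "d \<le> norm a" and d': "h < d'" "d' \<le> norm b"
  shows "\<bar>(fundsol (a - h *\<^sub>R e) - fundsol a) - (fundsol (b - h *\<^sub>R e) - fundsol b)\<bar>
    \<le> h * norm (a - b) / (2 * pi * ((d - h) * (d' - h)))"
proof -
  define f where "f s = fundsol (a - s *\<^sub>R e) - fundsol (b - s *\<^sub>R e)" for s
  define f' where "f' s = - (1 / (2 * pi)) * ((vinv (a - s *\<^sub>R e) - vinv (b - s *\<^sub>R e)) \<bullet> e)" for s
  have lo: "d - h \<le> norm (a - s *\<^sub>R e)" "d' - h \<le> norm (b - s *\<^sub>R e)" if "0 \<le> s" "s \<le> h" for s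
    using norm_triangle_ineq2[of a "s *\<^sub>R e"] norm_triangle_ineq2[of b "s *\<^sub>R e"] that e d d' by auto
  have nz: "a - s *\<^sub>R e \<noteq> 0" "b - s *\<^sub>R e \<noteq> 0" if "0 \<le> s" "s \<le> h" for s
    using lo[OF that] d d' by fastforce+
  have "(f has_real_derivative f' s) (at s)" if "0 \<le> s" "s \<le> h" for s
  proof -
    have D: "((\<lambda>s. fundsol (c - s *\<^sub>R e)) has_derivative (\<lambda>t. (- (t *\<^sub>R e)) \<bullet> ((1 / (2 * pi)) *\<^sub>R vinv (c - s *\<^sub>R e)))) (at s)"
      if "c - s *\<^sub>R e \<noteq> 0" for c
      by (rule has_derivative_compose[where g=fundsol and f="\<lambda>s. c - s *\<^sub>R e",
            OF _ fundsol_GDERIV[OF that, unfolded gderiv_def]])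
        (auto intro!: derivative_eq_intros)
    have "(f has_derivative (\<lambda>t. (- (t *\<^sub>R e)) \<bullet> ((1 / (2 * pi)) *\<^sub>R vinv (a - s *\<^sub>R e))
        - (- (t *\<^sub>R e)) \<bullet> ((1 / (2 * pi)) *\<^sub>R vinv (b - s *\<^sub>R e)))) (at s)"
      unfolding f_def by (intro has_derivative_diff D nz that)
    moreover have "(\<lambda>t. (- (t *\<^sub>R e)) \<bullet> ((1 / (2 * pi)) *\<^sub>R vinv (a - s *\<^sub>R e))
        - (- (t *\<^sub>R e)) \<bullet> ((1 / (2 * pi)) *\<^sub>R vinv (b - s *\<^sub>R e))) = (*) (f' s)"
      by (simp add: fun_eq_iff f'_def inner_simps inner_commute algebra_simps)
    ultimately show ?thesis unfolding has_field_derivative_def by (rule has_derivative_eq_rhs)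
  qed
  then obtain s where s: "0 < s" "s < h" "f h - f 0 = (h - 0) * f' s"
    using MVT2[OF h, of f f'] by auto
  have "\<bar>f' s\<bar> = 1 / (2 * pi) * \<bar>(vinv (a - s *\<^sub>R e) - vinv (b - s *\<^sub>R e)) \<bullet> e\<bar>"
    by (simp add: f'_def abs_mult)
  also have "\<dots> \<le> 1 / (2 * pi) * norm (vinv (a - s *\<^sub>R e) - vinv (b - s *\<^sub>R e))"
    using Cauchy_Schwarz_ineq2[of _ e] e by (intro mult_left_mono) auto
  also have "\<dots> = 1 / (2 * pi) * (norm (a - b) / (norm (a - s *\<^sub>R e) * norm (b - s *\<^sub>R e)))"
    using nz[of s] s by (simp add: norm_vinv_diff)
  also have "\<dots> \<le> 1 / (2 * pi) * (norm (a - b) / ((d - h) * (d' - h)))"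
    using lo[of s] s d d' by (intro mult_left_mono divide_left_mono mult_mono mult_pos_pos) auto
  finally have "h * \<bar>f' s\<bar> \<le> h * (1 / (2 * pi) * (norm (a - b) / ((d - h) * (d' - h))))"
    using h by (intro mult_left_mono) auto
  moreover have "\<bar>f h - f 0\<bar> = h * \<bar>f' s\<bar>" using s h by (simp add: abs_mult)
  ultimately show ?thesis by (simp add: f_def algebra_simps)
qed

section \<open>Symmetry and gradient bounds of the kernel\<close>

lemma norm_le_by_inner:
  fixes v :: "real^2"
  assumes "\<And>e. norm e = 1 \<Longrightarrow> v \<bullet> e \<le> B" and "0 \<le> B"
  shows "norm v \<le> B"
proof (cases "v = 0")
  case False
  have "norm (v /\<^sub>R norm v) = 1" using False by simp
  from assms(1)[OF this] show ?thesis using False by (simp add: dot_square_norm power2_eq_square field_simps)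
qed (use assms in simp)

lemma GDERIV_quotient_tendsto:
  assumes "GDERIV f y :> D"
  shows "((\<lambda>h. (f (y + h *\<^sub>R e) - f y) / h) \<longlongrightarrow> D \<bullet> e) (at_right 0)"
proof -
  have "(f has_derivative (\<lambda>v. v \<bullet> D)) (at (y + 0 *\<^sub>R e))" using assms by (simp add: gderiv_def)
  moreover have "((\<lambda>h. y + h *\<^sub>R e) has_derivative (\<lambda>t. t *\<^sub>R e)) (at 0)"
    by (auto intro!: derivative_eq_intros)
  ultimately have "((\<lambda>h. f (y + h *\<^sub>R e)) has_derivative (\<lambda>t. (t *\<^sub>R e) \<bullet> D)) (at 0)"
    using has_derivative_compose by blast
  moreover have "(\<lambda>t. (t *\<^sub>R e) \<bullet> D) = (*) (D \<bullet> e)" by (auto simp: inner_commute)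
  ultimately have "((\<lambda>h. f (y + h *\<^sub>R e)) has_real_derivative D \<bullet> e) (at 0)"
    unfolding has_field_derivative_def by simp
  then have "((\<lambda>h. (f (y + h *\<^sub>R e) - f y) / h) \<longlongrightarrow> D \<bullet> e) (at 0)"
    by (simp add: has_field_derivative_iff)
  then show ?thesis by (rule tendsto_within_subset) simp
qed

locale dirichlet_kernel =
  fixes \<Omega> :: "(real^2) set" and k :: "real^2 \<Rightarrow> real^2 \<Rightarrow> real"
  assumes open_dom: "open \<Omega>" and bounded_dom: "bounded \<Omega>" and is_k: "is_k \<Omega> k"
begin

text \<open>Only lower bounds for the distance to the boundary enter the estimates, and in this form
  a displacement costs exactly its length (\<open>far_perturb\<close>).\<close>

definition far :: "real^2 \<Rightarrow> real \<Rightarrow> bool" where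
  "far x d \<longleftrightarrow> x \<in> \<Omega> \<and> 0 < d \<and> (\<forall>\<xi>\<in>frontier \<Omega>. d \<le> dist x \<xi>)"

lemma farD: "far x d \<Longrightarrow> x \<in> \<Omega>" "far x d \<Longrightarrow> 0 < d" "far x d \<Longrightarrow> \<xi> \<in> frontier \<Omega> \<Longrightarrow> d \<le> norm (\<xi> - x)"
  by (auto simp: far_def dist_norm norm_minus_commute)

text \<open>Connectedness: a ball around \<open>x\<close> that left \<open>\<Omega>\<close> would
  meet the frontier.\<close>

lemma far_ball:
  assumes "far x d" shows "ball x d \<subseteq> \<Omega>"
proof (rule ccontr)
  assume "\<not> ball x d \<subseteq> \<Omega>"
  then have "ball x d - \<Omega> \<noteq> {}" by auto
  moreover have "x \<in> ball x d \<inter> \<Omega>" using assms by (auto simp: far_def)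
  ultimately obtain \<xi> where "\<xi> \<in> ball x d" "\<xi> \<in> frontier \<Omega>"
    using connected_Int_frontier[OF connected_ball[of x d], of \<Omega>] by blast
  then show False using assms by (force simp: far_def)
qed

lemma far_perturb:
  assumes "far x d" "dist x y \<le> d - d'" "0 < d'" shows "far y d'"
proof -
  have "y \<in> \<Omega>" using assms far_ball[OF assms(1)] by auto
  moreover have "d' \<le> dist y \<xi>" if "\<xi> \<in> frontier \<Omega>" for \<xi>
    using assms that dist_triangle[of x \<xi> y] by (fastforce simp: far_def dist_commute)
  ultimately show ?thesis using assms by (auto simp: far_def)
qed

lemma far_ex:
  assumes "x \<in> \<Omega>" obtains d where "far x d"
proof -
  obtain d where d: "0 < d" "ball x d \<subseteq> \<Omega>" using open_dom assms openE by blast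
  have "d \<le> dist x \<xi>" if "\<xi> \<in> frontier \<Omega>" for \<xi>
  proof -
    have "\<xi> \<notin> \<Omega>" using that open_dom by (auto simp: frontier_def interior_open)
    then show ?thesis using d by (meson mem_ball not_le subsetD)
  qed
  then show thesis using that[of d] d assms by (auto simp: far_def)
qed

lemma frontier_notin: "\<xi> \<in> frontier \<Omega> \<Longrightarrow> \<xi> \<notin> \<Omega>"
  using open_dom by (auto simp: frontier_def interior_open)

section \<open>Boundary data and comparison with the logarithm\<close>

lemma k_cont: "y \<in> \<Omega> \<Longrightarrow> continuous_on (closure \<Omega>) (\<lambda>x. k x y)"
  using is_k by (auto simp: is_k_def)

lemma k_cont': "y \<in> \<Omega> \<Longrightarrow> continuous_on \<Omega> (\<lambda>x. k x y)"
  by (rule continuous_on_subset[OF k_cont closure_subset])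

lemma k_wharmonic: "y \<in> \<Omega> \<Longrightarrow> norm e = 1 \<Longrightarrow> wharmonic e \<Omega> (\<lambda>x. k x y)"
  using is_k open_dom by (auto simp: is_k_def intro!: harmonic_on_wharmonic)

lemma k_frontier: "y \<in> \<Omega> \<Longrightarrow> \<xi> \<in> frontier \<Omega> \<Longrightarrow> k \<xi> y = fundsol (\<xi> - y)"
  using is_k by (auto simp: is_k_def fundsol_def)

lemma norm_axis_1: "norm (axis 1 1 :: real^2) = 1" by (simp add: norm_eq_sqrt_inner inner_axis_axis)

lemma fundsol_continuous: "continuous_on (UNIV - {y}) (\<lambda>x. fundsol (x - y))"
  unfolding fundsol_def by (intro continuous_intros) auto

text \<open>Nonnegativity of the Green function. The pole is taken out of the domain and becomes a
  frontier point; there the difference tends to infinity, which the one-sided boundary condition of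
  the minimum principle admits.\<close>

lemma k_ge_fundsol:
  assumes "x \<in> \<Omega>" "y \<in> \<Omega>" "x \<noteq> y"
  shows "fundsol (x - y) \<le> k x y"
proof -
  let ?u = "\<lambda>x. k x y - fundsol (x - y)"
  let ?S = "\<Omega> - {y}"
  have "0 \<le> ?u x"
  proof (rule wharmonic_min_principle[where S="?S" and u="?u"])
    show "open ?S" using open_dom by auto
    show "bounded ?S" using bounded_dom by (rule bounded_subset) auto
    show "wharmonic (axis 1 1) ?S ?u"
      by (intro wharmonic_diff wharmonic_fundsol norm_axis_1 wharmonic_subset[OF k_wharmonic[OF assms(2) norm_axis_1]]) auto
    show "continuous_on ?S ?u"
      by (intro continuous_on_diff continuous_on_subset[OF k_cont'[OF assms(2)]]
          continuous_on_subset[OF fundsol_continuous]) auto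
    fix p \<epsilon> assume p: "p \<in> frontier ?S" and "0 < (\<epsilon>::real)"
    have "closure ?S \<subseteq> closure \<Omega>" by (intro closure_mono) auto
    then have pc: "p \<in> closure \<Omega>" "p \<notin> ?S"
      using p open_dom by (auto simp: frontier_def interior_open open_delete)
    have kp: "((\<lambda>x. k x y) \<longlongrightarrow> k p y) (at p within ?S)"
      by (rule tendsto_within_subset[of _ _ _ "closure \<Omega>"])
        (use k_cont[OF assms(2)] pc(1) closure_subset in \<open>auto simp: continuous_on_def\<close>)
    show "\<forall>\<^sub>F x in at p within ?S. - \<epsilon> < ?u x"
    proof (cases "p = y")
      case True
      have "\<forall>\<^sub>F x in at p within ?S. k p y - 1 < k x y"
        by (rule order_tendstoD(1)[OF kp]) simp
      moreover have "\<forall>\<^sub>F x in at p within ?S. fundsol (x - y) < k p y - 1"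
      proof -
        \<comment> \<open>Within this distance of the pole the logarithm is below
          \<open>k p y - 1\<close>, a level above which continuity keeps
          \<open>k x y\<close>.\<close>
        let ?r = "exp (2 * pi * (k p y - 1))"
        have "fundsol (x - y) < k p y - 1" if "x \<noteq> y" "dist x y < ?r" for x
        proof -
          have "ln (norm (x - y)) < ln ?r" using that by (subst ln_less_cancel_iff) (auto simp: dist_norm)
          then show ?thesis by (simp add: fundsol_def field_simps)
        qed
        then show ?thesis using True unfolding eventually_at
          by (intro exI[of _ ?r]) auto
      qed
      ultimately show ?thesis by eventually_elim (use \<open>0 < \<epsilon>\<close> in linarith)
    next
      case False
      then have "p \<in> frontier \<Omega>" using pc open_dom by (auto simp: frontier_def interior_open)
      have "((\<lambda>x. fundsol (x - y)) \<longlongrightarrow> fundsol (p - y)) (at p within ?S)"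
        by (rule tendsto_within_subset[of _ _ _ "UNIV - {y}"])
          (use fundsol_continuous[of y] False in \<open>auto simp: continuous_on_def\<close>)
      from tendsto_diff[OF kp this] have "(?u \<longlongrightarrow> 0) (at p within ?S)"
        using k_frontier[OF assms(2) \<open>p \<in> frontier \<Omega>\<close>] by simp
      then show ?thesis by (rule order_tendstoD(1)) (use \<open>0 < \<epsilon>\<close> in simp)
    qed
  qed (use assms norm_axis_1 in auto)
  then show ?thesis by simp
qed

lemma k_second_Lipschitz:
  assumes "x \<in> \<Omega>" "far y d" "far y' d"
  shows "\<bar>k x y - k x y'\<bar> \<le> norm (y - y') / (2 * pi * d)"
proof (rule wharmonic_abs_le[OF open_dom bounded_dom norm_axis_1, where u="\<lambda>x. k x y - k x y'"])
  fix \<xi> assume \<xi>: "\<xi> \<in> frontier \<Omega>"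
  show "\<bar>k \<xi> y - k \<xi> y'\<bar> \<le> norm (y - y') / (2 * pi * d)"
    using fundsol_Lipschitz[of d "\<xi> - y" "\<xi> - y'"] farD[OF assms(2)] farD[OF assms(3)] \<xi>
    by (simp add: k_frontier norm_minus_commute)
qed (use assms farD in \<open>auto intro!: wharmonic_diff k_wharmonic norm_axis_1 continuous_intros k_cont\<close>)

lemma k_second_continuous:
  assumes "x \<in> \<Omega>" shows "continuous_on \<Omega> (k x)"
  unfolding continuous_on_iff
proof (intro ballI allI impI)
  fix y and \<epsilon> :: real assume "y \<in> \<Omega>" "0 < \<epsilon>"
  then obtain d where d: "far y d" using far_ex by blast
  have "0 < d" using d farD by blast
  show "\<exists>\<delta>>0. \<forall>x'\<in>\<Omega>. dist x' y < \<delta> \<longrightarrow> dist (k x x') (k x y) < \<epsilon>"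
  proof (intro exI[of _ "min (d/2) (\<epsilon> * (2 * pi * (d/2)))"] conjI ballI impI)
    fix z assume "z \<in> \<Omega>" and z: "dist z y < min (d/2) (\<epsilon> * (2 * pi * (d/2)))"
    have "far z (d/2)" "far y (d/2)" using d \<open>0 < d\<close> z by (auto intro!: far_perturb[OF d] simp: dist_commute)
    from k_second_Lipschitz[OF assms this]
    have "\<bar>k x z - k x y\<bar> \<le> norm (z - y) / (2 * pi * (d/2))" .
    also have "\<dots> < \<epsilon>" using z \<open>0 < d\<close> by (simp add: pos_divide_less_eq dist_norm)
    finally show "dist (k x z) (k x y) < \<epsilon>" by (simp add: dist_real_def)
  qed (use \<open>0 < d\<close> \<open>0 < \<epsilon>\<close> in auto)
qed

lemma k_second_wharmonic:
  assumes "x \<in> \<Omega>" and e: "norm e = 1" shows "wharmonic e \<Omega> (k x)"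
  unfolding wharmonic_def
proof
  fix y assume "y \<in> \<Omega>"
  then obtain d where d: "far y d" using far_ex by blast
  have "0 < d" using d farD by blast
  show "((\<lambda>h. disc_lap e (k x) y h / h\<^sup>2) \<longlongrightarrow> 0) (at_right 0)"
  proof (rule disc_lap_tendstoI)
    show "0 < d / 6" using \<open>0 < d\<close> by simp
    fix h assume h: "0 < h" "h < d / 6"
    then have "h ^ 4 \<le> (d / 6) ^ 4" by (intro power_mono) auto
    then have "1296 * h ^ 4 \<le> d ^ 4" unfolding power_divide by simp
    moreover have "0 \<le> h ^ 4" by simp
    ultimately have h4: "6 * h ^ 4 \<le> d ^ 4" by linarith
    have sub: "ball y d \<subseteq> \<Omega>" using d by (rule far_ball)
    have pts: "y + h *\<^sub>R e \<in> \<Omega>" "y - h *\<^sub>R e \<in> \<Omega>" "y + h *\<^sub>R perp e \<in> \<Omega>" "y - h *\<^sub>R perp e \<in> \<Omega>"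
      using h e by (auto intro!: subsetD[OF sub] simp: dist_norm)
    have "\<bar>disc_lap e (k x) y h\<bar> \<le> 3 * h ^ 4 / (2 * pi * d ^ 4)"
    \<comment> \<open>The stencil acts on \<open>y\<close> at fixed \<open>h\<close>, the maximum
      principle on \<open>x\<close>: a combination of five harmonic functions whose boundary values
      are the discrete Laplacian of the logarithm.\<close>
    proof (rule wharmonic_abs_le[OF open_dom bounded_dom norm_axis_1, where u="\<lambda>x. disc_lap e (k x) y h"])
      fix \<xi> assume \<xi>: "\<xi> \<in> frontier \<Omega>"
      have "disc_lap e (k \<xi>) y h = disc_lap e (\<lambda>y. fundsol (\<xi> - y)) y h"
        unfolding disc_lap_def using pts \<open>y \<in> \<Omega>\<close> \<xi> by (simp add: k_frontier)
      also have "\<dots> = disc_lap e fundsol (\<xi> - y) h" by (rule disc_lap_reflect)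
      finally show "\<bar>disc_lap e (k \<xi>) y h\<bar> \<le> 3 * h ^ 4 / (2 * pi * d ^ 4)"
        using disc_lap_fundsol[OF e \<open>0 < d\<close> farD(3)[OF d \<xi>] h4] by simp
    qed (use pts assms \<open>y \<in> \<Omega>\<close> in \<open>auto simp: disc_lap_def
        intro!: wharmonic_diff wharmonic_add wharmonic_cmult k_wharmonic norm_axis_1 continuous_intros k_cont\<close>)
    then show "\<bar>disc_lap e (k x) y h\<bar> \<le> 3 / (2 * pi * d ^ 4) * h ^ 4" by simp
  qed
qed

text \<open>As functions of \<open>y\<close>, both sides are harmonic, and \<open>k x y\<close> dominates \<open>log |x - y| / 2\<pi>\<close>, which is the boundary
  value of \<open>k y x\<close>.\<close>

lemma k_le_swap:
  assumes "x \<in> \<Omega>" "y \<in> \<Omega>" shows "k y x \<le> k x y"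
proof -
  have "0 \<le> k x y - k y x"
  proof (rule wharmonic_min_principle[OF open_dom bounded_dom norm_axis_1, where u="\<lambda>y. k x y - k y x"])
    show "wharmonic (axis 1 1) \<Omega> (\<lambda>y. k x y - k y x)"
      by (intro wharmonic_diff k_second_wharmonic k_wharmonic norm_axis_1 assms)
    show "continuous_on \<Omega> (\<lambda>y. k x y - k y x)"
      by (intro continuous_on_diff k_second_continuous k_cont' assms)
    fix p \<epsilon> assume p: "p \<in> frontier \<Omega>" and "0 < (\<epsilon>::real)"
    then have pn: "p \<noteq> x" using frontier_notin assms by blast
    have "((\<lambda>y. k y x) \<longlongrightarrow> k p x) (at p within \<Omega>)"
      by (rule tendsto_within_subset[of _ _ _ "closure \<Omega>"])
        (use k_cont[OF assms(1)] p closure_subset in \<open>auto simp: continuous_on_def frontier_def\<close>)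
    moreover have "((\<lambda>y. fundsol (y - x)) \<longlongrightarrow> fundsol (p - x)) (at p within \<Omega>)"
      by (rule tendsto_within_subset[of _ _ _ UNIV])
        (use fundsol_continuous[of x] pn in \<open>auto simp: continuous_on_eq_continuous_at open_delete isCont_def\<close>)
    ultimately have "((\<lambda>y. fundsol (y - x) - k y x) \<longlongrightarrow> 0) (at p within \<Omega>)"
      using tendsto_diff k_frontier[OF assms(1) p] by fastforce
    then have "\<forall>\<^sub>F y in at p within \<Omega>. - \<epsilon> < fundsol (y - x) - k y x"
      by (rule order_tendstoD(1)) (use \<open>0 < \<epsilon>\<close> in simp)
    moreover have "\<forall>\<^sub>F y in at p within \<Omega>. y \<in> \<Omega>" by (simp add: eventually_at_filter)
    moreover have "\<forall>\<^sub>F y in at p within \<Omega>. y \<in> - {x}"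
      by (rule topological_tendstoD[OF tendsto_ident_at]) (use pn in auto)
    ultimately show "\<forall>\<^sub>F y in at p within \<Omega>. - \<epsilon> < k x y - k y x"
    proof eventually_elim
      case (elim y)
      have "fundsol (y - x) = fundsol (x - y)" by (simp add: fundsol_def norm_minus_commute)
      then show ?case using k_ge_fundsol[of x y] elim assms by auto
    qed
  qed (rule assms)
  then show ?thesis by simp
qed

lemma k_sym: "x \<in> \<Omega> \<Longrightarrow> y \<in> \<Omega> \<Longrightarrow> k x y = k y x"
  by (intro antisym k_le_swap)

text \<open>Two estimates in sequence: the increment in \<open>y\<close> is bounded uniformly over
  \<open>\<Omega>\<close> by its boundary data, and this bound serves as \<open>M\<close> in the
  Lipschitz estimate in \<open>x\<close>.\<close>

lemma k_mixed_difference: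
  assumes "far y d" "far y' d" and "far (midpoint x x') r" and "x \<in> \<Omega>" "x' \<in> \<Omega>" "0 < s" "s < r"
  shows "\<bar>(k x y - k x y') - (k x' y - k x' y')\<bar> \<le> 7 / 4 * (norm (y - y') / (2 * pi * d)) / s * norm (x - x')"
proof (rule wharmonic_Lipschitz[where U=\<Omega> and u="\<lambda>x. k x y - k x y'"])
  show "cball (midpoint x x') s \<subseteq> \<Omega>" using far_ball[OF assms(3)] \<open>s < r\<close> by auto
qed (use assms farD in \<open>auto intro!: wharmonic_diff k_wharmonic continuous_intros k_cont' k_second_Lipschitz\<close>)

section \<open>The gradient of the kernel in its first variable\<close>

definition K :: "real^2 \<Rightarrow> real^2 \<Rightarrow> real^2" where
  "K y x = (SOME D. GDERIV (\<lambda>y. k y x) y :> D)"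

lemma K_GDERIV:
  assumes "y \<in> \<Omega>" "x \<in> \<Omega>" shows "GDERIV (\<lambda>y. k y x) y :> K y x"
proof -
  have "\<exists>D. GDERIV (\<lambda>y. k y x) y :> D"
    using is_k assms unfolding is_k_def harmonic_on_def by blast
  then show ?thesis unfolding K_def by (rule someI_ex)
qed

text \<open>Symmetry moves the differentiated point into the second slot. The quotient is then
  harmonic in \<open>x\<close> with explicit boundary values, so bounds on increments pass to
  \<open>K\<close> in the limit.\<close>

lemma K_quotient:
  assumes "y \<in> \<Omega>" "x \<in> \<Omega>"
  shows "((\<lambda>h. (k x (y + h *\<^sub>R e) - k x y) / h) \<longlongrightarrow> K y x \<bullet> e) (at_right 0)"
proof (rule Lim_transform_eventually[OF GDERIV_quotient_tendsto[OF K_GDERIV[OF assms]]])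
  have "((\<lambda>h. y + h *\<^sub>R e) \<longlongrightarrow> y) (at_right 0)" by (auto intro!: tendsto_eq_intros)
  then have "\<forall>\<^sub>F h in at_right 0. y + h *\<^sub>R e \<in> \<Omega>" using open_dom assms(1) by (rule topological_tendstoD)
  then show "\<forall>\<^sub>F h in at_right 0. (k (y + h *\<^sub>R e) x - k y x) / h = (k x (y + h *\<^sub>R e) - k x y) / h"
    by eventually_elim (use assms in \<open>simp add: k_sym[of x]\<close>)
qed

lemma norm_K_le:
  assumes "far y d" "x \<in> \<Omega>"
  shows "norm (K y x) \<le> 1 / (2 * pi * d)"
proof (rule norm_le_by_inner)
  fix e :: "real^2" assume e: "norm e = 1"
  have d: "0 < d" "y \<in> \<Omega>" using assms farD by auto
  have lim: "((\<lambda>h. 1 / (2 * pi * (d - h))) \<longlongrightarrow> 1 / (2 * pi * (d - 0))) (at_right 0)"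
    using d by (intro tendsto_intros) auto
  have "K y x \<bullet> e \<le> 1 / (2 * pi * (d - 0))"
  proof (rule tendsto_le[OF _ lim K_quotient[OF d(2) assms(2)]])
    show "\<forall>\<^sub>F h in at_right 0. (k x (y + h *\<^sub>R e) - k x y) / h \<le> 1 / (2 * pi * (d - h))"
      unfolding eventually_at_right_field
    proof (intro exI[of _ d] conjI allI impI)
      fix h assume h: "0 < h" "h < d"
      have f: "far (y + h *\<^sub>R e) (d - h)" "far y (d - h)"
        using assms(1) h e by (auto intro!: far_perturb[OF assms(1)] simp: dist_norm)
      have "k x (y + h *\<^sub>R e) - k x y \<le> h / (2 * pi * (d - h))"
        using k_second_Lipschitz[OF assms(2) f] h e by (simp add: abs_le_iff)
      from divide_right_mono[OF this, of h]
      show "(k x (y + h *\<^sub>R e) - k x y) / h \<le> 1 / (2 * pi * (d - h))"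
        using h by simp
    qed (rule d)
  qed simp
  then show "K y x \<bullet> e \<le> 1 / (2 * pi * d)" by simp
qed (use assms farD in \<open>auto simp: less_imp_le\<close>)

lemma K_second_Lipschitz:
  assumes "far y d" "far (midpoint x x') r" "x \<in> \<Omega>" "x' \<in> \<Omega>"
  shows "norm (K y x - K y x') \<le> 7 / 4 * (1 / (2 * pi * d)) / r * norm (x - x')"
proof (rule norm_le_by_inner)
  fix e :: "real^2" assume e: "norm e = 1"
  have d: "0 < d" "y \<in> \<Omega>" "0 < r" using assms farD by auto
  have lim: "((\<lambda>h. 7 / 4 * (1 / (2 * pi * (d - h))) / (r - h) * norm (x - x')) \<longlongrightarrow>
      7 / 4 * (1 / (2 * pi * (d - 0))) / (r - 0) * norm (x - x')) (at_right 0)"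
    using d by (intro tendsto_intros) auto
  have "K y x \<bullet> e - K y x' \<bullet> e \<le> 7 / 4 * (1 / (2 * pi * (d - 0))) / (r - 0) * norm (x - x')"
  proof (rule tendsto_le[OF _ lim tendsto_diff[OF K_quotient[OF d(2) assms(3)] K_quotient[OF d(2) assms(4)]]])
    show "\<forall>\<^sub>F h in at_right 0. (k x (y + h *\<^sub>R e) - k x y) / h - (k x' (y + h *\<^sub>R e) - k x' y) / h
       \<le> 7 / 4 * (1 / (2 * pi * (d - h))) / (r - h) * norm (x - x')"
      unfolding eventually_at_right_field
    proof (intro exI[of _ "min d r"] conjI allI impI)
      fix h assume h: "0 < h" "h < min d r"
      have f: "far (y + h *\<^sub>R e) (d - h)" "far y (d - h)"
        using assms(1) h e by (auto intro!: far_perturb[OF assms(1)] simp: dist_norm)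
      have "(k x (y + h *\<^sub>R e) - k x y) - (k x' (y + h *\<^sub>R e) - k x' y)
          \<le> 7 / 4 * (h / (2 * pi * (d - h))) / (r - h) * norm (x - x')"
        \<comment> \<open>The radius \<open>r - h\<close> is strictly below \<open>r\<close>, as the
          closed disc inside \<open>\<Omega>\<close> requires, and tends to \<open>r\<close>, so the
          constant 7/4 survives the limit.\<close>
        using k_mixed_difference[OF f assms(2-4), of "r - h"] h e by (simp add: abs_le_iff)
      from divide_right_mono[OF this, of h]
      show "(k x (y + h *\<^sub>R e) - k x y) / h - (k x' (y + h *\<^sub>R e) - k x' y) / h
       \<le> 7 / 4 * (1 / (2 * pi * (d - h))) / (r - h) * norm (x - x')"
        using h by (simp add: diff_divide_distrib)
    qed (use d in auto)
  qed simp
  then show "(K y x - K y x') \<bullet> e \<le> 7 / 4 * (1 / (2 * pi * d)) / r * norm (x - x')"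
    by (simp add: inner_diff_left)
qed (use assms farD in \<open>auto simp: less_imp_le\<close>)

text \<open>A four-point combination of \<open>k\<close> is compared with the same combination of
  logarithms on the boundary; second derivatives of \<open>k\<close> do not enter.\<close>

lemma K_first_Lipschitz:
  assumes "far y d" "far y' d'" "x \<in> \<Omega>"
  shows "norm (K y x - K y' x) \<le> norm (y - y') / (2 * pi * (d * d'))"
proof (rule norm_le_by_inner)
  fix e :: "real^2" assume e: "norm e = 1"
  have d: "0 < d" "y \<in> \<Omega>" "0 < d'" "y' \<in> \<Omega>" using assms farD by auto
  have lim: "((\<lambda>h. norm (y - y') / (2 * pi * ((d - h) * (d' - h)))) \<longlongrightarrow>
      norm (y - y') / (2 * pi * ((d - 0) * (d' - 0)))) (at_right 0)"
    using d by (intro tendsto_intros) auto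
  have "K y x \<bullet> e - K y' x \<bullet> e \<le> norm (y - y') / (2 * pi * ((d - 0) * (d' - 0)))"
  proof (rule tendsto_le[OF _ lim tendsto_diff[OF K_quotient[OF d(2) assms(3)] K_quotient[OF d(4) assms(3)]]])
    show "\<forall>\<^sub>F h in at_right 0. (k x (y + h *\<^sub>R e) - k x y) / h - (k x (y' + h *\<^sub>R e) - k x y') / h
       \<le> norm (y - y') / (2 * pi * ((d - h) * (d' - h)))"
      unfolding eventually_at_right_field
    proof (intro exI[of _ "min d d'"] conjI allI impI)
      fix h assume h: "0 < h" "h < min d d'"
      have in': "y + h *\<^sub>R e \<in> \<Omega>" "y' + h *\<^sub>R e \<in> \<Omega>"
        using far_ball[OF assms(1)] far_ball[OF assms(2)] h e by (auto simp: subset_eq dist_norm)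
      have "\<bar>(k x (y + h *\<^sub>R e) - k x y) - (k x (y' + h *\<^sub>R e) - k x y')\<bar>
          \<le> h * norm (y - y') / (2 * pi * ((d - h) * (d' - h)))"
      proof (rule wharmonic_abs_le[OF open_dom bounded_dom norm_axis_1,
            where u="\<lambda>x. (k x (y + h *\<^sub>R e) - k x y) - (k x (y' + h *\<^sub>R e) - k x y')"])
        fix \<xi> assume \<xi>: "\<xi> \<in> frontier \<Omega>"
        show "\<bar>(k \<xi> (y + h *\<^sub>R e) - k \<xi> y) - (k \<xi> (y' + h *\<^sub>R e) - k \<xi> y')\<bar>
          \<le> h * norm (y - y') / (2 * pi * ((d - h) * (d' - h)))"
          using fundsol_second_difference[OF e h(1), of d "\<xi> - y" d' "\<xi> - y'"] h
            farD(3)[OF assms(1) \<xi>] farD(3)[OF assms(2) \<xi>] in' d \<xi>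
          by (simp add: k_frontier norm_minus_commute algebra_simps)
      qed (use in' d assms in \<open>auto intro!: wharmonic_diff k_wharmonic norm_axis_1 continuous_intros k_cont\<close>)
      then have "(k x (y + h *\<^sub>R e) - k x y) - (k x (y' + h *\<^sub>R e) - k x y')
          \<le> h * norm (y - y') / (2 * pi * ((d - h) * (d' - h)))" by linarith
      from divide_right_mono[OF this, of h]
      show "(k x (y + h *\<^sub>R e) - k x y) / h - (k x (y' + h *\<^sub>R e) - k x y') / h
       \<le> norm (y - y') / (2 * pi * ((d - h) * (d' - h)))"
        using h by (simp add: diff_divide_distrib)
    qed (use d in auto)
  qed simp
  then show "(K y x - K y' x) \<bullet> e \<le> norm (y - y') / (2 * pi * (d * d'))"
    by (simp add: inner_diff_left)
qed (use assms farD in \<open>auto simp: less_imp_le\<close>)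

lemma GDERIV_cong_open:
  assumes "GDERIV f x :> D" "x \<in> \<Omega>" "\<And>y. y \<in> \<Omega> \<Longrightarrow> f y = g y"
  shows "GDERIV g x :> D"
  using assms open_dom unfolding gderiv_def by (auto intro: has_derivative_transform_within_open)

text \<open>By symmetry \<open>k y y - 2 k y x + k x x\<close> is a mixed increment and hence of
  order \<open>|y - x|^2\<close>. So the diagonal has the derivative of \<open>2 * k y x\<close> in
  \<open>y\<close>, without joint differentiability of \<open>k\<close>.\<close>

lemma k_diagonal_GDERIV:
  assumes x: "x \<in> \<Omega>" shows "GDERIV (\<lambda>x. k x x) x :> 2 *\<^sub>R K x x"
proof -
  obtain d where d: "far x d" using far_ex x by blast
  have d0: "0 < d" using d farD by blast
  define C where "C = 7 / 4 * (1 / (2 * pi * (d/2))) / (d/4)"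
  have C: "0 \<le> C" using d0 by (simp add: C_def)
  have "((\<lambda>y. k y y - 2 * k y x) has_derivative (\<lambda>v. 0)) (at x)"
    unfolding has_derivative_at_alt
  proof (intro conjI allI impI)
    fix \<epsilon> :: real assume "0 < \<epsilon>"
    show "\<exists>\<delta>>0. \<forall>y. norm (y - x) < \<delta> \<longrightarrow>
      norm (k y y - 2 * k y x - (k x x - 2 * k x x) - 0) \<le> \<epsilon> * norm (y - x)"
    proof (intro exI[of _ "min (d/2) (\<epsilon> / (C + 1))"] conjI allI impI)
      fix y assume y: "norm (y - x) < min (d/2) (\<epsilon> / (C + 1))"
      then have f: "far y (d/2)" "far x (d/2)"
        using d0 by (auto intro!: far_perturb[OF d] simp: dist_norm norm_minus_commute)
      have "dist x (midpoint y x) = norm (y - x) / 2"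
      proof -
        have "x - midpoint y x = (1/2) *\<^sub>R (x - y)" by (simp add: midpoint_def vec_eq_iff field_simps)
        then show ?thesis by (simp add: dist_norm norm_minus_commute)
      qed
      then have "far (midpoint y x) (d/2)" using y d0 by (intro far_perturb[OF d]) auto
      from k_mixed_difference[OF f this, of "d/4"]
      have "\<bar>k y y - k y x - (k x y - k x x)\<bar> \<le> 7 / 4 * (norm (y - x) / (2 * pi * (d/2))) / (d/4) * norm (y - x)"
        using farD(1)[OF f(1)] x d0 by simp
      also have "k x y = k y x" using farD(1)[OF f(1)] x by (rule k_sym[symmetric])
      also have "7 / 4 * (norm (y - x) / (2 * pi * (d/2))) / (d/4) * norm (y - x) = C * norm (y - x) * norm (y - x)"
        by (simp add: C_def)
      also have "\<dots> \<le> \<epsilon> * norm (y - x)"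
      proof (rule mult_right_mono)
        have "norm (y - x) * (C + 1) \<le> \<epsilon>" using y C by (simp add: pos_less_divide_eq)
        then have "norm (y - x) + C * norm (y - x) \<le> \<epsilon>" by (simp add: algebra_simps)
        then show "C * norm (y - x) \<le> \<epsilon>" using norm_ge_zero[of "y - x"] by linarith
      qed simp
      finally show "norm (k y y - 2 * k y x - (k x x - 2 * k x x) - 0) \<le> \<epsilon> * norm (y - x)" by (simp add: algebra_simps)
    qed (use d0 C \<open>0 < \<epsilon>\<close> in auto)
  qed simp
  moreover have "((\<lambda>y. 2 * k y x) has_derivative (\<lambda>v. 2 * (v \<bullet> K x x))) (at x)"
    using K_GDERIV[OF x x] by (auto intro!: derivative_eq_intros simp: gderiv_def)
  ultimately have "((\<lambda>y. (k y y - 2 * k y x) + 2 * k y x) has_derivative (\<lambda>v. 0 + 2 * (v \<bullet> K x x))) (at x)"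
    by (rule has_derivative_add)
  then show ?thesis by (simp add: gderiv_def)
qed

end

section \<open>The gradient of the energy\<close>

text \<open>The energy lists each pair once, as \<open>a < c\<close>, so \<open>i\<close> is the
  first index of some pairs and the second index of others; this collects both kinds by the partner
  of \<open>i\<close>.\<close>

lemma sum_pairs_containing:
  fixes g :: "nat \<Rightarrow> 'a::comm_monoid_add"
  assumes "i \<in> {1..n}"
  shows "(\<Sum>a\<in>{1..n}. \<Sum>c\<in>{a<..n}. if a = i then g c else if c = i then g a else 0) = (\<Sum>j\<in>{1..n} - {i}. g j)"
proof -
  have inner: "(\<Sum>c\<in>{a<..n}. if a = i then g c else if c = i then g a else 0)
      = (if a = i then \<Sum>c\<in>{i<..n}. g c else 0) + (if a \<in> {1..<i} then g a else 0)" if "a \<in> {1..n}" for a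
    using that assms by (cases "a = i") (auto simp: sum.delta)
  have "(\<Sum>a\<in>{1..n}. \<Sum>c\<in>{a<..n}. if a = i then g c else if c = i then g a else 0)
      = (\<Sum>c\<in>{i<..n}. g c) + (\<Sum>a\<in>{1..n}. if a \<in> {1..<i} then g a else 0)"
  proof -
    have "(\<Sum>a\<in>{1..n}. \<Sum>c\<in>{a<..n}. if a = i then g c else if c = i then g a else 0)
      = (\<Sum>a\<in>{1..n}. (if a = i then \<Sum>c\<in>{i<..n}. g c else 0) + (if a \<in> {1..<i} then g a else 0))"
      by (rule sum.cong[OF refl inner])
    then show ?thesis using assms by (simp only: sum.distrib sum.delta finite_atLeastAtMost if_True)
  qed
  also have "(\<Sum>a\<in>{1..n}. if a \<in> {1..<i} then g a else 0) = (\<Sum>a\<in>{1..<i}. g a)"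
    using assms by (subst sum.inter_restrict[symmetric]) (auto intro!: sum.cong)
  also have "(\<Sum>c\<in>{i<..n}. g c) + (\<Sum>a\<in>{1..<i}. g a) = (\<Sum>j\<in>{i<..n} \<union> {1..<i}. g j)"
    by (rule sum.union_disjoint[symmetric]) auto
  also have "{i<..n} \<union> {1..<i} = {1..n} - {i}" using assms by auto
  finally show ?thesis .
qed

lemma GDERIV_unique:
  assumes "GDERIV f x :> D" "GDERIV f x :> D'" shows "D = D'"
proof -
  have "(\<lambda>h. h \<bullet> D) = (\<lambda>h. h \<bullet> D')"
    using assms unfolding gderiv_def by (rule has_derivative_unique)
  then show ?thesis by (metis vector_eq_ldot)
qed

lemma sum_squared_le_card:
  fixes f :: "'a \<Rightarrow> real"
  assumes "finite I" shows "(\<Sum>i\<in>I. f i)\<^sup>2 \<le> real (card I) * (\<Sum>i\<in>I. (f i)\<^sup>2)"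
  using Cauchy_Schwarz_ineq_sum[of f "\<lambda>_. 1" I] by (simp add: mult.commute)

context dirichlet_kernel begin

definition G :: "real^2 \<Rightarrow> real^2 \<Rightarrow> real^2" where
  "G y x = K y x - (1 / (2 * pi)) *\<^sub>R vinv (y - x)"

text \<open>Closed form of the negative energy gradient. The self-interaction has factor 1: the
  gradient of the diagonal is twice \<open>K\<close>, the energy carries \<open>1 / 2\<close>, and
  the squared modulus is 1.\<close>

definition velocity :: "(nat \<Rightarrow> real) \<Rightarrow> nat \<Rightarrow> (nat \<Rightarrow> real^2) \<Rightarrow> nat \<Rightarrow> real^2" where
  "velocity b n z i = - (\<Sum>j\<in>{1..n} - {i}. (b i * b j) *\<^sub>R G (z i) (z j)) - K (z i) (z i)"

lemma G_GDERIV: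
  assumes "y \<in> \<Omega>" "x \<in> \<Omega>" "y \<noteq> x"
  shows "GDERIV (\<lambda>y. k y x - 1 / (2 * pi) * ln (norm (y - x))) y :> G y x"
    and "GDERIV (\<lambda>y. k x y - 1 / (2 * pi) * ln (norm (x - y))) y :> G y x"
proof -
  have "(fundsol has_derivative (\<lambda>h. h \<bullet> ((1 / (2 * pi)) *\<^sub>R vinv (y - x)))) (at (y - x))"
    using fundsol_GDERIV[of "y - x"] assms by (simp add: gderiv_def)
  moreover have "((\<lambda>y. y - x) has_derivative (\<lambda>h. h)) (at y)" by (auto intro!: derivative_eq_intros)
  ultimately have f: "((\<lambda>y. fundsol (y - x)) has_derivative (\<lambda>h. h \<bullet> ((1 / (2 * pi)) *\<^sub>R vinv (y - x)))) (at y)"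
    by (intro has_derivative_compose[where g=fundsol and f="\<lambda>y. y - x"])
  have "GDERIV (\<lambda>y. k y x - fundsol (y - x)) y :> G y x"
    using has_derivative_diff[OF K_GDERIV[OF assms(1,2), unfolded gderiv_def] f]
    unfolding gderiv_def G_def inner_diff_right .
  then show 1: "GDERIV (\<lambda>y. k y x - 1 / (2 * pi) * ln (norm (y - x))) y :> G y x"
    by (simp add: fundsol_def)
  show "GDERIV (\<lambda>y. k x y - 1 / (2 * pi) * ln (norm (x - y))) y :> G y x"
    by (rule GDERIV_cong_open[OF 1 assms(1)]) (use assms k_sym in \<open>auto simp: norm_minus_commute\<close>)
qed

lemma energy_GDERIV:
  assumes z: "z \<in> {1..n} \<rightarrow> \<Omega>" "inj_on z {1..n}" and i: "i \<in> {1..n}" and b: "(b i)\<^sup>2 = 1"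
  shows "GDERIV (\<lambda>x. energy k b n (z(i := x))) (z i) :> - velocity b n z i"
proof -
  let ?u = "\<lambda>x. z(i := x)"
  define g where "g j = (b i * b j) *\<^sub>R G (z i) (z j)" for j
  define T where "T a c x = b a * b c * (k (?u x a) (?u x c) - 1 / (2 * pi) * ln (norm (?u x a - ?u x c)))" for a c x
  define DD where "DD a c = (if a = i then g c else if c = i then g a else 0)" for a c
  have zi: "z i \<in> \<Omega>" using z i by auto
  have T: "(T a c has_derivative (\<lambda>h. h \<bullet> DD a c)) (at (z i))" if ac: "a \<in> {1..n}" "c \<in> {a<..n}" for a c
  proof -
    have cn: "c \<in> {1..n}" "a \<noteq> c" using ac by auto
    have zz: "z a \<in> \<Omega>" "z c \<in> \<Omega>" "z a \<noteq> z c" using z ac cn by (auto dest: inj_onD)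
    consider "a = i" | "c = i" "a \<noteq> i" | "a \<noteq> i" "c \<noteq> i" by blast
    then show ?thesis
    proof cases
      case 1
      then have "T a c = (\<lambda>y. b i * b c * (k y (z c) - 1 / (2 * pi) * ln (norm (y - z c))))"
        using cn by (auto simp: T_def)
      moreover have "(\<dots> has_derivative (\<lambda>h. (b i * b c) * (h \<bullet> G (z i) (z c)))) (at (z i))"
        using G_GDERIV(1)[of "z i" "z c"] zz zi 1 unfolding gderiv_def by (intro has_derivative_mult_right) auto
      ultimately show ?thesis using 1 by (simp add: DD_def g_def)
    next
      case 2
      then have "T a c = (\<lambda>y. b i * b a * (k (z a) y - 1 / (2 * pi) * ln (norm (z a - y))))"
        using cn by (auto simp: T_def)
      moreover have "(\<dots> has_derivative (\<lambda>h. (b i * b a) * (h \<bullet> G (z i) (z a)))) (at (z i))"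
        using G_GDERIV(2)[of "z i" "z a"] zz zi 2 unfolding gderiv_def by (intro has_derivative_mult_right) auto
      ultimately show ?thesis using 2 by (simp add: DD_def g_def)
    next
      case 3
      then have "T a c = (\<lambda>_. T a c (z i))" by (auto simp: T_def)
      then show ?thesis using 3 has_derivative_const[of "T a c (z i)" "at (z i)"] by (simp add: DD_def)
    qed
  qed
  define U where "U a x = (b a)\<^sup>2 * k (?u x a) (?u x a)" for a x
  have U: "(U a has_derivative (\<lambda>h. h \<bullet> (if a = i then 2 *\<^sub>R K (z i) (z i) else 0))) (at (z i))" for a
  proof (cases "a = i")
    case True
    then have "U a = (\<lambda>x. k x x)" using b by (simp add: U_def fun_eq_iff)
    then show ?thesis using True k_diagonal_GDERIV[OF zi] by (simp add: gderiv_def)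
  next
    case False
    then have "U a = (\<lambda>_. U a (z i))" by (simp add: U_def fun_eq_iff)
    then show ?thesis using False has_derivative_const[of "U a (z i)" "at (z i)"] by simp
  qed
  have "((\<lambda>x. (\<Sum>a\<in>{1..n}. \<Sum>c\<in>{a<..n}. T a c x) + 1 / 2 * (\<Sum>a\<in>{1..n}. U a x)) has_derivative
     (\<lambda>h. (\<Sum>a\<in>{1..n}. \<Sum>c\<in>{a<..n}. h \<bullet> DD a c) + 1 / 2 * (\<Sum>a\<in>{1..n}. h \<bullet> (if a = i then 2 *\<^sub>R K (z i) (z i) else 0)))) (at (z i))"
    by (intro has_derivative_add has_derivative_sum has_derivative_mult_right T U)
  moreover have "(\<lambda>h. (\<Sum>a\<in>{1..n}. \<Sum>c\<in>{a<..n}. h \<bullet> DD a c) + 1 / 2 * (\<Sum>a\<in>{1..n}. h \<bullet> (if a = i then 2 *\<^sub>R K (z i) (z i) else 0)))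
    = (\<lambda>h. h \<bullet> (- velocity b n z i))"
  proof
    fix h
    have "(\<Sum>a\<in>{1..n}. \<Sum>c\<in>{a<..n}. h \<bullet> DD a c) = h \<bullet> (\<Sum>a\<in>{1..n}. \<Sum>c\<in>{a<..n}. DD a c)"
      by (simp add: inner_sum_right)
    also have "(\<Sum>a\<in>{1..n}. \<Sum>c\<in>{a<..n}. DD a c) = (\<Sum>j\<in>{1..n} - {i}. g j)"
      unfolding DD_def by (rule sum_pairs_containing[OF i])
    finally have 1: "(\<Sum>a\<in>{1..n}. \<Sum>c\<in>{a<..n}. h \<bullet> DD a c) = h \<bullet> (\<Sum>j\<in>{1..n} - {i}. g j)" .
    have "(\<Sum>a\<in>{1..n}. h \<bullet> (if a = i then 2 *\<^sub>R K (z i) (z i) else 0)) = h \<bullet> (\<Sum>a\<in>{1..n}. (if a = i then 2 *\<^sub>R K (z i) (z i) else 0))"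
      by (simp only: inner_sum_right)
    also have "\<dots> = 2 * (h \<bullet> K (z i) (z i))" using i by (simp add: sum.delta)
    finally show "(\<Sum>a\<in>{1..n}. \<Sum>c\<in>{a<..n}. h \<bullet> DD a c) + 1 / 2 * (\<Sum>a\<in>{1..n}. h \<bullet> (if a = i then 2 *\<^sub>R K (z i) (z i) else 0))
      = h \<bullet> (- velocity b n z i)"
      unfolding 1 by (simp add: velocity_def g_def inner_simps)
  qed
  moreover have "(\<lambda>x. energy k b n (?u x)) = (\<lambda>x. (\<Sum>a\<in>{1..n}. \<Sum>c\<in>{a<..n}. T a c x) + 1 / 2 * (\<Sum>a\<in>{1..n}. U a x))"
    by (simp add: energy_def T_def U_def)
  ultimately show ?thesis unfolding gderiv_def by simp
qed

section \<open>Local Lipschitz bounds for the velocity\<close>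

lemma K_Lipschitz:
  assumes "far y d" "far y' d" "far (midpoint x x') d" "x \<in> \<Omega>" "x' \<in> \<Omega>"
  shows "norm (K y x - K y' x') \<le> (norm (y - y') + norm (x - x')) / d\<^sup>2"
proof -
  have d: "0 < d" using assms farD by blast
  \<comment> \<open>Sharp constants matter only for the decay of the pair distance; for existence
    and uniqueness both factors may be rounded up to 1.\<close>
  have p: "1 / (2 * pi) \<le> 1" "7 / 4 * (1 / (2 * pi)) \<le> 1" using pi_gt3 by (auto simp: divide_simps)
  have "norm (K y x - K y' x') \<le> norm (K y x - K y' x) + norm (K y' x - K y' x')"
    using norm_triangle_ineq[of "K y x - K y' x" "K y' x - K y' x'"] by simp
  also have "norm (K y x - K y' x) \<le> 1 / (2 * pi) * (norm (y - y') / d\<^sup>2)"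
    using K_first_Lipschitz[OF assms(1,2,4)] by (simp add: power2_eq_square)
  also have "\<dots> \<le> 1 * (norm (y - y') / d\<^sup>2)" by (intro mult_right_mono p) simp
  also have "norm (K y' x - K y' x') \<le> 7 / 4 * (1 / (2 * pi)) * (norm (x - x') / d\<^sup>2)"
    using K_second_Lipschitz[OF assms(2,3,4,5)] by (simp add: power2_eq_square)
  also have "\<dots> \<le> 1 * (norm (x - x') / d\<^sup>2)" by (intro mult_right_mono p) simp
  finally show ?thesis by (simp add: add_divide_distrib)
qed

lemma G_Lipschitz:
  assumes "far y d" "far y' d" "far (midpoint x x') d" "x \<in> \<Omega>" "x' \<in> \<Omega>"
    and "d \<le> norm (y - x)" "d \<le> norm (y' - x')"
  shows "norm (G y x - G y' x') \<le> 2 * (norm (y - y') + norm (x - x')) / d\<^sup>2"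
proof -
  have d: "0 < d" using assms farD by blast
  have "norm (vinv (y - x) - vinv (y' - x')) = norm ((y - x) - (y' - x')) / (norm (y - x) * norm (y' - x'))"
    using assms d by (intro norm_vinv_diff) auto
  also have "\<dots> \<le> (norm (y - y') + norm (x - x')) / (d * d)"
  proof (rule frac_le)
    show "norm ((y - x) - (y' - x')) \<le> norm (y - y') + norm (x - x')"
      using norm_triangle_ineq4[of "y - y'" "x - x'"] by (simp add: algebra_simps)
    show "d * d \<le> norm (y - x) * norm (y' - x')" using assms d by (intro mult_mono) auto
  qed (use d in auto)
  finally have v: "norm (vinv (y - x) - vinv (y' - x')) \<le> (norm (y - y') + norm (x - x')) / d\<^sup>2"
    by (simp add: power2_eq_square)
  have "G y x - G y' x' = (K y x - K y' x') - (1 / (2 * pi)) *\<^sub>R (vinv (y - x) - vinv (y' - x'))"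
    by (simp add: G_def algebra_simps)
  then have "norm (G y x - G y' x') \<le> norm (K y x - K y' x') + 1 / (2 * pi) * norm (vinv (y - x) - vinv (y' - x'))"
    using norm_triangle_ineq4[of "K y x - K y' x'" "(1 / (2 * pi)) *\<^sub>R (vinv (y - x) - vinv (y' - x'))"] by simp
  also have "1 / (2 * pi) * norm (vinv (y - x) - vinv (y' - x')) \<le> 1 * norm (vinv (y - x) - vinv (y' - x'))"
    using pi_gt3 by (intro mult_right_mono) (auto simp: divide_simps)
  finally show ?thesis using v K_Lipschitz[OF assms(1-5)] by (simp add: add_divide_distrib)
qed

lemma far_mono: "far x d \<Longrightarrow> 0 < d' \<Longrightarrow> d' \<le> d \<Longrightarrow> far x d'"
  by (force simp: far_def)

text \<open>Some \<open>d\<close> bounds from below all distances between points and to the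
  boundary. If each point moves by less than \<open>d / 4\<close>, at least half of every distance
  remains, and there each term of the velocity is Lipschitz.\<close>

lemma velocity_local_Lipschitz:
  assumes z: "z \<in> {1..n} \<rightarrow> \<Omega>" "inj_on z {1..n}" and b: "\<And>i. i \<in> {1..n} \<Longrightarrow> \<bar>b i\<bar> = 1"
  shows "\<exists>\<delta>>0. \<exists>L\<ge>0. \<forall>x y. (\<forall>i\<in>{1..n}. norm (x i - z i) < \<delta> \<and> norm (y i - z i) < \<delta>) \<longrightarrow>
    (\<forall>i\<in>{1..n}. norm (velocity b n x i - velocity b n y i) \<le> L * (\<Sum>j\<in>{1..n}. norm (x j - y j)))"
proof -
  have "\<exists>d. far (z i) d" if "i \<in> {1..n}" for i
    using far_ex[of "z i"] z(1) that by (auto simp: Pi_iff)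
  then obtain D where D: "\<And>i. i \<in> {1..n} \<Longrightarrow> far (z i) (D i)" by metis
  define A where "A = insert 1 (D ` {1..n} \<union> (\<lambda>(i, j). norm (z i - z j)) ` {p \<in> {1..n} \<times> {1..n}. fst p \<noteq> snd p})"
  have finA: "finite A" unfolding A_def by simp
  have posA: "\<forall>a\<in>A. 0 < a"
  proof
    fix a assume "a \<in> A"
    then consider "a = 1" | i where "i \<in> {1..n}" "a = D i"
      | i j where "i \<in> {1..n}" "j \<in> {1..n}" "i \<noteq> j" "a = norm (z i - z j)"
      by (auto simp: A_def)
    then show "0 < a"
      by cases (use farD(2)[OF D] inj_onD[OF z(2)] in auto)
  qed
  define d where "d = Min A"
  have d0: "0 < d" using finA posA by (auto simp: d_def A_def Min_gr_iff)
  have dfar: "far (z i) d" if "i \<in> {1..n}" for i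
  proof (rule far_mono[OF D[OF that] d0])
    show "d \<le> D i" unfolding d_def using finA that by (intro Min_le) (auto simp: A_def)
  qed
  have dsep: "d \<le> norm (z i - z j)" if "i \<in> {1..n}" "j \<in> {1..n}" "i \<noteq> j" for i j
    unfolding d_def using finA that by (intro Min_le) (force simp: A_def)+
  define e where "e = d / 2"
  define L where "L = real n * (4 / e\<^sup>2) + 2 / e\<^sup>2"
  have e0: "0 < e" using d0 by (simp add: e_def)
  show ?thesis
  proof (rule exI[of _ "d / 4"], intro conjI exI[of _ L] allI impI ballI)
    show "0 < d / 4" "0 \<le> L" using d0 e0 by (auto simp: L_def)
    fix x y :: "nat \<Rightarrow> real^2" and i
    assume xy: "\<forall>i\<in>{1..n}. norm (x i - z i) < d / 4 \<and> norm (y i - z i) < d / 4" and i: "i \<in> {1..n}"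
    have x: "norm (x i - z i) < d / 4" and y: "norm (y i - z i) < d / 4" if "i \<in> {1..n}" for i
      using xy that by auto
    define S where "S = (\<Sum>j\<in>{1..n}. norm (x j - y j))"
    have S: "norm (x j - y j) \<le> S" if "j \<in> {1..n}" for j
      unfolding S_def using that by (intro member_le_sum) auto
    have near: "far w e" if "j \<in> {1..n}" "norm (w - z j) < d / 4" for w j
      using that d0 by (intro far_perturb[OF dfar]) (auto simp: dist_norm norm_minus_commute e_def)
    have mid: "norm (midpoint (x j) (y j) - z j) < d / 4" if "j \<in> {1..n}" for j
    proof -
      have "midpoint (x j) (y j) \<in> ball (z j) (d / 4)"
        using x[OF that] y[OF that]
        by (intro subsetD[OF _ midpoint_in_closed_segment] closed_segment_subset convex_ball)
          (auto simp: dist_norm norm_minus_commute)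
      then show ?thesis by (simp add: dist_norm norm_minus_commute)
    qed
    have fx: "far (x j) e" "far (y j) e" "far (midpoint (x j) (y j)) e" if "j \<in> {1..n}" for j
      using near[OF that] x[OF that] y[OF that] mid[OF that] by auto
    have sep: "e \<le> norm (w j - w l)"
      if "j \<in> {1..n}" "l \<in> {1..n}" "j \<noteq> l" "\<And>i. i \<in> {1..n} \<Longrightarrow> norm (w i - z i) < d / 4" for w j l
    proof -
      have "norm (z j - z l) \<le> norm (w j - w l) + norm (w j - z j) + norm (w l - z l)"
        using norm_triangle_ineq4[of "w j - w l" "(w j - z j) - (w l - z l)"]
          norm_triangle_ineq4[of "w j - z j" "w l - z l"] by simp
      then show ?thesis using dsep[OF that(1-3)] that(4)[OF that(1)] that(4)[OF that(2)] by (simp add: e_def)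
    qed
    have Kd: "norm (K (x i) (x i) - K (y i) (y i)) \<le> 2 / e\<^sup>2 * S"
    proof -
      have "norm (K (x i) (x i) - K (y i) (y i)) \<le> (norm (x i - y i) + norm (x i - y i)) / e\<^sup>2"
        using fx[OF i] farD by (intro K_Lipschitz) auto
      also have "\<dots> \<le> (S + S) / e\<^sup>2" using S[OF i] by (intro divide_right_mono) auto
      finally show ?thesis by simp
    qed
    have Gd: "norm ((b i * b j) *\<^sub>R G (x i) (x j) - (b i * b j) *\<^sub>R G (y i) (y j)) \<le> 4 / e\<^sup>2 * S" if j: "j \<in> {1..n} - {i}" for j
    proof -
      have "norm ((b i * b j) *\<^sub>R G (x i) (x j) - (b i * b j) *\<^sub>R G (y i) (y j)) = norm (G (x i) (x j) - G (y i) (y j))"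
        using b[OF i] b[of j] j by (simp add: abs_mult flip: scaleR_diff_right)
      also have "\<dots> \<le> 2 * (norm (x i - y i) + norm (x j - y j)) / e\<^sup>2"
        using fx[OF i] fx[of j] j i farD x y by (intro G_Lipschitz sep) auto
      also have "\<dots> \<le> 2 * (S + S) / e\<^sup>2" using S[OF i] S[of j] j by (intro divide_right_mono) auto
      finally show ?thesis by simp
    qed
    have "velocity b n x i - velocity b n y i =
      - (\<Sum>j\<in>{1..n} - {i}. (b i * b j) *\<^sub>R G (x i) (x j) - (b i * b j) *\<^sub>R G (y i) (y j)) - (K (x i) (x i) - K (y i) (y i))"
      by (simp add: velocity_def sum_subtractf)
    then have "norm (velocity b n x i - velocity b n y i) \<le>
      norm (\<Sum>j\<in>{1..n} - {i}. (b i * b j) *\<^sub>R G (x i) (x j) - (b i * b j) *\<^sub>R G (y i) (y j)) + norm (K (x i) (x i) - K (y i) (y i))"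
      by (metis (no_types) norm_triangle_ineq4 norm_minus_cancel)
    also have "\<dots> \<le> (\<Sum>j\<in>{1..n} - {i}. 4 / e\<^sup>2 * S) + 2 / e\<^sup>2 * S"
      by (intro add_mono sum_norm_le Gd Kd)
    also have "\<dots> \<le> L * S"
    proof -
      have "0 \<le> S" by (simp add: S_def sum_nonneg)
      have "(\<Sum>j\<in>{1..n} - {i}. 4 / e\<^sup>2 * S) \<le> (\<Sum>j\<in>{1..n}. 4 / e\<^sup>2 * S)"
        using \<open>0 \<le> S\<close> by (intro sum_mono2) auto
      then show ?thesis by (simp add: L_def algebra_simps)
    qed
    finally show "norm (velocity b n x i - velocity b n y i) \<le> L * (\<Sum>j\<in>{1..n}. norm (x j - y j))"
      unfolding S_def .
  qed
qed

end

section \<open>Global solutions of ordinary differential equations\<close>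

lemma integral_upper_has_vector_derivative:
  fixes g :: "real \<Rightarrow> 'a::banach"
  assumes g: "continuous_on {0..} g" and "0 \<le> t"
  shows "((\<lambda>t. integral {0..t} g) has_vector_derivative g t) (at t within {0..})"
proof -
  have "((\<lambda>t. integral {0..t} g) has_vector_derivative g t) (at t within {0..t + 1})"
    by (rule integral_has_vector_derivative) (use assms in \<open>auto intro: continuous_on_subset\<close>)
  moreover have "at t within {0..t + 1} = at t within {0..}"
    by (rule at_within_nhd[of _ "{..<t + 1}"]) (use assms in auto)
  ultimately show ?thesis by simp
qed

lemma integral_exp_le:
  fixes T :: real assumes "0 < c" "0 \<le> T"
  shows "integral {0..T} (\<lambda>s. exp (c * s)) \<le> exp (c * T) / c"
proof -
  have "((\<lambda>s. exp (c * s)) has_integral (exp (c * T) / c - exp (c * 0) / c)) {0..T}"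
    by (rule fundamental_theorem_of_calculus)
      (use assms in \<open>auto intro!: derivative_eq_intros simp: has_real_derivative_iff_has_vector_derivative[symmetric]\<close>)
  then show ?thesis using assms by (simp add: integral_unique)
qed

text \<open>Picard iteration in an exponentially weighted sup norm (Bielecki): the weight makes the
  integral operator a contraction on the whole half-line at once, so local solutions need not be
  continued.\<close>

theorem picard_lindeloef_global:
  fixes F :: "'a::banach \<Rightarrow> 'a"
  assumes lip: "L-lipschitz_on UNIV F"
  obtains x where "x 0 = x0" "\<And>t. 0 \<le> t \<Longrightarrow> (x has_vector_derivative F (x t)) (at t within {0..})"
proof -
  define M where "M = L + 1"
  have M: "0 < M" using lipschitz_on_nonneg[OF lip] by (simp add: M_def)
  have FL: "norm (F x - F y) \<le> M * norm (x - y)" for x y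
  proof -
    have "norm (F x - F y) \<le> L * norm (x - y)"
      using lipschitz_onD[OF lip, of x y] by (simp add: dist_norm)
    also have "\<dots> \<le> M * norm (x - y)" by (intro mult_right_mono) (auto simp: M_def)
    finally show ?thesis .
  qed
  have Fcont: "continuous_on UNIV F" using lip by (rule lipschitz_on_continuous_on)
  \<comment> \<open>In the weighted norm the operator has Lipschitz constant \<open>M / c\<close>;
    this choice makes it \<open>1 / 2\<close>.\<close>
  define c where "c = 2 * M"
  have c: "0 < c" using M by (simp add: c_def)
  define g where "g \<phi> s = F (exp (c * s) *\<^sub>R apply_bcontfun \<phi> s)" for \<phi> s
  have gcont: "continuous_on S (g \<phi>)" for \<phi> S
    unfolding g_def by (intro continuous_on_compose2[OF Fcont] continuous_intros) auto
  define I where "I \<phi> T = integral {0..T} (g \<phi>)" for \<phi> T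
  have Ider: "(I \<phi> has_vector_derivative g \<phi> t) (at t within {0..})" if "0 \<le> t" for \<phi> t
    unfolding I_def by (rule integral_upper_has_vector_derivative[OF gcont that])
  have Icont: "continuous_on {0..} (I \<phi>)" for \<phi>
    unfolding continuous_on_eq_continuous_within
    by (intro ballI has_vector_derivative_continuous[OF Ider]) simp
  \<comment> \<open>The fixed point is \<open>exp (- c * t)\<close> times the solution. Bounded
    continuous functions are defined on all of \<open>real\<close>, so for negative times the value
    at 0 is used.\<close>
  define Q where "Q \<phi> t = exp (- c * max 0 t) *\<^sub>R (x0 + I \<phi> (max 0 t))" for \<phi> and t :: real
  have Ibound: "norm (I \<phi> T - J) \<le> B * (exp (c * T) / c)"
    if "0 \<le> T" and J: "(h has_integral J) {0..T}"
      and B: "\<And>s. s \<in> {0..T} \<Longrightarrow> norm (g \<phi> s - h s) \<le> B * exp (c * s)" "0 \<le> B" for \<phi> h J T B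
  proof -
    have gI: "(g \<phi> has_integral I \<phi> T) {0..T}"
      unfolding I_def using gcont by (intro integrable_integral integrable_continuous_real) auto
    have "norm (integral {0..T} (\<lambda>s. g \<phi> s - h s)) \<le> integral {0..T} (\<lambda>s. B * exp (c * s))"
      by (rule integral_norm_bound_integral)
        (use B in \<open>auto intro!: integrable_continuous_real continuous_intros
            has_integral_integrable[OF has_integral_diff[OF gI J]]\<close>)
    also have "integral {0..T} (\<lambda>s. g \<phi> s - h s) = I \<phi> T - J"
      by (rule integral_unique) (rule has_integral_diff[OF gI J])
    also have "integral {0..T} (\<lambda>s. B * exp (c * s)) \<le> B * (exp (c * T) / c)"
      using mult_left_mono[OF integral_exp_le[OF c \<open>0 \<le> T\<close>] B(2)] by simp
    finally show ?thesis .
  qed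
  have ee: "exp (- c * T) * (B * (exp (c * T) / c)) = B / c" for B T
    by (simp add: exp_minus field_simps)
  have scale: "exp (- c * T) * a \<le> B / c" if "a \<le> B * (exp (c * T) / c)" for a B T
    using mult_left_mono[OF that, of "exp (- c * T)"] unfolding ee by simp
  have Qb: "Q \<phi> \<in> bcontfun" for \<phi>
  proof (rule bcontfun_normI)
    show "continuous_on UNIV (Q \<phi>)" unfolding Q_def
      by (intro continuous_intros continuous_on_compose2[OF Icont]) auto
    fix t :: real
    define T where "T = max 0 t"
    let ?B = "norm (F 0) + M * norm \<phi>"
    have T: "0 \<le> T" by (simp add: T_def)
    have B: "0 \<le> ?B" using M by simp
    have "norm (I \<phi> T - 0) \<le> ?B * (exp (c * T) / c)"
    proof (rule Ibound[OF T _ _ B])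
      show "((\<lambda>s. 0) has_integral 0) {0..T}" by simp
      fix s assume s: "s \<in> {0..T}"
      have "norm (g \<phi> s) \<le> norm (F 0) + norm (g \<phi> s - F 0)"
        using norm_triangle_ineq[of "F 0" "g \<phi> s - F 0"] by simp
      also have "norm (g \<phi> s - F 0) \<le> M * (exp (c * s) * norm (apply_bcontfun \<phi> s))"
        using FL[of "exp (c * s) *\<^sub>R apply_bcontfun \<phi> s" 0] by (simp add: g_def)
      also have "\<dots> \<le> M * (exp (c * s) * norm \<phi>)"
        using M norm_bounded[of \<phi> s] by (intro mult_left_mono) auto
      also have "norm (F 0) \<le> norm (F 0) * exp (c * s)"
        using s c mult_left_mono[of 1 "exp (c * s)" "norm (F 0)"] by simp
      finally show "norm (g \<phi> s - 0) \<le> ?B * exp (c * s)" by (simp add: algebra_simps)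
    qed
    then have "exp (- c * T) * norm (I \<phi> T) \<le> ?B / c"
      by (intro scale) simp
    moreover have "exp (- c * T) * norm x0 \<le> norm x0"
      using T c mult_right_mono[of "exp (- c * T)" 1 "norm x0"] by simp
    moreover have "norm (Q \<phi> t) \<le> exp (- c * T) * (norm x0 + norm (I \<phi> T))"
      unfolding Q_def T_def[symmetric] by (simp add: norm_triangle_ineq)
    ultimately show "norm (Q \<phi> t) \<le> norm x0 + ?B / c" by (simp add: algebra_simps)
  qed
  define P where "P \<phi> = Bcontfun (Q \<phi>)" for \<phi>
  have P: "apply_bcontfun (P \<phi>) = Q \<phi>" for \<phi> unfolding P_def by (simp add: Bcontfun_inverse Qb)
  have "\<exists>!\<phi>. P \<phi> = \<phi>"
  proof (rule banach_fix_type[of "1/2"])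
    show "\<forall>\<phi> \<psi>. dist (P \<phi>) (P \<psi>) \<le> 1/2 * dist \<phi> \<psi>"
    proof (intro allI dist_bound)
      fix \<phi> \<psi> and t :: real
      define T where "T = max 0 t"
      have T: "0 \<le> T" by (simp add: T_def)
      have "norm (I \<phi> T - I \<psi> T) \<le> (M * dist \<phi> \<psi>) * (exp (c * T) / c)"
      proof (rule Ibound[OF T])
        show "(g \<psi> has_integral I \<psi> T) {0..T}"
          unfolding I_def using gcont by (intro integrable_integral integrable_continuous_real) auto
        fix s
        have "norm (g \<phi> s - g \<psi> s) \<le> M * (exp (c * s) * norm (apply_bcontfun \<phi> s - apply_bcontfun \<psi> s))"
          using FL[of "exp (c * s) *\<^sub>R apply_bcontfun \<phi> s" "exp (c * s) *\<^sub>R apply_bcontfun \<psi> s"]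
          by (simp add: g_def flip: scaleR_diff_right)
        also have "\<dots> \<le> M * (exp (c * s) * dist \<phi> \<psi>)"
          using M dist_bounded[of \<phi> s \<psi>] by (intro mult_left_mono) (auto simp: dist_norm)
        finally show "norm (g \<phi> s - g \<psi> s) \<le> M * dist \<phi> \<psi> * exp (c * s)" by (simp add: mult_ac)
      qed (use M in simp)
      then have "exp (- c * T) * norm (I \<phi> T - I \<psi> T) \<le> M * dist \<phi> \<psi> / c"
        by (rule scale)
      then show "dist (apply_bcontfun (P \<phi>) t) (apply_bcontfun (P \<psi>) t) \<le> 1/2 * dist \<phi> \<psi>"
        unfolding P Q_def T_def[symmetric] dist_norm using M
        by (simp add: c_def flip: scaleR_diff_right)
    qed
  qed auto
  then obtain \<phi> where "P \<phi> = \<phi>" by blast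
  then have fixpt: "apply_bcontfun \<phi> = Q \<phi>" using P by metis
  define x where "x t = x0 + I \<phi> t" for t
  have xg: "g \<phi> t = F (x t)" if "0 \<le> t" for t
    using that unfolding g_def fixpt by (simp add: Q_def x_def exp_minus)
  show thesis
  proof
    show "x 0 = x0" by (simp add: x_def I_def)
    fix t :: real assume t: "0 \<le> t"
    show "(x has_vector_derivative F (x t)) (at t within {0..})"
      unfolding x_def using Ider[OF t, of \<phi>] xg[OF t]
      by (auto intro!: derivative_eq_intros simp: x_def)
  qed
qed

text \<open>A straight line of slope \<open>F x0\<close> continues the solution to negative times,
  which makes the derivative at 0 two-sided. Derivative tests and the inverse function rule then
  apply at the initial time without a special case.\<close>

corollary picard_lindeloef_extended:
  fixes F :: "'a::banach \<Rightarrow> 'a"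
  assumes lip: "L-lipschitz_on UNIV F"
  obtains x where "x 0 = x0" "\<And>t. (x has_vector_derivative F (x (max 0 t))) (at t)"
proof -
  obtain y where y: "y 0 = x0" "\<And>t. 0 \<le> t \<Longrightarrow> (y has_vector_derivative F (y t)) (at t within {0..})"
    using picard_lindeloef_global[OF lip] by blast
  define x where "x = (\<lambda>t. if t \<in> {0..} then y t else x0 + t *\<^sub>R F x0)"
  show thesis
  proof
    show "x 0 = x0" using y by (simp add: x_def)
    fix t :: real
    have cl: "closure {..<0::real} = {..0}" by simp
    have "(x has_vector_derivative (if t \<in> {0..} then F (y t) else F x0)) (at t within UNIV)"
      unfolding x_def
    proof (rule has_vector_derivative_If_within_closures[where T="{..<0}"])
      show "(y has_vector_derivative F (y t)) (at t within {0..} \<union> closure {0..} \<inter> closure {..<0})"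
        if "t \<in> {0..} \<union> closure {0..} \<inter> closure {..<0}"
      proof -
        have "{0..} \<union> closure {0..} \<inter> closure {..<0} = {0::real..}" by auto
        then show ?thesis using y(2)[of t] that by auto
      qed
    qed (auto intro!: derivative_eq_intros simp: y(1))
    then show "(x has_vector_derivative F (x (max 0 t))) (at t)"
      using y(1) by (auto simp: x_def max_def split: if_splits)
  qed
qed

lemma gronwall_zero:
  fixes \<phi> :: "real \<Rightarrow> real"
  assumes "a \<le> b" "continuous_on {a..b} \<phi>"
    and "\<And>t. a < t \<Longrightarrow> t < b \<Longrightarrow> (\<phi> has_real_derivative \<phi>' t) (at t)"
    and "\<And>t. a < t \<Longrightarrow> t < b \<Longrightarrow> \<phi>' t \<le> C * \<phi> t" and "\<phi> a = 0"
  shows "\<phi> b \<le> 0"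
proof (cases "a = b")
  case False
  then have ab: "a < b" using assms by simp
  let ?\<psi> = "\<lambda>t. exp (- C * t) * \<phi> t"
  have "?\<psi> b \<le> ?\<psi> a"
  proof (rule DERIV_nonpos_imp_decreasing_open[OF assms(1)])
    fix t assume t: "a < t" "t < b"
    have "(?\<psi> has_real_derivative exp (- C * t) * (\<phi>' t - C * \<phi> t)) (at t)"
      using assms(3)[OF t] by (auto intro!: derivative_eq_intros simp: algebra_simps)
    moreover have "exp (- C * t) * (\<phi>' t - C * \<phi> t) \<le> 0"
      using assms(4)[OF t] by (intro mult_nonneg_nonpos) auto
    ultimately show "\<exists>y. (?\<psi> has_real_derivative y) (at t) \<and> y \<le> 0" by blast
  qed (intro continuous_intros assms)
  then show ?thesis using assms(5) by (simp add: mult_le_0_iff)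
qed (use assms in simp)

section \<open>Uniqueness of the evolution\<close>

lemma evolution_restrict:
  assumes "evolution \<Omega> k b n T z" "S \<le> T" shows "evolution \<Omega> k b n S z"
  unfolding evolution_def
proof (intro conjI ballI)
  fix i assume i: "i \<in> {1..n}"
  have "continuous_on {0..T} (\<lambda>t. z t i)" using assms(1) i unfolding evolution_def by blast
  then show "continuous_on {0..S} (\<lambda>t. z t i)" by (rule continuous_on_subset) (use assms(2) in auto)
next
  fix t assume t: "t \<in> {0..<S}"
  then have t': "t \<in> {0..<T}" using assms by auto
  then show "z t \<in> {1..n} \<rightarrow> \<Omega>" "inj_on (z t) {1..n}"
    using assms(1) unfolding evolution_def by blast+
  fix i assume i: "i \<in> {1..n}"
  obtain g where g: "GDERIV (\<lambda>x. energy k b n ((z t)(i := x))) (z t i) :> g"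
    "((\<lambda>s. z s i) has_vector_derivative - g) (at t within {0..<T})"
    using assms(1) t' i unfolding evolution_def by blast
  have "((\<lambda>s. z s i) has_vector_derivative - g) (at t within {0..<S})"
    using g(2) by (rule has_vector_derivative_within_subset) (use assms in auto)
  with g(1) show "\<exists>g. GDERIV (\<lambda>x. energy k b n ((z t)(i := x))) (z t i) :> g \<and>
    ((\<lambda>s. z s i) has_vector_derivative - g) (at t within {0..<S})" by blast
qed

context dirichlet_kernel begin

lemma evolution_velocity:
  assumes b: "\<And>i. i \<in> {1..n} \<Longrightarrow> \<bar>b i\<bar> = 1" and z: "evolution \<Omega> k b n T z"
    and t: "t \<in> {0..<T}" and i: "i \<in> {1..n}"
  shows "((\<lambda>s. z s i) has_vector_derivative velocity b n (z t) i) (at t within {0..<T})"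
proof -
  have dom: "z t \<in> {1..n} \<rightarrow> \<Omega>" "inj_on (z t) {1..n}"
    using z t unfolding evolution_def by blast+
  obtain g where g: "GDERIV (\<lambda>x. energy k b n ((z t)(i := x))) (z t i) :> g"
    "((\<lambda>s. z s i) has_vector_derivative - g) (at t within {0..<T})"
    using z t i unfolding evolution_def by blast
  have "(b i)\<^sup>2 = 1" using b[OF i] by (metis abs_one one_power2 power2_abs)
  with dom i have "GDERIV (\<lambda>x. energy k b n ((z t)(i := x))) (z t i) :> - velocity b n (z t) i"
    by (intro energy_GDERIV)
  from GDERIV_unique[OF g(1) this] g(2) show ?thesis by simp
qed

text \<open>In physical time the velocity is only locally Lipschitz, with constants that degenerate
  at a collision. The proof therefore starts from the last time \<open>s\<close> at which the two
  evolutions agree, takes the Lipschitz constant around that configuration, and pushes the agreement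
  past \<open>s\<close> by Gronwall.\<close>

lemma evolution_unique:
  assumes b: "\<And>i. i \<in> {1..n} \<Longrightarrow> \<bar>b i\<bar> = 1"
    and w: "evolution \<Omega> k b n S w" and z: "evolution \<Omega> k b n S z"
    and init: "\<And>i. i \<in> {1..n} \<Longrightarrow> w 0 i = z 0 i" and S: "0 < S"
    and t: "t \<in> {0..S}" and i: "i \<in> {1..n}"
  shows "w t i = z t i"
proof -
  have cw: "continuous_on {0..S} (\<lambda>t. w t i)" and cz: "continuous_on {0..S} (\<lambda>t. z t i)"
    if "i \<in> {1..n}" for i using w z that by (auto simp: evolution_def)
  define \<phi> where "\<phi> t = (\<Sum>i\<in>{1..n}. (norm (w t i - z t i))\<^sup>2)" for t
  have \<phi>c: "continuous_on {0..S} \<phi>" unfolding \<phi>_def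
    by (intro continuous_intros cw cz) auto
  have \<phi>0: "\<phi> t = 0 \<longleftrightarrow> (\<forall>i\<in>{1..n}. w t i = z t i)" for t
    unfolding \<phi>_def by (subst sum_nonneg_eq_0_iff) auto
  have \<phi>nn: "0 \<le> \<phi> t" for t unfolding \<phi>_def by (intro sum_nonneg) auto
  have zero: "\<phi> t1 = 0" if t1: "t1 \<in> {0..<S}" for t1
  proof (rule ccontr)
    assume ne: "\<phi> t1 \<noteq> 0"
    define B where "B = {t \<in> {0..t1}. \<phi> t = 0}"
    have c1: "continuous_on {0..t1} \<phi>" by (rule continuous_on_subset[OF \<phi>c]) (use t1 in auto)
    have "closed B" unfolding B_def using continuous_closed_preimage_constant[OF c1, of 0] by simp
    moreover have "bounded B" by (rule bounded_subset[of "{0..t1}"]) (auto simp: B_def)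
    ultimately have "compact B" by (simp add: compact_eq_bounded_closed)
    moreover have "0 \<in> B" using t1 init \<phi>0 by (auto simp: B_def)
    ultimately obtain s where s: "s \<in> B" "\<And>t. t \<in> B \<Longrightarrow> t \<le> s"
      using compact_attains_sup[of B] by auto
    have s1: "0 \<le> s" "s < t1" "s \<in> {0..<S}" "\<phi> s = 0"
      using s(1) ne t1 by (auto simp: B_def order.order_iff_strict)
    have eqs: "w s i = z s i" if "i \<in> {1..n}" for i using s1(4) \<phi>0 that by blast
    have dom: "z s \<in> {1..n} \<rightarrow> \<Omega>" "inj_on (z s) {1..n}"
      using z s1(3) unfolding evolution_def by blast+
    have "\<exists>\<delta>>0. \<exists>L\<ge>0. \<forall>x y. (\<forall>i\<in>{1..n}. norm (x i - z s i) < \<delta> \<and> norm (y i - z s i) < \<delta>) \<longrightarrow>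
        (\<forall>i\<in>{1..n}. norm (velocity b n x i - velocity b n y i) \<le> L * (\<Sum>j\<in>{1..n}. norm (x j - y j)))"
      by (rule velocity_local_Lipschitz[OF dom b])
    then obtain \<delta> L where \<delta>: "0 < \<delta>" "0 \<le> L"
      and lip: "\<forall>x y. (\<forall>i\<in>{1..n}. norm (x i - z s i) < \<delta> \<and> norm (y i - z s i) < \<delta>) \<longrightarrow>
        (\<forall>i\<in>{1..n}. norm (velocity b n x i - velocity b n y i) \<le> L * (\<Sum>j\<in>{1..n}. norm (x j - y j)))"
      by (elim exE conjE) blast
    have "\<forall>i\<in>{1..n}. \<forall>\<^sub>F t in at s within {0..S}. norm (w t i - z s i) < \<delta> \<and> norm (z t i - z s i) < \<delta>"
    proof
      fix i assume i: "i \<in> {1..n}"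
      have "((\<lambda>t. w t i) \<longlongrightarrow> w s i) (at s within {0..S})" "((\<lambda>t. z t i) \<longlongrightarrow> z s i) (at s within {0..S})"
        using cw[OF i] cz[OF i] s1 by (auto simp: continuous_on_def)
      from eventually_conj[OF tendstoD[OF this(1) \<delta>(1)] tendstoD[OF this(2) \<delta>(1)]]
      show "\<forall>\<^sub>F t in at s within {0..S}. norm (w t i - z s i) < \<delta> \<and> norm (z t i - z s i) < \<delta>"
        unfolding eqs[OF i] dist_norm .
    qed
    then have "\<forall>\<^sub>F t in at s within {0..S}. \<forall>i\<in>{1..n}. norm (w t i - z s i) < \<delta> \<and> norm (z t i - z s i) < \<delta>"
      by (simp add: eventually_ball_finite_distrib)
    then obtain \<epsilon> where \<epsilon>: "0 < \<epsilon>" "\<And>t i. t \<in> {0..S} \<Longrightarrow> t \<noteq> s \<Longrightarrow> dist t s < \<epsilon> \<Longrightarrow> i \<in> {1..n} \<Longrightarrow>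
       norm (w t i - z s i) < \<delta> \<and> norm (z t i - z s i) < \<delta>"
      unfolding eventually_at by blast
    define e where "e = min t1 (s + \<epsilon> / 2)"
    have e: "s < e" "e \<le> t1" "e < S" "e < s + \<epsilon>" using s1 \<epsilon>(1) t1 by (auto simp: e_def)
    have "\<phi> e \<le> 0"
    proof (rule gronwall_zero[OF less_imp_le[OF e(1)], where C="2 * L * real n"])
      show "continuous_on {s..e} \<phi>" by (rule continuous_on_subset[OF \<phi>c]) (use s1 e in auto)
      let ?\<phi>' = "\<lambda>t. \<Sum>i\<in>{1..n}. 2 * ((w t i - z t i) \<bullet> (velocity b n (w t) i - velocity b n (z t) i))"
      fix t assume t: "s < t" "t < e"
      have tS: "t \<in> {0..<S}" using t s1 e by auto
      have atw: "at t within {0..<S} = at t"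
        by (rule at_within_interior) (use t s1 e in auto)
      have der: "((\<lambda>t. (norm (w t i - z t i))\<^sup>2) has_real_derivative
         2 * ((w t i - z t i) \<bullet> (velocity b n (w t) i - velocity b n (z t) i))) (at t)" if i: "i \<in> {1..n}" for i
      proof -
        have dv: "((\<lambda>t. w t i - z t i) has_vector_derivative (velocity b n (w t) i - velocity b n (z t) i)) (at t)"
          using evolution_velocity[OF b w tS i] evolution_velocity[OF b z tS i] unfolding atw
          by (intro has_vector_derivative_diff)
        show ?thesis unfolding power2_norm_eq_inner has_real_derivative_iff_has_vector_derivative
          using bounded_bilinear.has_vector_derivative[OF bounded_bilinear_inner dv dv]
          by (simp add: inner_commute)
      qed
      show "(\<phi> has_real_derivative ?\<phi>' t) (at t)" unfolding \<phi>_def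
        by (intro DERIV_sum der)
      define Sm where "Sm = (\<Sum>j\<in>{1..n}. norm (w t j - z t j))"
      have "?\<phi>' t \<le> (\<Sum>i\<in>{1..n}. 2 * (norm (w t i - z t i) * (L * Sm)))"
      proof (rule sum_mono)
        fix i assume i: "i \<in> {1..n}"
        have near: "norm (w t i - z s i) < \<delta> \<and> norm (z t i - z s i) < \<delta>" if "i \<in> {1..n}" for i
          by (rule \<epsilon>(2)[OF _ _ _ that]) (use t s1 e in \<open>auto simp: dist_real_def\<close>)
        have "norm (velocity b n (w t) i - velocity b n (z t) i) \<le> L * Sm"
          unfolding Sm_def using lip[rule_format, of "w t" "z t" i] near i by blast
        then have "norm (w t i - z t i) * norm (velocity b n (w t) i - velocity b n (z t) i) \<le> norm (w t i - z t i) * (L * Sm)"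
          by (intro mult_left_mono) auto
        then show "2 * ((w t i - z t i) \<bullet> (velocity b n (w t) i - velocity b n (z t) i)) \<le> 2 * (norm (w t i - z t i) * (L * Sm))"
          using norm_cauchy_schwarz[of "w t i - z t i" "velocity b n (w t) i - velocity b n (z t) i"] by linarith
      qed
      also have "\<dots> = 2 * L * Sm\<^sup>2"
        by (simp add: Sm_def power2_eq_square sum_distrib_left sum_distrib_right mult_ac)
      also have "\<dots> \<le> 2 * L * (real n * \<phi> t)"
        using sum_squared_le_card[of "{1..n}" "\<lambda>j. norm (w t j - z t j)"] \<delta>(2)
        unfolding Sm_def \<phi>_def by (intro mult_left_mono) auto
      finally show "?\<phi>' t \<le> 2 * L * real n * \<phi> t" by (simp add: mult_ac)
    qed (rule s1)
    then have "e \<in> B" using \<phi>nn[of e] e s1 by (auto simp: B_def)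
    with s(2)[of e] e show False by simp
  qed
  have "\<phi> t = 0" if "t \<in> {0..S}" for t
  proof (rule continuous_constant_on_closure[where S="{0..<S}" and f=\<phi>])
    show "continuous_on (closure {0..<S}) \<phi>" using \<phi>c S by simp
  qed (use zero that S in auto)
  then show ?thesis using t i \<phi>0 by blast
qed

end

section \<open>Bounded Lipschitz maps and the space of configurations\<close>

definition bdd_Lipschitz :: "('a::metric_space \<Rightarrow> 'b::real_normed_vector) \<Rightarrow> bool" where
  "bdd_Lipschitz f \<longleftrightarrow> (\<exists>B L. 0 \<le> B \<and> 0 \<le> L \<and> (\<forall>x. norm (f x) \<le> B) \<and> (\<forall>x y. norm (f x - f y) \<le> L * dist x y))"

lemma bdd_LipschitzI:
  assumes "\<And>x. norm (f x) \<le> B" "\<And>x y. norm (f x - f y) \<le> L * dist x y" "0 \<le> L"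
  shows "bdd_Lipschitz f"
proof -
  have "0 \<le> B" using assms(1) norm_ge_zero order_trans by blast
  then show ?thesis using assms unfolding bdd_Lipschitz_def by blast
qed

lemma bdd_Lipschitz_const: "bdd_Lipschitz (\<lambda>x. c)"
  by (rule bdd_LipschitzI[of _ "norm c" 0]) auto

lemma bdd_Lipschitz_add:
  assumes "bdd_Lipschitz f" "bdd_Lipschitz g" shows "bdd_Lipschitz (\<lambda>x. f x + g x)"
proof -
  obtain B L where f: "\<And>x. norm (f x) \<le> B" "\<And>x y. norm (f x - f y) \<le> L * dist x y" "0 \<le> L"
    using assms(1) unfolding bdd_Lipschitz_def by blast
  obtain B' L' where g: "\<And>x. norm (g x) \<le> B'" "\<And>x y. norm (g x - g y) \<le> L' * dist x y" "0 \<le> L'"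
    using assms(2) unfolding bdd_Lipschitz_def by blast
  show ?thesis
  proof (rule bdd_LipschitzI[of _ "B + B'" "L + L'"])
    show "norm (f x + g x) \<le> B + B'" for x using f(1) g(1) by (rule norm_triangle_mono)
    show "norm (f x + g x - (f y + g y)) \<le> (L + L') * dist x y" for x y
      using norm_triangle_mono[OF f(2)[of x y] g(2)[of x y]] by (simp add: algebra_simps)
  qed (use f g in auto)
qed

text \<open>Here the bounds are needed: in the product rule each Lipschitz constant is multiplied by
  the supremum of the other factor.\<close>

lemma bdd_Lipschitz_scaleR:
  assumes "bdd_Lipschitz f" "bdd_Lipschitz g" shows "bdd_Lipschitz (\<lambda>x. f x *\<^sub>R g x)"
proof -
  obtain B L where f: "0 \<le> B" "\<And>x. norm (f x) \<le> B" "\<And>x y. norm (f x - f y) \<le> L * dist x y" "0 \<le> L"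
    using assms(1) unfolding bdd_Lipschitz_def by blast
  obtain B' L' where g: "0 \<le> B'" "\<And>x. norm (g x) \<le> B'" "\<And>x y. norm (g x - g y) \<le> L' * dist x y" "0 \<le> L'"
    using assms(2) unfolding bdd_Lipschitz_def by blast
  show ?thesis
  proof (rule bdd_LipschitzI[of _ "B * B'" "B * L' + L * B'"])
    show "norm (f x *\<^sub>R g x) \<le> B * B'" for x
      using f(1,2) g(1,2) by (simp add: mult_mono)
    fix x y
    have "f x *\<^sub>R g x - f y *\<^sub>R g y = f x *\<^sub>R (g x - g y) + (f x - f y) *\<^sub>R g y"
      by (simp add: algebra_simps)
    also have "norm \<dots> \<le> norm (f x) * norm (g x - g y) + norm (f x - f y) * norm (g y)"
      by (metis norm_scaleR norm_triangle_ineq real_norm_def)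
    also have "\<dots> \<le> B * (L' * dist x y) + (L * dist x y) * B'"
      using f g by (intro add_mono mult_mono) auto
    finally show "norm (f x *\<^sub>R g x - f y *\<^sub>R g y) \<le> (B * L' + L * B') * dist x y"
      by (simp add: algebra_simps)
  qed (use f g in auto)
qed

lemma bdd_Lipschitz_minus: "bdd_Lipschitz f \<Longrightarrow> bdd_Lipschitz (\<lambda>x. - f x)"
  using bdd_Lipschitz_scaleR[OF bdd_Lipschitz_const[of "-1"]] by fastforce

lemma bdd_Lipschitz_diff: "bdd_Lipschitz f \<Longrightarrow> bdd_Lipschitz g \<Longrightarrow> bdd_Lipschitz (\<lambda>x. f x - g x)"
  using bdd_Lipschitz_add[OF _ bdd_Lipschitz_minus] by fastforce

lemma bdd_Lipschitz_sum: "(\<And>i. i \<in> I \<Longrightarrow> bdd_Lipschitz (f i)) \<Longrightarrow> bdd_Lipschitz (\<lambda>x. \<Sum>i\<in>I. f i x)"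
  by (induction I rule: infinite_finite_induct) (auto intro: bdd_Lipschitz_const bdd_Lipschitz_add)

lemma bdd_Lipschitz_min:
  assumes "\<And>x. 0 \<le> f x" "\<And>x y. \<bar>f x - f y\<bar> \<le> L * dist x y" "0 \<le> L" "0 \<le> c"
  shows "bdd_Lipschitz (\<lambda>x. min (f x) c)"
proof (rule bdd_LipschitzI[of _ c L])
  show "norm (min (f x) c) \<le> c" for x using assms(1)[of x] assms(4) by auto
  fix x y
  have "\<bar>min (f x) c - min (f y) c\<bar> \<le> \<bar>f x - f y\<bar>" by linarith
  then show "norm (min (f x) c - min (f y) c) \<le> L * dist x y" using assms(2)[of x y] by simp
qed (rule assms)

instance bcontfun :: (metric_space, banach) banach ..

text \<open>The number of points is a variable, so no Euclidean type of fixed dimension fits. On a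
  discrete space every bounded family is a bounded continuous function, and configurations become
  elements of a Banach space with the sup norm.\<close>

definition coord :: "(nat discrete \<Rightarrow>\<^sub>C 'b::real_normed_vector) \<Rightarrow> nat \<Rightarrow> 'b" where
  "coord Z i = apply_bcontfun Z (discrete i)"

definition of_coords :: "(nat \<Rightarrow> 'b::real_normed_vector) \<Rightarrow> (nat discrete \<Rightarrow>\<^sub>C 'b)" where
  "of_coords f = Bcontfun (\<lambda>i. f (of_discrete i))"

lemma coord_of_coords:
  fixes f :: "nat \<Rightarrow> 'b::real_normed_vector"
  assumes "\<And>i. n < i \<Longrightarrow> f i = 0" shows "coord (of_coords f) = f"
proof -
  have "(\<lambda>i. f (of_discrete i)) \<in> bcontfun"
  proof (rule bcontfun_normI)
    show "continuous_on UNIV (\<lambda>i. f (of_discrete i))"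
      by (simp add: continuous_on_open_vimage open_discrete)
    fix i
    have "norm (f j) \<le> (\<Sum>i\<le>n. norm (f i))" for j
      using assms[of j] by (cases "n < j") (auto intro: member_le_sum sum_nonneg)
    then show "norm (f (of_discrete i)) \<le> (\<Sum>i\<le>n. norm (f i))" .
  qed
  then show ?thesis
    by (simp add: fun_eq_iff coord_def of_coords_def Bcontfun_inverse discrete_inverse)
qed

lemma norm_coord_diff_le: "norm (coord Z i - coord W i) \<le> dist Z W"
  using dist_bounded[of Z "discrete i" W] by (simp add: coord_def dist_norm)

lemma bounded_linear_coord: "bounded_linear (\<lambda>Z. coord Z i)"
  by (rule bounded_linear_intro[of _ 1]) (auto simp: coord_def norm_bounded)

lemma of_coords_Lipschitz:
  fixes f :: "'a::metric_space \<Rightarrow> nat \<Rightarrow> 'b::real_normed_vector"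
  assumes supp: "\<And>x i. n < i \<Longrightarrow> f x i = 0"
    and lip: "\<And>i. \<exists>L\<ge>0. \<forall>x y. norm (f x i - f y i) \<le> L * dist x y"
  obtains L where "L-lipschitz_on UNIV (\<lambda>x. of_coords (f x))"
proof -
  obtain C where C: "\<And>i. 0 \<le> C i" "\<And>i x y. norm (f x i - f y i) \<le> C i * dist x y"
    using lip by metis
  have "(\<Sum>i\<le>n. C i)-lipschitz_on UNIV (\<lambda>x. of_coords (f x))"
  proof (rule lipschitz_onI)
    fix x y
    show "dist (of_coords (f x)) (of_coords (f y)) \<le> (\<Sum>i\<le>n. C i) * dist x y"
    proof (rule dist_bound)
      fix j :: "nat discrete"
      define i where "i = of_discrete j"
      have j: "j = discrete i" by (simp add: i_def of_discrete_inverse)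
      have "norm (f x i - f y i) \<le> (\<Sum>i\<le>n. C i) * dist x y"
      proof (cases "n < i")
        case True
        then show ?thesis using supp C by (simp add: sum_nonneg)
      next
        case False
        then have "C i \<le> (\<Sum>i\<le>n. C i)" using C by (intro member_le_sum) auto
        then have "C i * dist x y \<le> (\<Sum>i\<le>n. C i) * dist x y" by (intro mult_right_mono) auto
        then show ?thesis using C(2)[of x i y] by linarith
      qed
      moreover have "apply_bcontfun (of_coords (f x)) j = f x i" for x
        using coord_of_coords[of n "f x", OF supp] unfolding coord_def j by (metis (no_types))
      ultimately show "dist (apply_bcontfun (of_coords (f x)) j) (apply_bcontfun (of_coords (f y)) j) \<le> (\<Sum>i\<le>n. C i) * dist x y"
        by (simp add: dist_norm)
    qed
  qed (use C in \<open>auto intro: sum_nonneg\<close>)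
  then show thesis by (rule that)
qed

section \<open>Regularised dynamics of a dipole\<close>

lemma bdd_Lipschitz_snd: "bdd_Lipschitz f \<Longrightarrow> bdd_Lipschitz (\<lambda>x. f (snd x))"
proof -
  assume "bdd_Lipschitz f"
  then obtain B L where f: "\<And>x. norm (f x) \<le> B" "\<And>x y. norm (f x - f y) \<le> L * dist x y" "0 \<le> L"
    unfolding bdd_Lipschitz_def by blast
  show ?thesis
  proof (rule bdd_LipschitzI[of _ B L])
    fix x y :: "'c \<times> 'a"
    have "norm (f (snd x) - f (snd y)) \<le> L * dist (snd x) (snd y)" by (rule f)
    also have "\<dots> \<le> L * dist x y" using f(3) by (intro mult_left_mono dist_snd_le)
    finally show "norm (f (snd x) - f (snd y)) \<le> L * dist x y" .
  qed (use f in auto)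
qed

text \<open>Meant for \<open>field\<close>: its linear attraction term is Lipschitz but unbounded,
  so it cannot be \<open>bdd_Lipschitz\<close> and is added separately.\<close>

lemma Lipschitz_add_bdd_Lipschitz:
  assumes "\<And>x y. norm (g x - g y) \<le> M * dist x y" "0 \<le> M" "bdd_Lipschitz f"
  shows "\<exists>L\<ge>0. \<forall>x y. norm ((g x + f x) - (g y + f y)) \<le> L * dist x y"
proof -
  obtain B L where f: "\<And>x y. norm (f x - f y) \<le> L * dist x y" "0 \<le> L"
    using assms(3) unfolding bdd_Lipschitz_def by blast
  have "norm ((g x + f x) - (g y + f y)) \<le> (M + L) * dist x y" for x y
    using norm_triangle_mono[OF assms(1)[of x y] f(1)[of x y]] by (simp add: algebra_simps)
  then show ?thesis using assms(2) f(2) by (intro exI[of _ "M + L"]) auto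
qed

lemma lipschitz_on_of_bdd_Lipschitz:
  assumes "bdd_Lipschitz f" obtains L where "L-lipschitz_on UNIV f"
proof -
  obtain L where "\<And>x y. norm (f x - f y) \<le> L * dist x y" "0 \<le> L"
    using assms unfolding bdd_Lipschitz_def by blast
  then have "L-lipschitz_on UNIV f" by (intro lipschitz_onI) (auto simp: dist_norm)
  then show thesis by (rule that)
qed

text \<open>The number 400 is a convenient margin: it yields
  \<open>p * \<zeta> \<le> 1 / 400\<close> and, since \<open>2 \<le> n\<close>, also
  \<open>\<zeta> \<le> \<eta> / 800\<close>, which makes every error term small against the
  attraction of the pair.\<close>

locale dipole = dirichlet_kernel \<Omega> k for \<Omega> k +
  fixes b :: "nat \<Rightarrow> real" and n :: nat and \<eta> \<zeta> :: real and z0 :: "nat \<Rightarrow> real^2"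
  assumes n2: "2 \<le> n" and burgers: "burgers_moduli n b" and \<zeta>: "0 < \<zeta>"
    and small: "400 * real n * \<zeta> \<le> \<eta>"
    and config: "z0 \<in> config_set \<Omega> n \<zeta> \<eta>" and distinct: "z0 1 \<noteq> z0 2"
begin

text \<open>The distance kept when every point stays within \<open>R\<close> of its centre: two
  radii cost \<open>2 / 100 * \<eta>\<close>. It must be close to \<open>\<eta>\<close>, so that
  \<open>7 / 4\<close> divided by the square of \<open>97 / 100\<close> is still below 2.\<close>

definition "\<delta> = 97 / 100 * \<eta>"

definition "R = \<eta> / 100"

text \<open>Both points of the pair are clamped to the same ball, so that clamping does not increase their
  distance.\<close>

definition center :: "nat \<Rightarrow> real^2" where
  "center i = (if i = 1 \<or> i = 2 then z0 1 else z0 i)"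

definition clamp :: "(nat \<Rightarrow> real^2) \<Rightarrow> nat \<Rightarrow> real^2" where
  "clamp z i = closest_point (cball (center i) R) (z i)"

text \<open>The velocity without the mutual attraction of the first two points.\<close>

definition regvel :: "(nat \<Rightarrow> real^2) \<Rightarrow> nat \<Rightarrow> real^2" where
  "regvel y i =
    (if i = 1 then K (y 1) (y 2) - K (y 1) (y 1) - (\<Sum>j\<in>{3..n}. b j *\<^sub>R G (y 1) (y j))
     else if i = 2 then K (y 2) (y 1) - K (y 2) (y 2) + (\<Sum>j\<in>{3..n}. b j *\<^sub>R G (y 2) (y j))
     else velocity b n y i)"

text \<open>The squared pair distance, truncated at \<open>\<zeta>\<close> to be bounded and
  Lipschitz; along the trajectory the truncation turns out to be inactive
  (\<open>speed_eq\<close>).\<close>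

definition speed :: "(nat \<Rightarrow> real^2) \<Rightarrow> real" where
  "speed z = (min (norm (z 1 - z 2)) \<zeta>)\<^sup>2"

text \<open>The velocity multiplied by the squared distance of the pair: the singular term
  \<open>vinv (z 1 - z 2)\<close> becomes the linear \<open>z 1 - z 2\<close>, which is left
  unclamped so that the decay of the distance is exact.\<close>

definition field :: "(nat \<Rightarrow> real^2) \<Rightarrow> nat \<Rightarrow> real^2" where
  "field z i =
    (if i = 1 then - (1 / (2 * pi)) *\<^sub>R (z 1 - z 2)
     else if i = 2 then (1 / (2 * pi)) *\<^sub>R (z 1 - z 2) else 0)
    + (if i \<in> {1..n} then speed z *\<^sub>R regvel (clamp z) i else 0)"

section \<open>Geometry of the initial configuration\<close>

lemma \<eta>_pos: "0 < \<eta>"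
proof -
  have "0 < 400 * real n * \<zeta>" using \<zeta> n2 by simp
  then show ?thesis using small by linarith
qed

lemma \<delta>_pos: "0 < \<delta>" using \<eta>_pos by (simp add: \<delta>_def)

lemma R_pos: "0 < R" using \<eta>_pos by (simp add: R_def)

lemma \<zeta>_le: "800 * \<zeta> \<le> \<eta>"
proof -
  have "2 * \<zeta> \<le> real n * \<zeta>" using n2 \<zeta> by (intro mult_right_mono) auto
  then show ?thesis using small by simp
qed

lemma moduli: "i \<in> {1..n} \<Longrightarrow> \<bar>b i\<bar> = 1" "b 1 = 1" "b 2 = - 1"
  using burgers by (auto simp: burgers_moduli_def dest!: bspec[of _ _ i])

lemma one_two: "1 \<in> {1..n}" "2 \<in> {1..n}" using n2 by auto

lemma z0_dom: "i \<in> {1..n} \<Longrightarrow> z0 i \<in> \<Omega>"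
  using config by (auto simp: config_set_def)

lemma z0_close: "norm (z0 1 - z0 2) < \<zeta>"
  using config by (simp add: config_set_def)

lemma z0_pair_far:
  assumes "i \<in> {1, 2}" "q \<in> z0 ` {3..n} \<union> frontier \<Omega>" shows "\<eta> \<le> dist (z0 i) q"
proof -
  have "z0 i \<in> {z0 1, z0 2}" using assms by auto
  then have "setdist {z0 1, z0 2} (z0 ` {3..n} \<union> frontier \<Omega>) \<le> dist (z0 i) q"
    using assms(2) by (rule setdist_le_dist)
  then show ?thesis using config by (simp add: config_set_def)
qed

lemma z0_separation:
  assumes "i \<in> {3..n}"
  shows "\<xi> \<in> frontier \<Omega> \<Longrightarrow> \<eta> \<le> dist (z0 i) \<xi>"
    and "j \<in> {3..n} \<Longrightarrow> i \<noteq> j \<Longrightarrow> \<eta> \<le> norm (z0 i - z0 j)"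
proof -
  let ?A = "{infdist (z0 i) (frontier \<Omega>) | i. i \<in> {3..n}} \<union>
    {norm (z0 i - z0 j) | i j. i \<in> {3..n} \<and> j \<in> {3..n} \<and> i \<noteq> j}"
  have "{norm (z0 i - z0 j) | i j. i \<in> {3..n} \<and> j \<in> {3..n} \<and> i \<noteq> j}
      \<subseteq> (\<lambda>(i, j). norm (z0 i - z0 j)) ` ({3..n} \<times> {3..n})" by auto
  then have "finite {norm (z0 i - z0 j) | i j. i \<in> {3..n} \<and> j \<in> {3..n} \<and> i \<noteq> j}"
    by (rule finite_subset) auto
  moreover have "finite {infdist (z0 i) (frontier \<Omega>) | i. i \<in> {3..n}}" by simp
  ultimately have fin: "finite ?A" by simp
  have "\<eta> < Min ?A" using config assms by (auto simp: config_set_def separation_def)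
  then have lt: "\<eta> \<le> a" if "a \<in> ?A" for a using Min_le[OF fin that] by linarith
  show "\<eta> \<le> dist (z0 i) \<xi>" if "\<xi> \<in> frontier \<Omega>"
  proof -
    have "\<eta> \<le> infdist (z0 i) (frontier \<Omega>)" by (rule lt) (use assms in blast)
    then show ?thesis using infdist_le[OF that, of "z0 i"] by linarith
  qed
  show "\<eta> \<le> norm (z0 i - z0 j)" if "j \<in> {3..n}" "i \<noteq> j"
    by (rule lt) (use assms that in blast)
qed

lemma center_far:
  assumes "i \<in> {1..n}" shows "far (center i) \<eta>"
proof (cases "i = 1 \<or> i = 2")
  case True
  then show ?thesis using z0_dom[of 1] one_two \<eta>_pos z0_pair_far[of 1]
    by (auto simp: far_def center_def)
next
  case False
  then have "i \<in> {3..n}" using assms by auto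
  then show ?thesis using z0_dom[OF assms] z0_separation(1) \<eta>_pos False
    by (auto simp: far_def center_def)
qed

lemma center_separation:
  assumes "i \<in> {1..n}" "j \<in> {1..n}" "i \<noteq> j" "3 \<le> i \<or> 3 \<le> j"
  shows "\<eta> \<le> norm (center i - center j)"
proof -
  have main: "\<eta> \<le> norm (center i - center j)" if "3 \<le> j" "i \<in> {1..n}" "j \<in> {1..n}" "i \<noteq> j" for i j
  proof (cases "3 \<le> i")
    case True
    then show ?thesis using z0_separation(2)[of i j] that by (auto simp: center_def)
  next
    case False
    then have "i = 1 \<or> i = 2" using that by auto
    moreover have "\<eta> \<le> dist (z0 1) (z0 j)" using that by (intro z0_pair_far) auto
    ultimately show ?thesis using that by (auto simp: center_def dist_norm)
  qed
  show ?thesis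
    using main[of j i] main[of i j] assms by (auto simp: norm_minus_commute)
qed

lemma ball_far: "i \<in> {1..n} \<Longrightarrow> x \<in> cball (center i) R \<Longrightarrow> far x \<delta>"
  using \<eta>_pos by (intro far_perturb[OF center_far]) (auto simp: \<delta>_def R_def)

lemma ball_midpoint: "x \<in> cball c r \<Longrightarrow> y \<in> cball c r \<Longrightarrow> midpoint x y \<in> cball c r"
  for x y c :: "real^2"
  using convexD[OF convex_cball, of x c r y "1/2" "1/2"]
  by (simp add: midpoint_def scaleR_add_right inverse_eq_divide)

lemma ball_separation:
  assumes "i \<in> {1..n}" "j \<in> {1..n}" "i \<noteq> j" "3 \<le> i \<or> 3 \<le> j"
    and "x \<in> cball (center i) R" "y \<in> cball (center j) R"
  shows "\<delta> \<le> norm (x - y)"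
proof -
  have "norm (center i - center j) \<le> norm (center i - x) + norm (x - y) + norm (y - center j)"
    using norm_triangle_ineq[of "center i - x" "x - center j"] norm_triangle_ineq[of "x - y" "y - center j"]
    by simp
  then show ?thesis using center_separation[OF assms(1-4)] assms(5,6) \<eta>_pos
    by (auto simp: dist_norm norm_minus_commute \<delta>_def R_def)
qed

lemma clamp_ball: "clamp z i \<in> cball (center i) R"
  unfolding clamp_def using R_pos by (intro closest_point_in_set) auto

lemma clamp_id: "z i \<in> cball (center i) R \<Longrightarrow> clamp z i = z i"
  by (simp add: clamp_def closest_point_self)

lemma clamp_Lipschitz: "norm (clamp z i - clamp w i) \<le> norm (z i - w i)"
  using closest_point_lipschitz[of "cball (center i) R" "z i" "w i"] R_pos
  by (auto simp: clamp_def dist_norm)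

lemma clamp_pair: "norm (clamp z 1 - clamp z 2) \<le> norm (z 1 - z 2)"
  using closest_point_lipschitz[of "cball (center 1) R" "z 1" "z 2"] R_pos
  by (auto simp: clamp_def dist_norm center_def)

section \<open>Size and Lipschitz bounds of the regular velocity\<close>

lemma norm_K_ball:
  assumes "i \<in> {1..n}" "j \<in> {1..n}" "x \<in> cball (center i) R" "y \<in> cball (center j) R"
  shows "norm (K x y) \<le> 1 / (2 * pi * \<delta>)"
  using ball_far[OF assms(1,3)] ball_far[OF assms(2,4)] farD(1) by (intro norm_K_le)

lemma norm_G_ball:
  assumes "i \<in> {1..n}" "j \<in> {1..n}" "x \<in> cball (center i) R" "y \<in> cball (center j) R"
    "i \<noteq> j" "3 \<le> i \<or> 3 \<le> j"
  shows "norm (G x y) \<le> 1 / (pi * \<delta>)"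
proof -
  have s: "\<delta> \<le> norm (x - y)" using assms by (intro ball_separation) auto
  have "norm (G x y) \<le> norm (K x y) + 1 / (2 * pi) * (1 / norm (x - y))"
    using norm_triangle_ineq4[of "K x y" "(1 / (2 * pi)) *\<^sub>R vinv (x - y)"]
    by (simp add: G_def norm_vinv)
  also have "norm (K x y) \<le> 1 / (2 * pi * \<delta>)" using assms by (intro norm_K_ball)
  also have "1 / (2 * pi) * (1 / norm (x - y)) \<le> 1 / (2 * pi) * (1 / \<delta>)"
    using s \<delta>_pos by (intro mult_left_mono divide_left_mono) (auto intro!: mult_pos_pos)
  finally show ?thesis by simp
qed

lemma velocity_pair:
  shows "velocity b n y 1 = regvel y 1 - (1 / (2 * pi)) *\<^sub>R vinv (y 1 - y 2)"
    and "velocity b n y 2 = regvel y 2 + (1 / (2 * pi)) *\<^sub>R vinv (y 1 - y 2)"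
proof -
  have 1: "{1..n} - {1} = insert 2 {3..n}" "{1..n} - {2} = insert 1 {3..n}" using n2 by auto
  have v: "vinv (y 2 - y 1) = - vinv (y 1 - y 2)"
    by (simp add: vinv_def norm_minus_commute algebra_simps)
  show "velocity b n y 1 = regvel y 1 - (1 / (2 * pi)) *\<^sub>R vinv (y 1 - y 2)"
    unfolding velocity_def 1 using moduli by (simp add: regvel_def G_def)
  show "velocity b n y 2 = regvel y 2 + (1 / (2 * pi)) *\<^sub>R vinv (y 1 - y 2)"
    unfolding velocity_def 1 using moduli by (simp add: regvel_def G_def v sum_negf del: One_nat_def)
qed

lemma norm_sum_G_le:
  assumes "I \<subseteq> {1..n}" "i \<in> {1..n}" "i \<notin> I" "\<And>j. j \<in> I \<Longrightarrow> 3 \<le> i \<or> 3 \<le> j"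
    and "\<And>i. i \<in> {1..n} \<Longrightarrow> y i \<in> cball (center i) R" and "\<And>j. j \<in> I \<Longrightarrow> \<bar>c j\<bar> = 1"
  shows "norm (\<Sum>j\<in>I. c j *\<^sub>R G (y i) (y j)) \<le> real (card I) / (pi * \<delta>)"
proof -
  have "norm (\<Sum>j\<in>I. c j *\<^sub>R G (y i) (y j)) \<le> (\<Sum>j\<in>I. 1 / (pi * \<delta>))"
  proof (rule sum_norm_le)
    fix j assume j: "j \<in> I"
    then have "norm (G (y i) (y j)) \<le> 1 / (pi * \<delta>)"
      using assms by (intro norm_G_ball[of i j]) auto
    then show "norm (c j *\<^sub>R G (y i) (y j)) \<le> 1 / (pi * \<delta>)" using assms(6)[OF j] by simp
  qed
  then show ?thesis by simp
qed

text \<open>In units of \<open>1 / (pi * \<delta>)\<close> a term \<open>G\<close> counts 1 and a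
  term \<open>K\<close> counts 1/2. A member of the pair sees \<open>n - 2\<close> of the former and
  two of the latter, any other point \<open>n - 1\<close> and one.\<close>

lemma norm_regvel_le:
  assumes y: "\<And>i. i \<in> {1..n} \<Longrightarrow> y i \<in> cball (center i) R" and i: "i \<in> {1..n}"
  shows "norm (regvel y i) \<le> real n / (pi * \<delta>)"
proof -
  have K: "norm (K (y i) (y j)) \<le> 1 / 2 / (pi * \<delta>)" if "i \<in> {1..n}" "j \<in> {1..n}" for i j
    using norm_K_ball[OF that y[OF that(1)] y[OF that(2)]] by (simp add: mult_ac)
  have p: "0 < pi * \<delta>" using \<delta>_pos by simp
  consider "i = 1" | "i = 2" | "3 \<le> i" using i by fastforce
  then show ?thesis
  proof cases
    case 1
    have "norm (regvel y 1) \<le> norm (K (y 1) (y 2)) + norm (K (y 1) (y 1)) + norm (\<Sum>j\<in>{3..n}. b j *\<^sub>R G (y 1) (y j))"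
      unfolding regvel_def by (simp add: norm_triangle_le_diff norm_triangle_ineq4)
    also have "\<dots> \<le> 1 / 2 / (pi * \<delta>) + 1 / 2 / (pi * \<delta>) + real (card {3..n}) / (pi * \<delta>)"
      using one_two y moduli by (intro add_mono K norm_sum_G_le) auto
    also have "\<dots> = (1 / 2 + 1 / 2 + real (card {3..n})) / (pi * \<delta>)" by (simp only: add_divide_distrib)
    also have "\<dots> \<le> real n / (pi * \<delta>)" using p n2 by (intro divide_right_mono) (auto simp: of_nat_diff)
    finally show ?thesis using 1 by simp
  next
    case 2
    have "norm (regvel y 2) \<le> norm (K (y 2) (y 1) - K (y 2) (y 2)) + norm (\<Sum>j\<in>{3..n}. b j *\<^sub>R G (y 2) (y j))"
      unfolding regvel_def by (simp add: norm_triangle_ineq)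
    also have "norm (K (y 2) (y 1) - K (y 2) (y 2)) \<le> norm (K (y 2) (y 1)) + norm (K (y 2) (y 2))"
      by (rule norm_triangle_ineq4)
    also have "norm (K (y 2) (y 1)) + norm (K (y 2) (y 2)) + norm (\<Sum>j\<in>{3..n}. b j *\<^sub>R G (y 2) (y j))
      \<le> 1 / 2 / (pi * \<delta>) + 1 / 2 / (pi * \<delta>) + real (card {3..n}) / (pi * \<delta>)"
      using one_two y moduli by (intro add_mono K norm_sum_G_le) auto
    also have "\<dots> = (1 / 2 + 1 / 2 + real (card {3..n})) / (pi * \<delta>)" by (simp only: add_divide_distrib)
    also have "\<dots> \<le> real n / (pi * \<delta>)" using p n2 by (intro divide_right_mono) (auto simp: of_nat_diff)
    finally show ?thesis using 2 by simp
  next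
    case 3
    have "norm (regvel y i) \<le> norm (\<Sum>j\<in>{1..n} - {i}. (b i * b j) *\<^sub>R G (y i) (y j)) + norm (K (y i) (y i))"
      using 3 norm_triangle_ineq4[of "- (\<Sum>j\<in>{1..n} - {i}. (b i * b j) *\<^sub>R G (y i) (y j))" "K (y i) (y i)"]
      by (simp add: regvel_def velocity_def)
    also have "\<dots> \<le> real (card ({1..n} - {i})) / (pi * \<delta>) + 1 / 2 / (pi * \<delta>)"
      using i y 3 moduli by (intro add_mono K norm_sum_G_le) (auto simp: abs_mult)
    also have "\<dots> = (real (card ({1..n} - {i})) + 1 / 2) / (pi * \<delta>)" by (simp only: add_divide_distrib)
    also have "\<dots> \<le> real n / (pi * \<delta>)" using p i n2 by (intro divide_right_mono) (auto simp: of_nat_diff)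
    finally show ?thesis .
  qed
qed

text \<open>Opposite moduli pair each self-interaction with a cross term, leaving two increments of
  \<open>K\<close> in its second variable; they are proportional to the distance and use the sharp
  constant 7/4. The forces of the other points act on the two members with opposite signs, do not
  cancel, and contribute \<open>n - 2\<close> twice.\<close>

lemma norm_regvel_diff_le:
  assumes y: "\<And>i. i \<in> {1..n} \<Longrightarrow> y i \<in> cball (center i) R"
  shows "norm (regvel y 1 - regvel y 2) \<le> (2 * (real n - 2) / \<delta> + 7 / 4 / \<delta>\<^sup>2 * norm (y 1 - y 2)) / pi"
proof -
  have yb: "y 1 \<in> cball (center 1) R" "y 2 \<in> cball (center 1) R" using y[of 1] y[of 2] one_two by (auto simp: center_def)
  have f: "far (y 1) \<delta>" "far (y 2) \<delta>" "far (midpoint (y 1) (y 2)) \<delta>" "far (midpoint (y 2) (y 1)) \<delta>"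
    using yb one_two by (auto intro!: ball_far[of 1] ball_midpoint)
  have "norm (K (y 1) (y 2) - K (y 1) (y 1)) \<le> 7 / 4 * (1 / (2 * pi * \<delta>)) / \<delta> * norm (y 2 - y 1)"
    using f farD by (intro K_second_Lipschitz) auto
  moreover have "norm (K (y 2) (y 2) - K (y 2) (y 1)) \<le> 7 / 4 * (1 / (2 * pi * \<delta>)) / \<delta> * norm (y 2 - y 1)"
    using f farD by (intro K_second_Lipschitz) auto
  moreover have "7 / 4 * (1 / (2 * pi * \<delta>)) / \<delta> * norm (y 2 - y 1) = (7 / 4 / \<delta>\<^sup>2 * norm (y 1 - y 2)) / pi / 2"
    by (simp add: power2_eq_square norm_minus_commute)
  moreover have "norm (\<Sum>j\<in>{3..n}. b j *\<^sub>R G (y 1) (y j)) \<le> real (card {3..n}) / (pi * \<delta>)"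
    "norm (\<Sum>j\<in>{3..n}. b j *\<^sub>R G (y 2) (y j)) \<le> real (card {3..n}) / (pi * \<delta>)"
    by (rule norm_sum_G_le; use one_two y moduli in auto)+
  moreover have "real (card {3..n}) / (pi * \<delta>) = (2 * (real n - 2) / \<delta>) / pi / 2"
    using n2 \<delta>_pos by (simp add: of_nat_diff field_simps)
  moreover have "regvel y 1 - regvel y 2 = (K (y 1) (y 2) - K (y 1) (y 1)) + (K (y 2) (y 2) - K (y 2) (y 1))
      - ((\<Sum>j\<in>{3..n}. b j *\<^sub>R G (y 1) (y j)) + (\<Sum>j\<in>{3..n}. b j *\<^sub>R G (y 2) (y j)))"
    by (simp add: regvel_def)
  then have "norm (regvel y 1 - regvel y 2) \<le> (norm (K (y 1) (y 2) - K (y 1) (y 1)) + norm (K (y 2) (y 2) - K (y 2) (y 1)))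
      + (norm (\<Sum>j\<in>{3..n}. b j *\<^sub>R G (y 1) (y j)) + norm (\<Sum>j\<in>{3..n}. b j *\<^sub>R G (y 2) (y j)))"
    by (simp only:) (meson norm_triangle_ineq norm_triangle_ineq4 add_mono order_trans)
  ultimately show ?thesis unfolding add_divide_distrib by linarith
qed

lemma bdd_Lipschitz_K_clamp:
  assumes "i \<in> {1..n}" "j \<in> {1..n}"
  shows "bdd_Lipschitz (\<lambda>Z :: nat discrete \<Rightarrow>\<^sub>C (real^2). K (clamp (coord Z) i) (clamp (coord Z) j))"
proof (rule bdd_LipschitzI)
  let ?c = "\<lambda>Z :: nat discrete \<Rightarrow>\<^sub>C (real^2). clamp (coord Z)"
  show "norm (K (?c Z i) (?c Z j)) \<le> 1 / (2 * pi * \<delta>)" for Z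
    by (rule norm_K_ball[OF assms clamp_ball clamp_ball])
  fix Z W
  have c: "norm (?c Z i - ?c W i) \<le> dist Z W" for i
    using clamp_Lipschitz[of "coord Z" i "coord W"] norm_coord_diff_le[of Z i W] by simp
  have "norm (K (?c Z i) (?c Z j) - K (?c W i) (?c W j)) \<le> (norm (?c Z i - ?c W i) + norm (?c Z j - ?c W j)) / \<delta>\<^sup>2"
    using farD(1)[OF ball_far[OF assms(2) clamp_ball]]
    by (intro K_Lipschitz ball_far[OF assms(1) clamp_ball] ball_far[OF assms(2) ball_midpoint[OF clamp_ball clamp_ball]]) auto
  also have "\<dots> \<le> (dist Z W + dist Z W) / \<delta>\<^sup>2" by (intro divide_right_mono add_mono c) auto
  finally show "norm (K (?c Z i) (?c Z j) - K (?c W i) (?c W j)) \<le> 2 / \<delta>\<^sup>2 * dist Z W" by simp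
qed (use \<delta>_pos in simp)

lemma bdd_Lipschitz_G_clamp:
  assumes "i \<in> {1..n}" "j \<in> {1..n}" "i \<noteq> j" "3 \<le> i \<or> 3 \<le> j"
  shows "bdd_Lipschitz (\<lambda>Z :: nat discrete \<Rightarrow>\<^sub>C (real^2). G (clamp (coord Z) i) (clamp (coord Z) j))"
proof (rule bdd_LipschitzI)
  let ?c = "\<lambda>Z :: nat discrete \<Rightarrow>\<^sub>C (real^2). clamp (coord Z)"
  show "norm (G (?c Z i) (?c Z j)) \<le> 1 / (pi * \<delta>)" for Z
    by (rule norm_G_ball[OF assms(1,2) clamp_ball clamp_ball assms(3,4)])
  fix Z W
  have c: "norm (?c Z i - ?c W i) \<le> dist Z W" for i
    using clamp_Lipschitz[of "coord Z" i "coord W"] norm_coord_diff_le[of Z i W] by simp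
  have "norm (G (?c Z i) (?c Z j) - G (?c W i) (?c W j)) \<le> 2 * (norm (?c Z i - ?c W i) + norm (?c Z j - ?c W j)) / \<delta>\<^sup>2"
    using farD(1)[OF ball_far[OF assms(2) clamp_ball]]
    by (intro G_Lipschitz ball_far[OF assms(1) clamp_ball] ball_far[OF assms(2) ball_midpoint[OF clamp_ball clamp_ball]]
        ball_separation[OF assms clamp_ball clamp_ball]) auto
  also have "\<dots> \<le> 2 * (dist Z W + dist Z W) / \<delta>\<^sup>2" by (intro divide_right_mono mult_left_mono add_mono c) auto
  finally show "norm (G (?c Z i) (?c Z j) - G (?c W i) (?c W j)) \<le> 4 / \<delta>\<^sup>2 * dist Z W" by simp
qed (use \<delta>_pos in simp)

lemma bdd_Lipschitz_regvel_clamp: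
  assumes i: "i \<in> {1..n}"
  shows "bdd_Lipschitz (\<lambda>Z :: nat discrete \<Rightarrow>\<^sub>C (real^2). regvel (clamp (coord Z)) i)"
proof -
  consider "i = 1" | "i = 2" | "3 \<le> i" using i by fastforce
  then show ?thesis
  proof cases
    case 1
    show ?thesis unfolding 1 regvel_def simp_thms if_True
      using one_two by (intro bdd_Lipschitz_diff bdd_Lipschitz_sum bdd_Lipschitz_scaleR bdd_Lipschitz_const bdd_Lipschitz_K_clamp bdd_Lipschitz_G_clamp) auto
  next
    case 2
    show ?thesis unfolding 2 regvel_def
      using one_two by (simp, intro bdd_Lipschitz_diff bdd_Lipschitz_add bdd_Lipschitz_sum bdd_Lipschitz_scaleR bdd_Lipschitz_const bdd_Lipschitz_K_clamp bdd_Lipschitz_G_clamp) auto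
  next
    case 3
    then show ?thesis unfolding regvel_def velocity_def
      using i by (simp, intro bdd_Lipschitz_diff bdd_Lipschitz_minus bdd_Lipschitz_sum bdd_Lipschitz_scaleR bdd_Lipschitz_const bdd_Lipschitz_K_clamp bdd_Lipschitz_G_clamp) auto
  qed
qed

lemma norm_pair_Lipschitz:
  fixes Z W :: "nat discrete \<Rightarrow>\<^sub>C (real^2)"
  shows "norm ((coord Z 1 - coord Z 2) - (coord W 1 - coord W 2)) \<le> 2 * dist Z W"
  using norm_triangle_ineq4[of "coord Z 1 - coord W 1" "coord Z 2 - coord W 2"]
    norm_coord_diff_le[of Z 1 W] norm_coord_diff_le[of Z 2 W]
  by (simp add: algebra_simps)

lemma bdd_Lipschitz_speed: "bdd_Lipschitz (\<lambda>Z :: nat discrete \<Rightarrow>\<^sub>C (real^2). speed (coord Z))"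
proof -
  have "bdd_Lipschitz (\<lambda>Z :: nat discrete \<Rightarrow>\<^sub>C (real^2). min (norm (coord Z 1 - coord Z 2)) \<zeta>)"
  proof (rule bdd_Lipschitz_min[where L=2])
    show "\<bar>norm (coord Z 1 - coord Z 2) - norm (coord W 1 - coord W 2)\<bar> \<le> 2 * dist Z W" for Z W :: "nat discrete \<Rightarrow>\<^sub>C (real^2)"
      using norm_triangle_ineq3[of "coord Z 1 - coord Z 2" "coord W 1 - coord W 2"] norm_pair_Lipschitz[of Z W] by linarith
  qed (use \<zeta> in auto)
  from bdd_Lipschitz_scaleR[OF this this] show ?thesis by (simp add: speed_def power2_eq_square)
qed

text \<open>Physical time is an unknown as well: \<open>\<theta>\<close> is an additional component
  of the autonomous system, driven by \<open>speed\<close>.\<close>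

lemma trajectory_exists:
  obtains \<theta> :: "real \<Rightarrow> real" and Z :: "real \<Rightarrow> nat \<Rightarrow> real^2" where
    "\<theta> 0 = 0" "\<And>i. i \<in> {1..n} \<Longrightarrow> Z 0 i = z0 i"
    "\<And>\<tau>. (\<theta> has_real_derivative speed (Z (max 0 \<tau>))) (at \<tau>)"
    "\<And>\<tau> i. i \<in> {1..n} \<Longrightarrow> ((\<lambda>\<tau>. Z \<tau> i) has_vector_derivative field (Z (max 0 \<tau>)) i) (at \<tau>)"
proof -
  let ?f = "\<lambda>x :: real \<times> (nat discrete \<Rightarrow>\<^sub>C (real^2)). field (coord (snd x))"
  have supp: "?f x i = 0" if "n < i" for x i
    using that n2 by (auto simp: field_def)
  have lip: "\<exists>L\<ge>0. \<forall>x y. norm (?f x i - ?f y i) \<le> L * dist x y" for i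
  proof -
    have 1: "bdd_Lipschitz (\<lambda>x :: real \<times> (nat discrete \<Rightarrow>\<^sub>C (real^2)). if i \<in> {1..n} then speed (coord (snd x)) *\<^sub>R regvel (clamp (coord (snd x))) i else 0)"
      by (cases "i \<in> {1..n}")
        (auto intro!: bdd_Lipschitz_const bdd_Lipschitz_scaleR bdd_Lipschitz_snd[OF bdd_Lipschitz_speed] bdd_Lipschitz_snd[OF bdd_Lipschitz_regvel_clamp])
    show ?thesis unfolding field_def
    proof (rule Lipschitz_add_bdd_Lipschitz[OF _ _ 1, where M=1])
      fix x y :: "real \<times> (nat discrete \<Rightarrow>\<^sub>C (real^2))"
      let ?p = "(coord (snd x) 1 - coord (snd x) 2) - (coord (snd y) 1 - coord (snd y) 2)"
      have "norm ?p \<le> 2 * dist x y"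
        using norm_pair_Lipschitz[of "snd x" "snd y"] dist_snd_le[of x y] by linarith
      then have "1 / (2 * pi) * norm ?p \<le> 1 / (2 * pi) * (2 * dist x y)"
        by (intro mult_left_mono) auto
      also have "\<dots> = (1 / pi) * dist x y" by simp
      also have "\<dots> \<le> 1 * dist x y" using pi_gt3 by (intro mult_right_mono) auto
      finally have *: "norm ((1 / (2 * pi)) *\<^sub>R ?p) \<le> dist x y" by simp
      have m: "- (1 / (2 * pi)) *\<^sub>R u - - (1 / (2 * pi)) *\<^sub>R v = - ((1 / (2 * pi)) *\<^sub>R (u - v))"
        "(1 / (2 * pi)) *\<^sub>R u - (1 / (2 * pi)) *\<^sub>R v = (1 / (2 * pi)) *\<^sub>R (u - v)" for u v :: "real^2"
        by (simp_all add: algebra_simps)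
      show "norm ((if i = 1 then - (1 / (2 * pi)) *\<^sub>R (coord (snd x) 1 - coord (snd x) 2)
          else if i = 2 then (1 / (2 * pi)) *\<^sub>R (coord (snd x) 1 - coord (snd x) 2) else 0)
        - (if i = 1 then - (1 / (2 * pi)) *\<^sub>R (coord (snd y) 1 - coord (snd y) 2)
          else if i = 2 then (1 / (2 * pi)) *\<^sub>R (coord (snd y) 1 - coord (snd y) 2) else 0)) \<le> 1 * dist x y"
        using * by (simp only: m norm_minus_cancel split: if_split) simp
    qed simp
  qed
  obtain L where L: "L-lipschitz_on UNIV (\<lambda>x. of_coords (?f x))"
    using of_coords_Lipschitz[of n ?f, OF supp lip] by blast
  obtain M where M: "M-lipschitz_on UNIV (\<lambda>x :: real \<times> (nat discrete \<Rightarrow>\<^sub>C (real^2)). speed (coord (snd x)))"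
    using lipschitz_on_of_bdd_Lipschitz[OF bdd_Lipschitz_snd[OF bdd_Lipschitz_speed]] by blast
  define Z0 where "Z0 = of_coords (\<lambda>i. if i \<in> {1..n} then z0 i else 0)"
  have Z0: "coord Z0 i = z0 i" if "i \<in> {1..n}" for i
    unfolding Z0_def using that by (subst coord_of_coords[of n]) auto
  obtain x where x: "x 0 = (0, Z0)"
    "\<And>\<tau>. (x has_vector_derivative (speed (coord (snd (x (max 0 \<tau>)))), of_coords (?f (x (max 0 \<tau>))))) (at \<tau>)"
    by (rule picard_lindeloef_extended[where F="\<lambda>x. (speed (coord (snd x)), of_coords (?f x))"
          and ?x0.0="(0, Z0)", OF lipschitz_on_Pair[OF M L]]) (rule that; assumption)
  show thesis
  proof (rule that[of "\<lambda>\<tau>. fst (x \<tau>)" "\<lambda>\<tau>. coord (snd (x \<tau>))"])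
    fix \<tau>
    show "((\<lambda>\<tau>. fst (x \<tau>)) has_real_derivative speed (coord (snd (x (max 0 \<tau>))))) (at \<tau>)"
      using bounded_linear.has_vector_derivative[OF bounded_linear_fst x(2)[of \<tau>]]
      by (simp add: has_real_derivative_iff_has_vector_derivative)
    fix i assume i: "i \<in> {1..n}"
    have "((\<lambda>\<tau>. coord (snd (x \<tau>)) i) has_vector_derivative
       coord (snd (speed (coord (snd (x (max 0 \<tau>)))), of_coords (?f (x (max 0 \<tau>))))) i) (at \<tau>)"
      by (rule bounded_linear.has_vector_derivative[OF bounded_linear_coord
            bounded_linear.has_vector_derivative[OF bounded_linear_snd x(2)[of \<tau>]]])
    then show "((\<lambda>\<tau>. coord (snd (x \<tau>)) i) has_vector_derivative field (coord (snd (x (max 0 \<tau>)))) i) (at \<tau>)"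
      by (simp add: coord_of_coords[of n, OF supp])
  qed (use x Z0 in auto)
qed

end

section \<open>Collision in finite time\<close>

locale dipole_trajectory = dipole +
  fixes \<theta> :: "real \<Rightarrow> real" and Z :: "real \<Rightarrow> nat \<Rightarrow> real^2"
  assumes \<theta>_0: "\<theta> 0 = 0" and Z_0: "\<And>i. i \<in> {1..n} \<Longrightarrow> Z 0 i = z0 i"
    and \<theta>_deriv: "\<And>\<tau>. (\<theta> has_real_derivative speed (Z (max 0 \<tau>))) (at \<tau>)"
    and Z_deriv: "\<And>\<tau> i. i \<in> {1..n} \<Longrightarrow> ((\<lambda>\<tau>. Z \<tau> i) has_vector_derivative field (Z (max 0 \<tau>)) i) (at \<tau>)"
begin

definition r :: "real \<Rightarrow> real" where "r \<tau> = norm (Z \<tau> 1 - Z \<tau> 2)"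

definition p where "p = (real n - 2) / \<eta>"
definition q where "q = 1 / \<eta>\<^sup>2"

lemma p_nonneg: "0 \<le> p" using n2 \<eta>_pos by (simp add: p_def)
lemma q_pos: "0 < q" using \<eta>_pos by (simp add: q_def)

lemma p_small: "0 \<le> m \<Longrightarrow> m \<le> \<zeta> \<Longrightarrow> p * m \<le> 1 / 400"
proof -
  assume m: "0 \<le> m" "m \<le> \<zeta>"
  have "(real n - 2) * m \<le> real n * \<zeta>" using m n2 by (intro mult_mono) auto
  then show ?thesis using small \<eta>_pos by (simp add: p_def divide_simps)
qed

lemma q_small: "0 \<le> m \<Longrightarrow> m \<le> \<zeta> \<Longrightarrow> q * m\<^sup>2 \<le> 1 / 640000"
proof -
  assume m: "0 \<le> m" "m \<le> \<zeta>"
  then have "800 * m \<le> \<eta>" using \<zeta>_le by simp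
  then have "(800 * m)\<^sup>2 \<le> \<eta>\<^sup>2" using m by (intro power_mono) auto
  then show ?thesis using \<eta>_pos by (simp add: q_def power_mult_distrib divide_simps)
qed

text \<open>Replacing \<open>\<eta>\<close> by \<open>\<delta>\<close> raises 2 to about 2.06 and
  7/4 to about 1.86. The Lyapunov argument allows anything below 3 and 2, respectively.\<close>

lemma coefficients: "2 * (real n - 2) / \<delta> \<le> 207 / 100 * p" "7 / 4 / \<delta>\<^sup>2 \<le> 187 / 100 * q"
proof -
  have "2 * (real n - 2) / \<delta> = 200 / 97 * p" by (simp add: \<delta>_def p_def)
  also have "\<dots> \<le> 207 / 100 * p" using p_nonneg by (intro mult_right_mono) auto
  finally show "2 * (real n - 2) / \<delta> \<le> 207 / 100 * p" .
  have "7 / 4 / \<delta>\<^sup>2 = 70000 / 37636 * q" by (simp add: \<delta>_def q_def power_mult_distrib power_divide)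
  also have "\<dots> \<le> 187 / 100 * q" using q_pos by (intro mult_right_mono) auto
  finally show "7 / 4 / \<delta>\<^sup>2 \<le> 187 / 100 * q" .
qed

lemma Z_deriv_pos: "0 \<le> \<tau> \<Longrightarrow> i \<in> {1..n} \<Longrightarrow> ((\<lambda>\<tau>. Z \<tau> i) has_vector_derivative field (Z \<tau>) i) (at \<tau>)"
  using Z_deriv[of i \<tau>] by (simp add: max_def)

section \<open>Decay of the pair distance\<close>

definition gap :: "real \<Rightarrow> real^2" where "gap \<tau> = regvel (clamp (Z \<tau>)) 1 - regvel (clamp (Z \<tau>)) 2"

definition s' :: "real \<Rightarrow> real" where
  "s' \<tau> = 2 * ((Z \<tau> 1 - Z \<tau> 2) \<bullet> (- (1 / pi) *\<^sub>R (Z \<tau> 1 - Z \<tau> 2) + speed (Z \<tau>) *\<^sub>R gap \<tau>))"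

text \<open>The square is differentiable even where \<open>r\<close> vanishes; positivity of
  \<open>r\<close> is only derived afterwards, from this equation.\<close>

lemma r2_deriv:
  assumes "0 \<le> \<tau>" shows "((\<lambda>\<tau>. (r \<tau>)\<^sup>2) has_real_derivative s' \<tau>) (at \<tau>)"
proof -
  have dv: "((\<lambda>\<tau>. Z \<tau> 1 - Z \<tau> 2) has_vector_derivative field (Z \<tau>) 1 - field (Z \<tau>) 2) (at \<tau>)"
    using assms one_two by (intro has_vector_derivative_diff Z_deriv_pos) auto
  have "field (Z \<tau>) 1 - field (Z \<tau>) 2 = - (1 / pi) *\<^sub>R (Z \<tau> 1 - Z \<tau> 2) + speed (Z \<tau>) *\<^sub>R gap \<tau>"
  proof -
    define D c where "D = Z \<tau> 1 - Z \<tau> 2" and "c = 1 / (2 * pi)"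
    have "field (Z \<tau>) 1 - field (Z \<tau>) 2
        = (- c *\<^sub>R D + speed (Z \<tau>) *\<^sub>R regvel (clamp (Z \<tau>)) 1) - (c *\<^sub>R D + speed (Z \<tau>) *\<^sub>R regvel (clamp (Z \<tau>)) 2)"
      using one_two unfolding field_def D_def c_def by (simp del: One_nat_def)
    also have "\<dots> = (- c - c) *\<^sub>R D + speed (Z \<tau>) *\<^sub>R gap \<tau>"
      unfolding gap_def by (simp only: scaleR_diff_left scaleR_diff_right) simp
    finally have "field (Z \<tau>) 1 - field (Z \<tau>) 2
        = (- (1 / (2 * pi)) - 1 / (2 * pi)) *\<^sub>R (Z \<tau> 1 - Z \<tau> 2) + speed (Z \<tau>) *\<^sub>R gap \<tau>"
      unfolding D_def c_def .
    also have "- (1 / (2 * pi)) - 1 / (2 * pi) = - (1 / pi)" by (simp add: field_simps)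
    finally show ?thesis .
  qed
  then show ?thesis
    unfolding r_def power2_norm_eq_inner has_real_derivative_iff_has_vector_derivative s'_def
    using bounded_bilinear.has_vector_derivative[OF bounded_bilinear_inner dv dv]
    by (simp add: inner_commute)
qed

text \<open>The bound is in terms of \<open>min (r \<tau>) \<zeta>\<close>, as
  \<open>r \<tau> < \<zeta>\<close> is not yet known: the truncated speed makes the relative error
  small for every value of \<open>r\<close>, and no continuity argument in time is called
  for.\<close>

lemma s'_bound:
  assumes m: "m = min (r \<tau>) \<zeta>"
  shows "\<bar>s' \<tau> + 2 / pi * (r \<tau>)\<^sup>2\<bar> \<le> 2 / pi * (r \<tau>)\<^sup>2 * (207 / 100 * p * m + 187 / 100 * q * m\<^sup>2)"
proof -
  let ?D = "Z \<tau> 1 - Z \<tau> 2"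
  have m0: "0 \<le> m" "m \<le> r \<tau>" using \<zeta> by (auto simp: m r_def)
  have sp: "speed (Z \<tau>) = m\<^sup>2" by (simp add: speed_def m r_def)
  have "norm (gap \<tau>) \<le> (2 * (real n - 2) / \<delta> + 7 / 4 / \<delta>\<^sup>2 * norm (clamp (Z \<tau>) 1 - clamp (Z \<tau>) 2)) / pi"
    unfolding gap_def using clamp_ball by (intro norm_regvel_diff_le)
  also have "\<dots> \<le> (207 / 100 * p + 187 / 100 * q * r \<tau>) / pi"
    using clamp_pair[of "Z \<tau>"] q_pos coefficients
    by (intro divide_right_mono add_mono mult_mono) (auto simp: r_def)
  finally have g: "norm (gap \<tau>) \<le> (207 / 100 * p + 187 / 100 * q * r \<tau>) / pi" .
  have "s' \<tau> + 2 / pi * (r \<tau>)\<^sup>2 = 2 * m\<^sup>2 * (?D \<bullet> gap \<tau>)"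
    by (simp add: s'_def sp r_def power2_norm_eq_inner inner_simps algebra_simps)
  then have "\<bar>s' \<tau> + 2 / pi * (r \<tau>)\<^sup>2\<bar> = 2 * m\<^sup>2 * \<bar>?D \<bullet> gap \<tau>\<bar>" by (simp add: abs_mult)
  also have "\<dots> \<le> 2 * m\<^sup>2 * (r \<tau> * ((207 / 100 * p + 187 / 100 * q * r \<tau>) / pi))"
  proof (intro mult_left_mono order_trans[OF Cauchy_Schwarz_ineq2])
    show "norm ?D * norm (gap \<tau>) \<le> r \<tau> * ((207 / 100 * p + 187 / 100 * q * r \<tau>) / pi)"
      using g by (intro mult_mono) (auto simp: r_def)
  qed simp
  also have "2 * m\<^sup>2 * (r \<tau> * ((207 / 100 * p + 187 / 100 * q * r \<tau>) / pi))
     = 2 / pi * (207 / 100 * p * m * (m * r \<tau>) + 187 / 100 * q * m\<^sup>2 * (r \<tau>)\<^sup>2)"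
    by (simp add: power2_eq_square field_simps)
  also have "\<dots> \<le> 2 / pi * (207 / 100 * p * m * (r \<tau> * r \<tau>) + 187 / 100 * q * m\<^sup>2 * (r \<tau>)\<^sup>2)"
    using m0 p_nonneg q_pos by (intro mult_left_mono add_mono mult_right_mono) auto
  also have "\<dots> = 2 / pi * (r \<tau>)\<^sup>2 * (207 / 100 * p * m + 187 / 100 * q * m\<^sup>2)"
    by (simp add: power2_eq_square field_simps)
  finally show ?thesis .
qed

lemma correction_small:
  assumes "0 \<le> m" "m \<le> \<zeta>"
  shows "0 \<le> 207 / 100 * p * m + 187 / 100 * q * m\<^sup>2" "207 / 100 * p * m + 187 / 100 * q * m\<^sup>2 \<le> 1 / 4"
proof -
  show "0 \<le> 207 / 100 * p * m + 187 / 100 * q * m\<^sup>2" using assms p_nonneg q_pos by simp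
  show "207 / 100 * p * m + 187 / 100 * q * m\<^sup>2 \<le> 1 / 4" using p_small[OF assms] q_small[OF assms] by linarith
qed

lemma s'_bounds: "s' \<tau> \<le> - (3 / (2 * pi)) * (r \<tau>)\<^sup>2" "- (5 / (2 * pi)) * (r \<tau>)\<^sup>2 \<le> s' \<tau>"
proof -
  let ?e = "207 / 100 * p * min (r \<tau>) \<zeta> + 187 / 100 * q * (min (r \<tau>) \<zeta>)\<^sup>2"
  have "0 \<le> ?e" "?e \<le> 1 / 4" using correction_small[of "min (r \<tau>) \<zeta>"] \<zeta> by (auto simp: r_def)
  then have "2 / pi * (r \<tau>)\<^sup>2 * ?e \<le> 2 / pi * (r \<tau>)\<^sup>2 * (1 / 4)" by (intro mult_left_mono) auto
  then have "\<bar>s' \<tau> + 2 / pi * (r \<tau>)\<^sup>2\<bar> \<le> 2 / pi * (r \<tau>)\<^sup>2 * (1 / 4)"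
    using s'_bound[OF refl, of \<tau>] by linarith
  moreover have "(3 / (2 * pi)) * (r \<tau>)\<^sup>2 = 3 / 4 * (2 / pi * (r \<tau>)\<^sup>2)"
    "(5 / (2 * pi)) * (r \<tau>)\<^sup>2 = 5 / 4 * (2 / pi * (r \<tau>)\<^sup>2)" by simp_all
  moreover have "s \<le> - A \<and> - B \<le> s"
    if "\<bar>s + X\<bar> \<le> X * (1 / 4)" "A = 3 / 4 * X" "B = 5 / 4 * X" for s X A B :: real
    using abs_le_D1[OF that(1)] abs_le_D2[OF that(1)] that(2,3) by (intro conjI; linarith)
  ultimately have "s' \<tau> \<le> - ((3 / (2 * pi)) * (r \<tau>)\<^sup>2) \<and> - ((5 / (2 * pi)) * (r \<tau>)\<^sup>2) \<le> s' \<tau>"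
    by blast
  then show "s' \<tau> \<le> - (3 / (2 * pi)) * (r \<tau>)\<^sup>2" "- (5 / (2 * pi)) * (r \<tau>)\<^sup>2 \<le> s' \<tau>"
    by simp_all
qed

text \<open>The decay is at most exponential, because \<open>exp (5 / (2 * pi) * \<tau>)\<close>
  times the square is nondecreasing. The collision thus lies at infinite
  \<open>\<tau>\<close>.\<close>

lemma r_pos: assumes "0 \<le> \<tau>" shows "0 < r \<tau>"
proof -
  let ?f = "\<lambda>\<tau>. exp (5 / (2 * pi) * \<tau>) * (r \<tau>)\<^sup>2"
  have "?f 0 \<le> ?f \<tau>"
  proof (rule DERIV_nonneg_imp_nondecreasing[OF assms])
    fix x assume x: "0 \<le> x" "x \<le> \<tau>"
    have "(?f has_real_derivative exp (5 / (2 * pi) * x) * s' x + exp (5 / (2 * pi) * x) * (5 / (2 * pi)) * (r x)\<^sup>2) (at x)"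
      by (rule DERIV_mult'[OF _ r2_deriv[OF x(1)]]) (auto intro!: derivative_eq_intros)
    then have "(?f has_real_derivative exp (5 / (2 * pi) * x) * (s' x + 5 / (2 * pi) * (r x)\<^sup>2)) (at x)"
      by (simp only: distrib_left mult.assoc)
    moreover have "0 \<le> exp (5 / (2 * pi) * x) * (s' x + 5 / (2 * pi) * (r x)\<^sup>2)"
      using s'_bounds(2)[of x] by (intro mult_nonneg_nonneg) auto
    ultimately show "\<exists>y. (?f has_real_derivative y) (at x) \<and> 0 \<le> y" by blast
  qed
  moreover have "0 < ?f 0" using distinct Z_0 one_two by (simp add: r_def)
  ultimately have "0 < exp (5 / (2 * pi) * \<tau>) * (r \<tau>)\<^sup>2" by linarith
  then have "r \<tau> \<noteq> 0" by (metis less_irrefl mult_zero_right zero_power2)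
  then show ?thesis by (simp add: r_def)
qed

lemma r_less_\<zeta>: assumes "0 \<le> \<tau>" shows "r \<tau> < \<zeta>"
proof -
  have "(r \<tau>)\<^sup>2 \<le> (r 0)\<^sup>2"
  proof (rule DERIV_nonpos_imp_nonincreasing[OF assms])
    fix x assume x: "0 \<le> x" "x \<le> \<tau>"
    have "s' x \<le> 0" using s'_bounds(1)[of x] by (rule order_trans) simp
    then show "\<exists>y. ((\<lambda>\<tau>. (r \<tau>)\<^sup>2) has_real_derivative y) (at x) \<and> y \<le> 0" using r2_deriv[OF x(1)] by blast
  qed
  then have "r \<tau> \<le> r 0" by (simp add: r_def)
  also have "r 0 < \<zeta>" using z0_close Z_0 one_two by (simp add: r_def)
  finally show ?thesis .
qed

lemma speed_eq: "0 \<le> \<tau> \<Longrightarrow> speed (Z \<tau>) = (r \<tau>)\<^sup>2"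
  using r_less_\<zeta>[of \<tau>] by (simp add: speed_def r_def min_def)

definition r' :: "real \<Rightarrow> real" where "r' \<tau> = s' \<tau> / (2 * r \<tau>)"

lemma r_deriv:
  assumes "0 \<le> \<tau>" shows "(r has_real_derivative r' \<tau>) (at \<tau>)"
proof -
  have "((\<lambda>\<tau>. sqrt ((r \<tau>)\<^sup>2)) has_real_derivative r' \<tau>) (at \<tau>)"
  proof -
    have "((\<lambda>\<tau>. sqrt ((r \<tau>)\<^sup>2)) has_real_derivative inverse (sqrt ((r \<tau>)\<^sup>2)) / 2 * s' \<tau>) (at \<tau>)"
      by (rule DERIV_chain2[OF DERIV_real_sqrt r2_deriv[OF assms]]) (use r_pos[OF assms] in simp)
    moreover have "inverse (sqrt ((r \<tau>)\<^sup>2)) / 2 * s' \<tau> = r' \<tau>"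
      using r_pos[OF assms] by (simp add: r'_def field_simps)
    ultimately show ?thesis by (simp only:)
  qed
  moreover have "(\<lambda>\<tau>. sqrt ((r \<tau>)\<^sup>2)) = r" by (simp add: fun_eq_iff r_def)
  ultimately show ?thesis by simp
qed

lemma r'_le:
  assumes "0 \<le> \<tau>"
  shows "r' \<tau> \<le> - (1 / pi) * r \<tau> * (1 - 207 / 100 * p * r \<tau> - 187 / 100 * q * (r \<tau>)\<^sup>2)"
    and "r' \<tau> \<le> - (3 / (4 * pi)) * r \<tau>"
proof -
  have pos: "0 < r \<tau>" by (rule r_pos[OF assms])
  let ?e = "207 / 100 * p * r \<tau> + 187 / 100 * q * (r \<tau>)\<^sup>2"
  have "\<bar>s' \<tau> + 2 / pi * (r \<tau>)\<^sup>2\<bar> \<le> 2 / pi * (r \<tau>)\<^sup>2 * ?e"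
    using s'_bound[of "r \<tau>" \<tau>] r_less_\<zeta>[OF assms] by simp
  then have "s' \<tau> \<le> 2 / pi * (r \<tau>)\<^sup>2 * ?e - 2 / pi * (r \<tau>)\<^sup>2" by linarith
  then have "r' \<tau> \<le> (2 / pi * (r \<tau>)\<^sup>2 * ?e - 2 / pi * (r \<tau>)\<^sup>2) / (2 * r \<tau>)"
    unfolding r'_def using pos by (intro divide_right_mono) auto
  also have "\<dots> = - (1 / pi) * r \<tau> * (1 - 207 / 100 * p * r \<tau> - 187 / 100 * q * (r \<tau>)\<^sup>2)"
    using pos by (simp add: divide_simps power2_eq_square) (simp add: algebra_simps)
  finally show "r' \<tau> \<le> - (1 / pi) * r \<tau> * (1 - 207 / 100 * p * r \<tau> - 187 / 100 * q * (r \<tau>)\<^sup>2)" .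
  have "r' \<tau> \<le> (- (3 / (2 * pi)) * (r \<tau>)\<^sup>2) / (2 * r \<tau>)"
    unfolding r'_def using pos s'_bounds(1)[of \<tau>] by (intro divide_right_mono) auto
  also have "\<dots> = - (3 / (4 * pi)) * r \<tau>" using pos by (simp add: power2_eq_square)
  finally show "r' \<tau> \<le> - (3 / (4 * pi)) * r \<tau>" .
qed

section \<open>Displacements and removal of the clamp\<close>

lemma norm_field_le:
  assumes "0 \<le> \<tau>" and i: "i \<in> {1..n}" shows "norm (field (Z \<tau>) i) \<le> - r' \<tau>"
proof -
  have r: "0 < r \<tau>" "r \<tau> < \<zeta>" using r_pos r_less_\<zeta> assms by auto
  have "norm (field (Z \<tau>) i) \<le> 1 / (2 * pi) * r \<tau> + (r \<tau>)\<^sup>2 * norm (regvel (clamp (Z \<tau>)) i)"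
    unfolding field_def using i speed_eq[OF assms(1)] r
    by (intro norm_triangle_mono) (auto simp: r_def)
  also have "(r \<tau>)\<^sup>2 * norm (regvel (clamp (Z \<tau>)) i) \<le> (r \<tau>)\<^sup>2 * (real n / (pi * \<delta>))"
    using clamp_ball i by (intro mult_left_mono norm_regvel_le) auto
  also have "\<dots> = r \<tau> * (1 / pi) * (r \<tau> * real n / \<delta>)" by (simp add: power2_eq_square)
  also have "\<dots> \<le> r \<tau> * (1 / pi) * (1 / 4)"
  proof (intro mult_left_mono)
    have "r \<tau> * real n \<le> \<zeta> * real n" using r by (intro mult_right_mono) auto
    then show "r \<tau> * real n / \<delta> \<le> 1 / 4" using small \<delta>_pos \<eta>_pos
      by (simp add: divide_simps) (simp add: \<delta>_def algebra_simps)
  qed (use r in auto)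
  \<comment> \<open>The budget: \<open>1 / (2 * pi)\<close> from the attraction and
    \<open>1 / (4 * pi)\<close> from everything else add up to exactly the guaranteed rate of
    decrease of \<open>r\<close>.\<close>
  also have "1 / (2 * pi) * r \<tau> + r \<tau> * (1 / pi) * (1 / 4) = 3 / (4 * pi) * r \<tau>" by (simp add: field_simps)
  finally show ?thesis using r'_le(2)[OF assms(1)] by simp
qed

text \<open>Each point moves no faster than \<open>r\<close> decreases, so its path is paid for by
  the loss of \<open>r\<close>. Confinement to the balls and convergence of all points both follow
  from this telescoping bound.\<close>

lemma displacement:
  assumes "0 \<le> \<tau>1" "\<tau>1 \<le> \<tau>2" and i: "i \<in> {1..n}"
  shows "norm (Z \<tau>2 i - Z \<tau>1 i) \<le> r \<tau>1 - r \<tau>2"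
proof (cases "\<tau>1 = \<tau>2")
  case False
  then have lt: "\<tau>1 < \<tau>2" using assms by simp
  have "norm (Z \<tau>2 i - Z \<tau>1 i) \<le> (- r \<tau>2) - (- r \<tau>1)"
  proof (rule differentiable_bound_general[OF lt, where f'="\<lambda>\<tau>. field (Z \<tau>) i" and \<phi>'="\<lambda>\<tau>. - r' \<tau>" and f="\<lambda>\<tau>. Z \<tau> i" and \<phi>="\<lambda>\<tau>. - r \<tau>"])
    show "continuous_on {\<tau>1..\<tau>2} (\<lambda>\<tau>. Z \<tau> i)"
      by (intro continuous_at_imp_continuous_on ballI has_vector_derivative_continuous[OF Z_deriv[OF i]])
    show "continuous_on {\<tau>1..\<tau>2} (\<lambda>\<tau>. - r \<tau>)"
      using assms(1) by (intro continuous_on_minus continuous_at_imp_continuous_on ballI DERIV_isCont[OF r_deriv]) auto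
    fix x assume "\<tau>1 < x" "x < \<tau>2"
    then have x: "0 \<le> x" using assms by simp
    show "((\<lambda>\<tau>. Z \<tau> i) has_vector_derivative field (Z x) i) (at x)" by (rule Z_deriv_pos[OF x i])
    show "((\<lambda>\<tau>. - r \<tau>) has_vector_derivative - r' x) (at x)"
      using DERIV_minus[OF r_deriv[OF x]] by (simp add: has_real_derivative_iff_has_vector_derivative)
    show "norm (field (Z x) i) \<le> - r' x" by (rule norm_field_le[OF x i])
  qed
  then show ?thesis by simp
qed simp

lemma Z_in_ball:
  assumes "0 \<le> \<tau>" and i: "i \<in> {1..n}" shows "Z \<tau> i \<in> cball (center i) R"
proof -
  have "norm (Z \<tau> i - z0 i) \<le> \<zeta>"
    using displacement[OF order_refl assms] Z_0[OF i] r_pos[OF assms(1)] r_less_\<zeta>[of 0] by simp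
  \<comment> \<open>The second point of the pair is clamped around the first, which costs another
    \<open>\<zeta>\<close>; the total \<open>2 * \<zeta>\<close> is still far below
    \<open>R\<close>.\<close>
  moreover have "norm (z0 i - center i) \<le> \<zeta>"
    using z0_close \<zeta> by (auto simp: center_def norm_minus_commute)
  ultimately have "norm (Z \<tau> i - center i) \<le> 2 * \<zeta>"
    using norm_triangle_ineq[of "Z \<tau> i - z0 i" "z0 i - center i"] by simp
  then show ?thesis using \<zeta>_le \<zeta> by (simp add: dist_norm norm_minus_commute R_def)
qed

text \<open>All bounds were proved for the clamped system and all times, and they confine the points
  to the balls; so the clamp never acts and the trajectory solves the original rescaled
  system.\<close>

lemma regvel_clamp:
  assumes "0 \<le> \<tau>" "i \<in> {1..n}" shows "regvel (clamp (Z \<tau>)) i = regvel (Z \<tau>) i"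
proof -
  have c: "clamp (Z \<tau>) j = Z \<tau> j" if "j \<in> {1..n}" for j
    by (rule clamp_id[of "Z \<tau>" j, OF Z_in_ball[OF assms(1) that]])
  show ?thesis using assms(2) one_two c unfolding regvel_def velocity_def
    by (auto simp: c intro!: arg_cong2[where f="(-)"] arg_cong2[where f="(+)"] sum.cong arg_cong[where f=uminus])
qed

lemma Z_velocity:
  assumes "0 \<le> \<tau>" and i: "i \<in> {1..n}"
  shows "((\<lambda>\<tau>. Z \<tau> i) has_vector_derivative (r \<tau>)\<^sup>2 *\<^sub>R velocity b n (Z \<tau>) i) (at \<tau>)"
proof -
  have r: "0 < r \<tau>" by (rule r_pos[OF assms(1)])
  have rv: "(r \<tau>)\<^sup>2 *\<^sub>R vinv (Z \<tau> 1 - Z \<tau> 2) = Z \<tau> 1 - Z \<tau> 2"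
    using r by (simp add: vinv_def r_def)
  have "field (Z \<tau>) i = (r \<tau>)\<^sup>2 *\<^sub>R velocity b n (Z \<tau>) i"
  proof -
    consider "i = 1" | "i = 2" | "i \<noteq> 1" "i \<noteq> 2" by blast
    then show ?thesis
    proof cases
      case 1
      have "(r \<tau>)\<^sup>2 *\<^sub>R velocity b n (Z \<tau>) 1 = (r \<tau>)\<^sup>2 *\<^sub>R regvel (Z \<tau>) 1 - (1 / (2 * pi)) *\<^sub>R ((r \<tau>)\<^sup>2 *\<^sub>R vinv (Z \<tau> 1 - Z \<tau> 2))"
        unfolding velocity_pair by (simp add: scaleR_diff_right mult.commute del: One_nat_def)
      then show ?thesis using 1 i one_two unfolding rv
        by (simp add: field_def speed_eq[OF assms(1)] regvel_clamp[OF assms(1) one_two(1)] regvel_clamp[OF assms(1) one_two(2)] del: One_nat_def)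
    next
      case 2
      have "(r \<tau>)\<^sup>2 *\<^sub>R velocity b n (Z \<tau>) 2 = (r \<tau>)\<^sup>2 *\<^sub>R regvel (Z \<tau>) 2 + (1 / (2 * pi)) *\<^sub>R ((r \<tau>)\<^sup>2 *\<^sub>R vinv (Z \<tau> 1 - Z \<tau> 2))"
        unfolding velocity_pair by (simp add: scaleR_add_right mult.commute del: One_nat_def)
      then show ?thesis using 2 i one_two unfolding rv
        by (simp add: field_def speed_eq[OF assms(1)] regvel_clamp[OF assms(1) one_two(1)] regvel_clamp[OF assms(1) one_two(2)] del: One_nat_def)
    next
      case 3
      then show ?thesis using i
        by (simp add: field_def speed_eq[OF assms(1)] regvel_clamp[OF assms]) (simp add: regvel_def)
    qed
  qed
  then show ?thesis using Z_deriv_pos[OF assms] by simp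
qed

lemma Z_dom: "0 \<le> \<tau> \<Longrightarrow> i \<in> {1..n} \<Longrightarrow> Z \<tau> i \<in> \<Omega>"
  using ball_far[OF _ Z_in_ball] farD(1) by blast

lemma Z_inj: assumes "0 \<le> \<tau>" shows "inj_on (Z \<tau>) {1..n}"
proof (rule inj_onI, rule ccontr)
  fix i j assume ij: "i \<in> {1..n}" "j \<in> {1..n}" "Z \<tau> i = Z \<tau> j" "i \<noteq> j"
  show False
  proof (cases "3 \<le> i \<or> 3 \<le> j")
    case True
    from ball_separation[OF ij(1,2,4) True Z_in_ball[OF assms ij(1)] Z_in_ball[OF assms ij(2)]] ij(3) \<delta>_pos
    show False by simp
  next
    case False
    then have "{i, j} = {1, 2}" using ij by auto
    then have "Z \<tau> 1 = Z \<tau> 2" using ij(3) by (metis doubleton_eq_iff)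
    then show False using r_pos[OF assms] by (simp add: r_def)
  qed
qed

lemma r_antimono:
  assumes "0 \<le> \<tau>1" "\<tau>1 \<le> \<tau>2" shows "r \<tau>2 \<le> r \<tau>1"
  using displacement[OF assms one_two(1)] norm_ge_zero[of "Z \<tau>2 1 - Z \<tau>1 1"] by linarith

lemma r_small:
  assumes "0 < \<epsilon>" shows "\<exists>\<tau>\<ge>0. r \<tau> < \<epsilon>"
proof (rule ccontr)
  assume "\<not> ?thesis"
  then have ge: "\<epsilon> \<le> r \<tau>" if "0 \<le> \<tau>" for \<tau> using that by (simp add: not_less)
  define c where "c = 3 / (4 * pi) * \<epsilon>"
  have c: "0 < c" using assms by (simp add: c_def)
  define \<tau> where "\<tau> = \<zeta> / c"
  have \<tau>: "0 \<le> \<tau>" using \<zeta> c by (simp add: \<tau>_def)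
  have "r \<tau> + c * \<tau> \<le> r 0 + c * 0"
  proof (rule DERIV_nonpos_imp_nonincreasing[OF \<tau>, where f="\<lambda>\<tau>. r \<tau> + c * \<tau>"])
    fix x assume x: "0 \<le> x" "x \<le> \<tau>"
    have "((\<lambda>\<tau>. r \<tau> + c * \<tau>) has_real_derivative r' x + c) (at x)"
      using r_deriv[OF x(1)] by (auto intro!: derivative_eq_intros)
    moreover have "3 / (4 * pi) * \<epsilon> \<le> 3 / (4 * pi) * r x" using ge[OF x(1)] by (intro mult_left_mono) auto
    then have "r' x + c \<le> 0" using r'_le(2)[OF x(1)] by (simp add: c_def)
    ultimately show "\<exists>y. ((\<lambda>\<tau>. r \<tau> + c * \<tau>) has_real_derivative y) (at x) \<and> y \<le> 0" by blast
  qed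
  moreover have "c * \<tau> = \<zeta>" using c by (simp add: \<tau>_def)
  ultimately show False using r_pos[OF \<tau>] r_less_\<zeta>[of 0] by simp
qed

section \<open>The Lyapunov function and the bound on the collision time\<close>

lemma Lyapunov_polynomial:
  fixes u v :: real
  assumes "0 \<le> u" "u \<le> 1 / 400" "0 \<le> v" "v \<le> 1 / 640000"
  shows "1 \<le> (1 + 3 * u + 2 * v) * (1 - 207 / 100 * u - 187 / 100 * v)"
proof -
  have "u * u \<le> u * (1 / 400)" "u * v \<le> u * (1 / 640000)" "v * v \<le> v * (1 / 640000)"
    using mult_left_mono[OF assms(2,1)] mult_left_mono[OF assms(4,1)] mult_left_mono[OF assms(4,3)] .
  \<comment> \<open>The linear coefficients are \<open>3 - 207/100\<close> and
    \<open>2 - 187/100\<close>; being positive, they absorb the quadratic terms, which are small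
    since \<open>u\<close> and \<open>v\<close> are.\<close>
  moreover have "(1 + 3 * u + 2 * v) * (1 - 207 / 100 * u - 187 / 100 * v)
      = 1 + 93 / 100 * u + 13 / 100 * v - 621 / 100 * (u * u) - 975 / 100 * (u * v) - 374 / 100 * (v * v)"
    by (simp add: field_simps)
  ultimately show ?thesis using assms by linarith
qed

text \<open>With \<open>y = 2 p x + q x^2\<close> the stated bound, as a function of the initial
  distance \<open>x\<close>, is \<open>pi/2 x^2 / (1 - y)\<close>; \<open>V\<close> keeps the factor
  \<open>1 + y\<close> in place of \<open>1 / (1 - y)\<close>. Its derivative is
  \<open>pi x (1 + 3 p x + 2 q x^2)\<close>, the first factor in
  \<open>Lyapunov_polynomial\<close>.\<close>

definition V :: "real \<Rightarrow> real" where
  "V x = pi / 2 * (x\<^sup>2 + 2 * p * x ^ 3 + q * x ^ 4)"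

lemma \<theta>_le: assumes "0 \<le> \<tau>" shows "\<theta> \<tau> \<le> V \<zeta>"
proof -
  have "\<theta> \<tau> + V (r \<tau>) \<le> \<theta> 0 + V (r 0)"
  proof (rule DERIV_nonpos_imp_nonincreasing[OF assms, where f="\<lambda>\<tau>. \<theta> \<tau> + V (r \<tau>)"])
    fix x assume x: "0 \<le> x" "x \<le> \<tau>"
    have r: "0 < r x" "r x < \<zeta>" using r_pos r_less_\<zeta> x by auto
    let ?w = "1 + 3 * (p * r x) + 2 * (q * (r x)\<^sup>2)"
    let ?g = "1 - 207 / 100 * (p * r x) - 187 / 100 * (q * (r x)\<^sup>2)"
    have w: "0 \<le> ?w" using r p_nonneg q_pos by (intro add_nonneg_nonneg mult_nonneg_nonneg) auto
    have \<theta>': "(\<theta> has_real_derivative (r x)\<^sup>2) (at x)" using \<theta>_deriv[of x] x by (simp add: speed_eq max_def)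
    have d: "((\<lambda>\<tau>. \<theta> \<tau> + V (r \<tau>)) has_real_derivative (r x)\<^sup>2 + pi * r x * ?w * r' x) (at x)"
      unfolding V_def
      by (auto intro!: derivative_eq_intros r_deriv[OF x(1)] \<theta>' simp: power2_eq_square power3_eq_cube field_simps power_numeral_reduce)
    have "pi * r x * ?w * r' x \<le> pi * r x * ?w * (- (1 / pi) * r x * ?g)"
      using r'_le(1)[OF x(1)] r w by (intro mult_left_mono mult_nonneg_nonneg) (auto simp: mult.assoc)
    also have "\<dots> = - (r x)\<^sup>2 * (?w * ?g)" by (simp add: power2_eq_square)
    also have "\<dots> \<le> - (r x)\<^sup>2 * 1"
      using Lyapunov_polynomial[of "p * r x" "q * (r x)\<^sup>2"] p_small[of "r x"] q_small[of "r x"] r p_nonneg q_pos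
      by (intro mult_left_mono_neg) auto
    finally show "\<exists>y. ((\<lambda>\<tau>. \<theta> \<tau> + V (r \<tau>)) has_real_derivative y) (at x) \<and> y \<le> 0" using d by force
  qed
  moreover have "0 \<le> V (r \<tau>)" using r_pos[OF assms] p_nonneg q_pos by (auto simp: V_def intro!: add_nonneg_nonneg)
  moreover have "V (r 0) \<le> V \<zeta>"
    unfolding V_def using r_pos[of 0] r_less_\<zeta>[of 0] p_nonneg q_pos
    by (intro mult_left_mono add_mono power_mono) auto
  ultimately show ?thesis using \<theta>_0 by simp
qed

lemma V_bound: "V \<zeta> \<le> pi * \<zeta>\<^sup>2 * \<eta>\<^sup>2 / (2 * (\<eta>\<^sup>2 - \<zeta>\<^sup>2 - 2 * (real n - 2) * \<zeta> * \<eta>))"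
proof -
  define y where "y = 2 * (p * \<zeta>) + q * \<zeta>\<^sup>2"
  have y: "0 \<le> y" "y < 1" using p_small[of \<zeta>] q_small[of \<zeta>] \<zeta> p_nonneg q_pos by (auto simp: y_def)
  have "V \<zeta> = pi / 2 * \<zeta>\<^sup>2 * (1 + y)"
    by (simp add: V_def y_def power2_eq_square power3_eq_cube power_numeral_reduce algebra_simps)
  also have "\<dots> \<le> pi / 2 * \<zeta>\<^sup>2 * (1 / (1 - y))"
  proof (rule mult_left_mono)
    have "(1 + y) * (1 - y) \<le> 1" by (simp add: algebra_simps)
    then show "1 + y \<le> 1 / (1 - y)" using y by (simp add: pos_le_divide_eq)
  qed simp
  also have "pi / 2 * \<zeta>\<^sup>2 * (1 / (1 - y)) = pi * \<zeta>\<^sup>2 * \<eta>\<^sup>2 / (2 * (\<eta>\<^sup>2 * (1 - y)))"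
    using \<eta>_pos by simp
  also have "\<eta>\<^sup>2 * (1 - y) = \<eta>\<^sup>2 - \<zeta>\<^sup>2 - 2 * (real n - 2) * \<zeta> * \<eta>"
    using \<eta>_pos by (simp add: y_def p_def q_def power2_eq_square field_simps)
  finally show ?thesis .
qed

end

section \<open>The limit configuration and the return to physical time\<close>

context dipole_trajectory begin

text \<open>The displacement bound makes the positions Cauchy along integer times, and the same
  bound carries the estimate to all real times; the rate is \<open>r\<close> itself, for every
  point.\<close>

lemma Z_limit:
  assumes i: "i \<in> {1..n}" shows "\<exists>l. \<forall>\<tau>\<ge>0. norm (Z \<tau> i - l) \<le> r \<tau>"
proof -
  let ?X = "\<lambda>m. Z (real m) i"
  have "Cauchy ?X"
  proof (rule CauchyI')
    fix \<epsilon> :: real assume "0 < \<epsilon>"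
    then obtain \<tau> where \<tau>: "0 \<le> \<tau>" "r \<tau> < \<epsilon>" using r_small by blast
    obtain M :: nat where M: "\<tau> \<le> real M" using real_arch_simple by blast
    show "\<exists>M. \<forall>m\<ge>M. \<forall>n>m. dist (?X m) (?X n) < \<epsilon>"
    proof (intro exI allI impI)
      fix m k :: nat assume m: "M \<le> m" "m < k"
      have "norm (?X k - ?X m) \<le> r (real m) - r (real k)"
        using m by (intro displacement i) auto
      also have "\<dots> < \<epsilon>"
        using r_antimono[OF \<tau>(1), of "real m"] r_pos[of "real k"] \<tau>(2) M m by auto
      finally show "dist (?X m) (?X k) < \<epsilon>" by (simp add: dist_norm norm_minus_commute)
    qed
  qed
  then obtain l where l: "?X \<longlonglongrightarrow> l" using Cauchy_convergent_iff convergent_def by blast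
  have "norm (Z \<tau> i - l) \<le> r \<tau>" if "0 \<le> \<tau>" for \<tau>
  proof (rule LIMSEQ_le_const2)
    show "(\<lambda>m. norm (Z \<tau> i - ?X m)) \<longlonglongrightarrow> norm (Z \<tau> i - l)" by (intro tendsto_intros l)
    obtain M :: nat where M: "\<tau> \<le> real M" using real_arch_simple by blast
    have "norm (Z \<tau> i - ?X m) \<le> r \<tau>" if "M \<le> m" for m
    proof -
      have "norm (?X m - Z \<tau> i) \<le> r \<tau> - r (real m)"
        using \<open>0 \<le> \<tau>\<close> M that by (intro displacement i) auto
      then show ?thesis using r_pos[of "real m"] by (simp add: norm_minus_commute)
    qed
    then show "\<exists>N. \<forall>m\<ge>N. norm (Z \<tau> i - ?X m) \<le> r \<tau>" by blast
  qed
  then show ?thesis by blast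
qed

text \<open>Total physical time of the rescaled trajectory. It is finite by the Lyapunov bound and,
  the clock being strictly increasing, never attained at finite \<open>\<tau>\<close>.\<close>

definition T where "T = Sup (\<theta> ` {0..})"

lemma \<theta>_less: assumes "x < y" shows "\<theta> x < \<theta> y"
proof (rule DERIV_pos_imp_increasing[OF assms])
  fix x
  have "0 < speed (Z (max 0 x))" using speed_eq[of "max 0 x"] r_pos[of "max 0 x"] by simp
  then show "\<exists>y. (\<theta> has_real_derivative y) (at x) \<and> 0 < y" using \<theta>_deriv by blast
qed

lemma \<theta>_cont: "isCont \<theta> x"
  using \<theta>_deriv by (rule DERIV_isCont)

lemma \<theta>_bdd: "bdd_above (\<theta> ` {0..})"
  using \<theta>_le by (intro bdd_aboveI[of _ "V \<zeta>"]) auto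

lemma \<theta>_less_T: assumes "0 \<le> \<tau>" shows "\<theta> \<tau> < T"
proof -
  have "\<theta> (\<tau> + 1) \<le> T" unfolding T_def using assms by (intro cSup_upper \<theta>_bdd) auto
  then show ?thesis using \<theta>_less[of \<tau> "\<tau> + 1"] by simp
qed

lemma T_pos: "0 < T" using \<theta>_less_T[of 0] \<theta>_0 by simp

lemma T_le: "T \<le> V \<zeta>"
  unfolding T_def using \<theta>_le by (intro cSup_least) auto

text \<open>Rescaled time as a function of physical time. Since \<open>\<theta>\<close> is strictly
  increasing on all of \<open>real\<close>, it is a genuine inverse on the range of
  \<open>\<theta>\<close>, which contains \<open>[0, T)\<close> and a neighbourhood of 0.\<close>

definition g where "g = inv \<theta>"

lemma g_\<theta>: "g (\<theta> x) = x"
proof -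
  have "inj \<theta>" by (rule injI) (metis \<theta>_less less_irrefl linorder_neqE)
  then show ?thesis by (simp add: g_def)
qed

lemma \<theta>_onto:
  assumes "x \<le> y" "\<theta> x \<le> t" "t \<le> \<theta> y" shows "\<theta> (g t) = t" "x \<le> g t"
proof -
  obtain \<tau> where "x \<le> \<tau>" "\<theta> \<tau> = t"
    using IVT[of \<theta> x t y] assms \<theta>_cont by blast
  then show "\<theta> (g t) = t" "x \<le> g t" using g_\<theta> by auto
qed

lemma g_range:
  assumes "0 \<le> t" "t < T" shows "\<theta> (g t) = t" "0 \<le> g t"
proof -
  obtain y where y: "0 \<le> y" "t < \<theta> y"
    using assms(2) less_cSup_iff[OF _ \<theta>_bdd, of t] by (auto simp: T_def)
  show "\<theta> (g t) = t" "0 \<le> g t" using \<theta>_onto[of 0 y t] y assms(1) \<theta>_0 by auto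
qed

lemma g_less: assumes "0 \<le> t" "t < T" "\<theta> x < t" shows "x < g t"
proof (rule ccontr)
  assume "\<not> x < g t"
  then have "\<theta> (g t) \<le> \<theta> x" using \<theta>_less[of "g t" x] by (cases "g t = x") auto
  then show False using g_range(1)[OF assms(1,2)] assms(3) by simp
qed

lemma g_deriv:
  assumes t: "0 \<le> t" "t < T"
  shows "(g has_real_derivative inverse ((r (g t))\<^sup>2)) (at t)"
proof (rule DERIV_inverse_function)
  have g: "\<theta> (g t) = t" "0 \<le> g t" using g_range[OF t] by auto
  show "(\<theta> has_real_derivative (r (g t))\<^sup>2) (at (g t))"
    using \<theta>_deriv[of "g t"] g(2) by (simp add: max_def speed_eq)
  show "(r (g t))\<^sup>2 \<noteq> 0" using r_pos[OF g(2)] by simp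
  \<comment> \<open>For \<open>t = 0\<close> the left neighbour belongs to a negative
    \<open>\<tau>\<close>: here the continuation of the trajectory to negative times makes the
    derivative of \<open>g\<close> two-sided.\<close>
  show "\<theta> (g t - 1) < t" "t < \<theta> (g t + 1)"
    using \<theta>_less[of "g t - 1" "g t"] \<theta>_less[of "g t" "g t + 1"] g(1) by auto
  show "\<theta> (g y) = y" if "\<theta> (g t - 1) < y" "y < \<theta> (g t + 1)" for y
    using \<theta>_onto(1)[of "g t - 1" "g t + 1" y] that by auto
  have "isCont g (\<theta> (g t))"
    by (rule isCont_inverse_function[of 1]) (auto simp: g_\<theta> \<theta>_cont)
  then show "isCont g t" using g(1) by simp
qed

lemma collision: "collision_time \<Omega> k b n z0 T"
proof -
  obtain l where l: "\<And>i \<tau>. i \<in> {1..n} \<Longrightarrow> 0 \<le> \<tau> \<Longrightarrow> norm (Z \<tau> i - l i) \<le> r \<tau>"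
    using Z_limit by metis
  \<comment> \<open>From \<open>T\<close> on the path rests at the limit, which provides the value
    of the evolution at the collision.\<close>
  define z where "z t = (if t < T then Z (g t) else l)" for t
  have zg: "z t = Z (g t)" if "t < T" for t using that by (simp add: z_def)
  have dom: "z t \<in> {1..n} \<rightarrow> \<Omega>" "inj_on (z t) {1..n}" if "t \<in> {0..<T}" for t
    using that Z_dom Z_inj g_range(2)[of t] by (auto simp: zg)
  have der: "((\<lambda>t. z t i) has_vector_derivative velocity b n (z t) i) (at t)"
    if t: "t \<in> {0..<T}" and i: "i \<in> {1..n}" for t i
  proof -
    have t': "0 \<le> t" "t < T" using t by auto
    have g: "0 \<le> g t" by (rule g_range(2)[OF t'])
    \<comment> \<open>The squared distance in the rescaled equation cancels against the derivative
      of \<open>g\<close>, which leaves the unscaled velocity.\<close>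
    have "((\<lambda>\<tau>. Z \<tau> i) \<circ> g has_vector_derivative
        inverse ((r (g t))\<^sup>2) *\<^sub>R ((r (g t))\<^sup>2 *\<^sub>R velocity b n (Z (g t)) i)) (at t)"
      by (rule vector_diff_chain_at[where f=g and g="\<lambda>\<tau>. Z \<tau> i", OF _ Z_velocity[OF g i]])
        (use g_deriv[OF t'] in \<open>simp add: has_real_derivative_iff_has_vector_derivative\<close>)
    then have "((\<lambda>t. Z (g t) i) has_vector_derivative velocity b n (z t) i) (at t)"
      using r_pos[OF g] t' by (simp add: o_def zg)
    then show ?thesis
      by (rule has_vector_derivative_transform_within_open[of _ _ _ "{..<T}"]) (use t' in \<open>auto simp: zg\<close>)
  qed
  have cont: "continuous_on {0..T} (\<lambda>t. z t i)" if i: "i \<in> {1..n}" for i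
    unfolding continuous_on_eq_continuous_within
  proof
    fix t assume t: "t \<in> {0..T}"
    show "continuous (at t within {0..T}) (\<lambda>t. z t i)"
    proof (cases "t < T")
      case True
      then show ?thesis using has_vector_derivative_continuous[OF der[OF _ i, of t]] t
        by (auto intro: continuous_at_imp_continuous_within)
    next
      case False
      then have tT: "t = T" using t by simp
      show ?thesis unfolding tT continuous_within_eps_delta
      proof (intro allI impI)
        fix \<epsilon> :: real assume "0 < \<epsilon>"
        then obtain \<tau> where \<tau>: "0 \<le> \<tau>" "r \<tau> < \<epsilon>" using r_small by blast
        show "\<exists>\<delta>>0. \<forall>s\<in>{0..T}. dist s T < \<delta> \<longrightarrow> dist (z s i) (z T i) < \<epsilon>"
        \<comment> \<open>A time \<open>s < T\<close> closer to \<open>T\<close> than this satisfies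
          \<open>\<theta> \<tau> < s\<close>, hence \<open>\<tau> < g s\<close>, where all points
          are within \<open>r \<tau>\<close> of their limits.\<close>
        proof (intro exI[of _ "T - \<theta> \<tau>"] conjI ballI impI)
          show "0 < T - \<theta> \<tau>" using \<theta>_less_T[OF \<tau>(1)] by simp
          fix s assume s: "s \<in> {0..T}" "dist s T < T - \<theta> \<tau>"
          show "dist (z s i) (z T i) < \<epsilon>"
          proof (cases "s < T")
            case True
            then have g: "0 \<le> g s" "\<tau> < g s"
              using s g_range(2)[of s] g_less[of s \<tau>] by (auto simp: dist_real_def)
            have "norm (Z (g s) i - l i) \<le> r (g s)" by (rule l[OF i g(1)])
            also have "\<dots> \<le> r \<tau>" using \<tau> g by (intro r_antimono) auto
            finally show ?thesis using \<tau>(2) True by (simp add: z_def dist_norm)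
          next
            case False
            then have "s = T" using s by simp
            then show ?thesis using \<open>0 < \<epsilon>\<close> by simp
          qed
        qed
      qed
    qed
  qed
  have ev: "evolution \<Omega> k b n T z"
    unfolding evolution_def
  proof (intro conjI ballI)
    fix i t assume i: "i \<in> {1..n}" and t: "t \<in> {0..<T}"
    have "(b i)\<^sup>2 = 1" using moduli(1)[OF i] by (metis abs_one one_power2 power2_abs)
    then have "GDERIV (\<lambda>x. energy k b n ((z t)(i := x))) (z t i) :> - velocity b n (z t) i"
      using dom[OF t] i by (intro energy_GDERIV)
    moreover have "((\<lambda>s. z s i) has_vector_derivative - (- velocity b n (z t) i)) (at t within {0..<T})"
      using has_vector_derivative_at_within[OF der[OF t i]] by simp
    ultimately show "\<exists>g. GDERIV (\<lambda>x. energy k b n ((z t)(i := x))) (z t i) :> g \<and>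
        ((\<lambda>s. z s i) has_vector_derivative - g) (at t within {0..<T})" by blast
  qed (use cont dom in auto)
  have init: "z 0 i = z0 i" if "i \<in> {1..n}" for i
    using g_\<theta>[of 0] \<theta>_0 Z_0[OF that] T_pos by (simp add: z_def)
  have "the_evolution \<Omega> k b n z0 T z"
    unfolding the_evolution_def
  proof (intro conjI allI impI ballI)
    fix S w t i
    assume w: "0 < S \<and> S \<le> T \<and> evolution \<Omega> k b n S w \<and> (\<forall>i\<in>{1..n}. w 0 i = z0 i)"
      and t: "t \<in> {0..S}" and i: "i \<in> {1..n}"
    show "w t i = z t i"
    proof (rule evolution_unique[where b=b and n=n and S=S])
      show "evolution \<Omega> k b n S z" using evolution_restrict[OF ev] w by blast
    qed (use w t i init moduli(1) in auto)
  qed (use ev init in auto)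
  moreover have "l i \<in> \<Omega>" if i: "i \<in> {1..n}" for i
  proof -
    have "norm (z0 i - l i) \<le> \<zeta>" using l[OF i, of 0] Z_0[OF i] r_less_\<zeta>[of 0] by simp
    moreover have "norm (center i - z0 i) \<le> \<zeta>" using z0_close \<zeta> by (auto simp: center_def)
    ultimately have "norm (center i - l i) \<le> 2 * \<zeta>"
      using norm_triangle_ineq[of "center i - z0 i" "z0 i - l i"] by simp
    then have "l i \<in> cball (center i) R" using \<zeta>_le \<zeta> by (simp add: dist_norm R_def)
    then show ?thesis using ball_far[OF i] farD(1) by blast
  qed
  moreover have "l 1 = l 2"
  proof (rule ccontr)
    assume "l 1 \<noteq> l 2"
    \<comment> \<open>A third, because the distance of the limits is at most the sum of
      \<open>r \<tau>\<close> and two deviations, each bounded by \<open>r \<tau>\<close>.\<close>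
    then obtain \<tau> where \<tau>: "0 \<le> \<tau>" "r \<tau> < norm (l 1 - l 2) / 3"
      using r_small[of "norm (l 1 - l 2) / 3"] by auto
    have "norm (l 1 - l 2) \<le> norm (Z \<tau> 1 - l 1) + r \<tau> + norm (Z \<tau> 2 - l 2)"
      using norm_triangle_ineq[of "l 1 - Z \<tau> 1" "Z \<tau> 1 - Z \<tau> 2"]
        norm_triangle_ineq[of "l 1 - Z \<tau> 2" "Z \<tau> 2 - l 2"]
      by (simp add: r_def norm_minus_commute)
    then show False using l[OF one_two(1) \<tau>(1)] l[OF one_two(2) \<tau>(1)] \<tau>(2) by linarith
  qed
  moreover have "z T = l" by (simp add: z_def)
  ultimately show ?thesis
    unfolding collision_time_def using T_pos dom(1) one_two
    by (intro conjI exI[of _ z]) auto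
qed

end

theorem theorem3p4:
  fixes \<Omega> :: "(real^2) set" and k :: "real^2 \<Rightarrow> real^2 \<Rightarrow> real" and n :: nat and \<eta>0 :: real
  assumes "open \<Omega>" and "connected \<Omega>" and "bounded \<Omega>" and "C2_boundary \<Omega>"
    and "is_k \<Omega> k"
    and "2 \<le> n"
    and "0 < \<eta>0" and "\<eta>0 < diameter \<Omega> / 2"
  shows "(\<exists>\<zeta>0. 0 < \<zeta>0 \<and> \<zeta>0 < \<eta>0 \<and>
            (\<forall>b z0. burgers_moduli n b \<and> z0 \<in> config_set \<Omega> n \<zeta>0 \<eta>0 \<and> z0 1 \<noteq> z0 2 \<longrightarrow>
               (\<exists>T. collision_time \<Omega> k b n z0 T)))
       \<and> (\<forall>\<^sub>F \<zeta>0 in at_right 0.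
            \<forall>b z0. burgers_moduli n b \<and> z0 \<in> config_set \<Omega> n \<zeta>0 \<eta>0 \<and> z0 1 \<noteq> z0 2 \<longrightarrow>
               (\<exists>T. collision_time \<Omega> k b n z0 T \<and>
                    T \<le> pi * \<zeta>0\<^sup>2 * \<eta>0\<^sup>2 /
                        (2 * (\<eta>0\<^sup>2 - \<zeta>0\<^sup>2 - 2 * (real n - 2) * \<zeta>0 * \<eta>0))))"
proof -
  \<comment> \<open>The smallness condition depends only on \<open>n\<close> and
    \<open>\<eta>0\<close> and is inherited by smaller \<zeta>. Its extreme value
    \<open>\<eta>0 / (400 * real n)\<close> therefore gives the first claim, and all smaller values
    the second.\<close>
  have main: "\<exists>T. collision_time \<Omega> k b n z0 T \<and>
      T \<le> pi * \<zeta>\<^sup>2 * \<eta>0\<^sup>2 / (2 * (\<eta>0\<^sup>2 - \<zeta>\<^sup>2 - 2 * (real n - 2) * \<zeta> * \<eta>0))"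
    if \<zeta>: "0 < \<zeta>" "400 * real n * \<zeta> \<le> \<eta>0"
      and b: "burgers_moduli n b" and z0: "z0 \<in> config_set \<Omega> n \<zeta> \<eta>0" "z0 1 \<noteq> z0 2" for \<zeta> b z0
  proof -
    interpret dipole \<Omega> k b n \<eta>0 \<zeta> z0
      by unfold_locales (use assms \<zeta> b z0 in auto)
    obtain \<theta> Z where traj: "\<theta> 0 = 0" "\<And>i. i \<in> {1..n} \<Longrightarrow> Z 0 i = z0 i"
      "\<And>\<tau>. (\<theta> has_real_derivative speed (Z (max 0 \<tau>))) (at \<tau>)"
      "\<And>\<tau> i. i \<in> {1..n} \<Longrightarrow> ((\<lambda>\<tau>. Z \<tau> i) has_vector_derivative field (Z (max 0 \<tau>)) i) (at \<tau>)"
      by (rule trajectory_exists) (rule that; assumption)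
    interpret dipole_trajectory \<Omega> k b n \<eta>0 \<zeta> z0 \<theta> Z
      by unfold_locales (fact traj)+
    show ?thesis using collision order_trans[OF T_le V_bound] by blast
  qed
  define \<zeta> where "\<zeta> = \<eta>0 / (400 * real n)"
  have n: "0 < real n" using assms by simp
  have \<zeta>: "0 < \<zeta>" "400 * real n * \<zeta> \<le> \<eta>0" using assms n by (auto simp: \<zeta>_def)
  have less: "\<zeta> < \<eta>0" using assms n by (simp add: \<zeta>_def pos_divide_less_eq)
  show ?thesis
  proof (intro conjI)
    show "\<exists>\<zeta>0. 0 < \<zeta>0 \<and> \<zeta>0 < \<eta>0 \<and>
            (\<forall>b z0. burgers_moduli n b \<and> z0 \<in> config_set \<Omega> n \<zeta>0 \<eta>0 \<and> z0 1 \<noteq> z0 2 \<longrightarrow>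
               (\<exists>T. collision_time \<Omega> k b n z0 T))"
    proof (rule exI[of _ \<zeta>], intro conjI allI impI)
      fix b z0 assume "burgers_moduli n b \<and> z0 \<in> config_set \<Omega> n \<zeta> \<eta>0 \<and> z0 1 \<noteq> z0 2"
      then show "\<exists>T. collision_time \<Omega> k b n z0 T" using main[OF \<zeta>, of b z0] by blast
    qed (rule \<zeta> less)+
    have "\<forall>\<^sub>F x in at_right 0. 0 < x \<and> 400 * real n * x \<le> \<eta>0"
      unfolding eventually_at_right_field
    proof (intro exI[of _ \<zeta>] conjI allI impI)
      fix x assume "0 < x" "x < \<zeta>"
      then have "400 * real n * x \<le> 400 * real n * \<zeta>" by (intro mult_left_mono) auto
      then show "400 * real n * x \<le> \<eta>0" using \<zeta>(2) by linarith
    qed (use \<zeta> in auto)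
    then show "\<forall>\<^sub>F \<zeta>0 in at_right 0.
            \<forall>b z0. burgers_moduli n b \<and> z0 \<in> config_set \<Omega> n \<zeta>0 \<eta>0 \<and> z0 1 \<noteq> z0 2 \<longrightarrow>
               (\<exists>T. collision_time \<Omega> k b n z0 T \<and>
                    T \<le> pi * \<zeta>0\<^sup>2 * \<eta>0\<^sup>2 /
                        (2 * (\<eta>0\<^sup>2 - \<zeta>0\<^sup>2 - 2 * (real n - 2) * \<zeta>0 * \<eta>0)))"
    proof eventually_elim
      case (elim x)
      show ?case
      proof (intro allI impI)
        fix b z0 assume "burgers_moduli n b \<and> z0 \<in> config_set \<Omega> n x \<eta>0 \<and> z0 1 \<noteq> z0 2"
        then show "\<exists>T. collision_time \<Omega> k b n z0 T \<and>
            T \<le> pi * x\<^sup>2 * \<eta>0\<^sup>2 / (2 * (\<eta>0\<^sup>2 - x\<^sup>2 - 2 * (real n - 2) * x * \<eta>0))"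
          using elim by (intro main) auto
      qed
    qed
  qed
qed

end
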